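(* Let $P$ be a pseudo-injective polynomial over the permutations with seed $g$ and let $B$ be a permutation, both given in the compact encoding. Then the equation $P(X)=B$ (unknown permutation $X$) can be solved in time $O\big(c^2\log(cp)\log q + c\log p\,(\log\log p)\big)$, where $c$ is the sum of the lengths of the arrays encoding each coefficient of $P$ and $B$, $p$ is the greatest cycle length of $B$, and $q$ is the greatest multiplicity of a cycle in $B$.
   Context: A permutation is a finite set with a bijection on it, up to isomorphism, i.e. a multiset of cycles $C_\ell$ (cycle of length $\ell$). Sum is disjoint union; product is the direct product of digraphs, so that $C_a C_b=\gcd(a,b)\,C_{\lcm(a,b)}$. A polynomial $P(X)=\sum_{i=0}^m A_iX^i$ has permutation coefficients; it is pseudo-injective with seed $g$ if $g$ is the smallest cycle length occurring among $A_1,\dots,A_m$ and every cycle length occurring among $A_1,\dots,A_m$ is a multiple of $g$. Compact encoding: a permutation is an array of pairs $(n,\ell)$ meaning $n$ copies of the cycle $C_\ell$; a polynomial $A_{1}X^{p_1}+\dots+A_{r}X^{p_r}$ with nonzero coefficients is an array of pairs $(p_i,A_i)$. Solving means deciding whether a solution exists and computing one. The four basic arithmetic operations on integers are assumed to take constant time. *)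

theory Defs
  imports
    Complex_Main
    "HOL-Library.Multiset"
    "HOL-Computational_Algebra.Polynomial"
    "HOL-Combinatorics.Orbits"
begin

section \<open>The semiring of permutations\<close>

text \<open>
  A permutation up to isomorphism is the multiset of its cycle lengths. That the operations
  below are disjoint union and direct product is checked in \<open>cycle_type_sum\<close> and
  \<open>cycle_type_prod\<close>.
\<close>

typedef permutation = "{M :: nat multiset. 0 \<notin># M}"
  morphisms cycles Abs_permutation
  by (rule exI[of _ "{#}"]) simp

setup_lifting type_definition_permutation

definition cyc_prod :: "nat multiset \<Rightarrow> nat multiset \<Rightarrow> nat multiset" where
  "cyc_prod M N = (\<Sum>a\<in>#M. \<Sum>b\<in>#N. replicate_mset (gcd a b) (lcm a b))"

lemma cyc_prod_empty [simp]: "cyc_prod {#} N = {#}" "cyc_prod M {#} = {#}"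
  by (simp_all add: cyc_prod_def)

lemma cyc_prod_add_left: "cyc_prod (M + M') N = cyc_prod M N + cyc_prod M' N"
  by (simp add: cyc_prod_def)

lemma cyc_prod_commute: "cyc_prod M N = cyc_prod N M"
  unfolding cyc_prod_def by (subst sum_mset.swap) (simp add: gcd.commute lcm.commute)

lemma cyc_prod_add_right: "cyc_prod M (N + N') = cyc_prod M N + cyc_prod M N'"
  by (metis cyc_prod_commute cyc_prod_add_left)

lemma cyc_prod_single: "cyc_prod {#a#} {#b#} = replicate_mset (gcd a b) (lcm a b)"
  by (simp add: cyc_prod_def)

lemma cyc_prod_replicate_left:
  "cyc_prod (replicate_mset n a) {#b#} = replicate_mset (n * gcd a b) (lcm a b)"
proof (induction n)
  case (Suc n)
  have "cyc_prod (replicate_mset (Suc n) a) {#b#}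
      = cyc_prod ({#a#} + replicate_mset n a) {#b#}" by simp
  also have "\<dots> = replicate_mset (gcd a b) (lcm a b) + replicate_mset (n * gcd a b) (lcm a b)"
    by (simp only: cyc_prod_add_left Suc.IH cyc_prod_single)
  finally show ?case by (simp add: multiset_eq_iff)
qed simp

lemma gcd_lcm_assoc: "gcd a b * gcd (lcm a b) c = gcd b c * gcd a (lcm b c)" for a b c :: nat
proof (cases "a = 0 \<or> b = 0 \<or> c = 0")
  case False
  then have nz: "lcm (lcm a b) c \<noteq> 0" by (simp add: lcm_eq_0_iff)
  have "gcd a b * gcd (lcm a b) c * lcm (lcm a b) c = gcd a b * (lcm a b * c)"
    by (metis mult.assoc prod_gcd_lcm_nat)
  also have "\<dots> = a * b * c" by (metis mult.assoc prod_gcd_lcm_nat)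
  finally have 1: "gcd a b * gcd (lcm a b) c * lcm (lcm a b) c = a * b * c" .
  have "gcd b c * gcd a (lcm b c) * lcm a (lcm b c) = gcd b c * (a * lcm b c)"
    by (metis mult.assoc prod_gcd_lcm_nat)
  also have "\<dots> = a * (gcd b c * lcm b c)" by (simp only: ac_simps)
  also have "\<dots> = a * b * c" by (simp only: prod_gcd_lcm_nat[symmetric] mult.assoc)
  finally have 2: "gcd b c * gcd a (lcm b c) * lcm a (lcm b c) = a * b * c" .
  from 1 2 nz show ?thesis by (metis lcm.assoc mult_cancel2)
qed (auto simp: mult.commute gcd.commute)

lemma cyc_prod_assoc: "cyc_prod (cyc_prod L M) N = cyc_prod L (cyc_prod M N)"
proof -
  have s: "cyc_prod (cyc_prod {#a#} {#b#}) {#c#} = cyc_prod {#a#} (cyc_prod {#b#} {#c#})" for a b c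
  proof -
    have "cyc_prod {#a#} (cyc_prod {#b#} {#c#}) = cyc_prod (replicate_mset (gcd b c) (lcm b c)) {#a#}"
      by (metis cyc_prod_commute cyc_prod_single)
    also have "\<dots> = replicate_mset (gcd b c * gcd a (lcm b c)) (lcm (lcm a b) c)"
      by (simp add: cyc_prod_replicate_left ac_simps)
    finally show ?thesis
      by (simp add: cyc_prod_single cyc_prod_replicate_left gcd_lcm_assoc)
  qed
  have t: "cyc_prod (cyc_prod {#a#} {#b#}) N = cyc_prod {#a#} (cyc_prod {#b#} N)" for a b
  proof (induction N)
    case (add x N)
    then show ?case
      by (simp only: add_mset_add_single[of x N] cyc_prod_add_right s)
  qed simp
  have u: "cyc_prod (cyc_prod {#a#} M) N = cyc_prod {#a#} (cyc_prod M N)" for a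
  proof (induction M)
    case (add x M)
    then show ?case
      by (simp only: add_mset_add_single[of x M] cyc_prod_add_right cyc_prod_add_left t)
  qed simp
  show ?thesis
  proof (induction L)
    case (add x L)
    then show ?case
      by (simp only: add_mset_add_single[of x L] cyc_prod_add_left u)
  qed simp
qed

lemma cyc_prod_one: "cyc_prod {#1#} M = M"
proof (induction M)
  case (add x M)
  have "cyc_prod {#1#} {#x#} = {#x#}" by (simp add: cyc_prod_single)
  with add show ?case by (simp only: add_mset_add_single[of x M] cyc_prod_add_right)
qed simp

instantiation permutation :: comm_semiring_1
begin

lift_definition zero_permutation :: permutation is "{#}" by simp

lift_definition one_permutation :: permutation is "{#1#}" by simp

lift_definition plus_permutation :: "permutation \<Rightarrow> permutation \<Rightarrow> permutation" is "(+)"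
  by simp

lift_definition times_permutation :: "permutation \<Rightarrow> permutation \<Rightarrow> permutation" is cyc_prod
  by (auto simp: cyc_prod_def) (metis gr0I)+

instance
proof
  fix a b c :: permutation
  show "a + b + c = a + (b + c)" "a + b = b + a" "0 + a = a"
    by (transfer, simp add: ac_simps)+
  show "a * b * c = a * (b * c)" by transfer (rule cyc_prod_assoc)
  show "a * b = b * a" by transfer (rule cyc_prod_commute)
  show "1 * a = a" by transfer (rule cyc_prod_one)
  show "(a + b) * c = a * c + b * c" by transfer (rule cyc_prod_add_left)
  show "0 * a = 0" "a * 0 = 0" "(0::permutation) \<noteq> 1" by (transfer, simp)+
qed

end

text \<open>\<open>cycle l\<close> is the cycle of length \<open>l\<close>; it is meaningful only for \<open>l > 0\<close>.\<close>

lift_definition cycle :: "nat \<Rightarrow> permutation" is "\<lambda>l. if l = 0 then {#} else {#l#}"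
  by simp

lemma cycle_times_cycle:
  assumes "0 < a" "0 < b"
  shows "cycle a * cycle b = of_nat (gcd a b) * cycle (lcm a b)"
proof -
  have *: "cycles (of_nat n * cycle l) = replicate_mset n l" if "0 < l" for n l
  proof (induction n)
    case (Suc n)
    have "cycles (of_nat (Suc n) * cycle l) = cycles (cycle l + of_nat n * cycle l)"
      by (simp only: of_nat_Suc distrib_right mult_1_left)
    also have "\<dots> = cycles (cycle l) + replicate_mset n l"
      by (simp only: plus_permutation.rep_eq Suc.IH)
    finally show ?case using that by (simp only: cycle.rep_eq) simp
  qed (simp add: zero_permutation.rep_eq)
  have "cycles (cycle a * cycle b) = replicate_mset (gcd a b) (lcm a b)"
    using assms by (simp only: times_permutation.rep_eq cycle.rep_eq) (simp add: cyc_prod_single)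
  also have "\<dots> = cycles (of_nat (gcd a b) * cycle (lcm a b))"
    using assms by (intro *[symmetric] lcm_pos_nat)
  finally show ?thesis by (rule cycles_inject[THEN iffD1])
qed

abbreviation cycle_lengths :: "permutation \<Rightarrow> nat set" where
  "cycle_lengths A \<equiv> set_mset (cycles A)"

abbreviation multiplicity_of :: "permutation \<Rightarrow> nat \<Rightarrow> nat" where
  "multiplicity_of A l \<equiv> count (cycles A) l"

subsection \<open>Agreement with bijections on finite sets\<close>

definition orbits_on :: "('a \<Rightarrow> 'a) \<Rightarrow> 'a set \<Rightarrow> 'a set set" where
  "orbits_on f S = orbit f ` S"

definition cycle_type :: "('a \<Rightarrow> 'a) \<Rightarrow> 'a set \<Rightarrow> permutation" where
  "cycle_type f S = Abs_permutation (image_mset card (mset_set (orbits_on f S)))"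

lemma orbit_bij:
  assumes "finite S" "bij_betw f S S" "x \<in> S"
  shows "orbit f x \<subseteq> S" "x \<in> orbit f x" "finite (orbit f x)"
proof -
  have st: "\<And>y. y \<in> S \<Longrightarrow> f y \<in> S" using assms(2) by (auto simp: bij_betw_def)
  show sub: "orbit f x \<subseteq> S"
  proof
    fix y assume "y \<in> orbit f x"
    then show "y \<in> S" by induction (auto intro: st assms(3))
  qed
  show "finite (orbit f x)" using sub assms(1) finite_subset by blast
  have pw: "\<And>k. (f ^^ k) x \<in> S" by (induct_tac k) (auto intro: st assms(3))
  have inj: "\<And>k. inj_on (f ^^ k) S"
  proof -
    fix k have "bij_betw (f ^^ k) S S"
    proof (induction k)
      case (Suc k)
      show ?case using bij_betw_trans[OF Suc assms(2)] by (simp add: comp_def)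
    qed (simp add: bij_betw_def)
    then show "inj_on (f ^^ k) S" by (rule bij_betw_imp_inj_on)
  qed
  have "finite (range (\<lambda>k. (f ^^ k) x))"
    by (rule finite_subset[OF _ assms(1)]) (use pw in auto)
  then have "\<not> inj (\<lambda>k. (f ^^ k) x)"
    using finite_imageD infinite_UNIV_nat by blast
  then obtain i' j' where "i' \<noteq> j'" "(f ^^ i') x = (f ^^ j') x"
    unfolding inj_def by blast
  then obtain i j where ij: "i < j" "(f ^^ i) x = (f ^^ j) x"
    by (cases "i' < j'") (auto simp: not_less le_less)
  have "(f ^^ i) ((f ^^ (j - i)) x) = (f ^^ (i + (j - i))) x"
    by (simp only: funpow_add comp_apply)
  then have "(f ^^ i) ((f ^^ (j - i)) x) = (f ^^ i) x" using ij by simp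
  then have "(f ^^ (j - i)) x = x"
    by (rule inj_onD[OF inj]) (use pw assms(3) in auto)
  with ij show "x \<in> orbit f x"
    unfolding orbit_altdef by (intro CollectI exI[of _ "j - i"]) simp
qed

lemma orbit_period:
  assumes "x \<in> orbit f x"
  shows "(f ^^ k) x = x \<longleftrightarrow> card (orbit f x) dvd k"
proof -
  define n where "n = funpow_dist1 f x x"
  have n: "(f ^^ n) x = x" unfolding n_def using assms by (rule funpow_dist1_prop)
  have inj: "inj_on (\<lambda>m. (f ^^ m) x) {0..<n}"
    unfolding n_def using assms by (rule inj_on_funpow_dist1)
  have "orbit f x = (\<lambda>m. (f ^^ m) x) ` {0..<n}"
    unfolding n_def using assms by (rule orbit_conv_funpow_dist1)
  then have card: "card (orbit f x) = n" using inj by (simp add: card_image)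
  have pos: "0 < n" by (simp add: n_def)
  have "(f ^^ k) x = (f ^^ (k mod n)) x" using funpow_mod_eq[OF n] by metis
  moreover have "(f ^^ (k mod n)) x = x \<longleftrightarrow> k mod n = 0"
    using inj_onD[OF inj, of "k mod n" 0] pos by auto
  ultimately show ?thesis by (simp add: card dvd_eq_mod_eq_0)
qed

lemma orbit_same:
  assumes "finite S" "bij_betw f S S" "x \<in> S" "y \<in> orbit f x"
  shows "orbit f y = orbit f x"
proof -
  have "cyclic_on f (orbit f x)"
    using orbit_bij(2)[OF assms(1-3)] unfolding cyclic_on_def by blast
  then show ?thesis using assms(4) by (metis orbit_cyclic_eq3)
qed

lemma cycles_cycle_type:
  assumes "finite S" "bij_betw f S S"
  shows "cycles (cycle_type f S) = image_mset card (mset_set (orbits_on f S))"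
proof -
  have "card W \<noteq> 0" if "W \<in> orbits_on f S" for W
    using that orbit_bij[OF assms] by (auto simp: orbits_on_def card_gt_0_iff orbit_nonempty)
  moreover have "finite (orbits_on f S)" using assms(1) by (simp add: orbits_on_def)
  ultimately have "0 \<notin># image_mset card (mset_set (orbits_on f S))"
    by force
  then show ?thesis
    unfolding cycle_type_def by (intro Abs_permutation_inverse CollectI)
qed

lemma cycle_type_sum:
  fixes f :: "'a \<Rightarrow> 'a" and g :: "'b \<Rightarrow> 'b"
  assumes S: "finite S" "bij_betw f S S" and T: "finite T" "bij_betw g T T"
  shows "cycle_type (map_sum f g) (S <+> T) = cycle_type f S + cycle_type g T"
proof -
  let ?h = "map_sum f g" and ?inl = "Inl :: 'a \<Rightarrow> 'a + 'b" and ?inr = "Inr :: 'b \<Rightarrow> 'a + 'b"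
  have pl: "(?h ^^ n) (Inl x) = Inl ((f ^^ n) x)" for n x by (induction n) auto
  have pr: "(?h ^^ n) (Inr x) = Inr ((g ^^ n) x)" for n x by (induction n) auto
  have ol: "orbit ?h (Inl x) = Inl ` orbit f x" for x by (auto simp: orbit_altdef pl)
  have ori: "orbit ?h (Inr x) = Inr ` orbit g x" for x by (auto simp: orbit_altdef pr)
  have orb: "orbits_on ?h (S <+> T) = image ?inl ` orbits_on f S \<union> image ?inr ` orbits_on g T"
    by (simp add: orbits_on_def ol ori Plus_def image_Un image_image)
  have disj: "image ?inl ` orbits_on f S \<inter> image ?inr ` orbits_on g T = {}"
  proof (rule equals0I)
    fix W assume "W \<in> image ?inl ` orbits_on f S \<inter> image ?inr ` orbits_on g T"
    then obtain x y where W: "W = Inl ` orbit f x" "W = Inr ` orbit g y"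
      unfolding orbits_on_def by blast
    obtain z where "z \<in> orbit f x" using orbit_nonempty[of f x] by blast
    then have "Inl z \<in> W" using W(1) by blast
    then show False using W(2) by blast
  qed
  have fin: "finite (orbits_on f S)" "finite (orbits_on g T)" "finite (S <+> T)"
    using S(1) T(1) by (simp_all add: orbits_on_def)
  have "?h ` (S <+> T) = f ` S <+> g ` T"
    by (simp add: Plus_def image_Un image_image)
  moreover have "inj_on ?h (S <+> T)"
    by (rule inj_onI) (auto elim!: PlusE dest: inj_onD[OF bij_betw_imp_inj_on[OF S(2)]]
        inj_onD[OF bij_betw_imp_inj_on[OF T(2)]])
  ultimately have bij: "bij_betw ?h (S <+> T) (S <+> T)"
    using bij_betw_imp_surj_on[OF S(2)] bij_betw_imp_surj_on[OF T(2)] unfolding bij_betw_def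
    by simp
  have il: "mset_set (image ?inl ` X) = image_mset (image ?inl) (mset_set X)" for X :: "'a set set"
    by (rule image_mset_mset_set[symmetric]) (simp add: inj_on_def inj_image_eq_iff)
  have ir: "mset_set (image ?inr ` Y) = image_mset (image ?inr) (mset_set Y)" for Y :: "'b set set"
    by (rule image_mset_mset_set[symmetric]) (simp add: inj_on_def inj_image_eq_iff)
  have "cycles (cycle_type ?h (S <+> T))
      = image_mset card (mset_set (image ?inl ` orbits_on f S))
        + image_mset card (mset_set (image ?inr ` orbits_on g T))"
    unfolding cycles_cycle_type[OF fin(3) bij] orb
    using disj fin by (simp add: mset_set_Union)
  also have "\<dots> = image_mset card (mset_set (orbits_on f S)) + image_mset card (mset_set (orbits_on g T))"
    unfolding il ir image_mset.compositionality comp_def by (simp add: card_image)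
  also have "\<dots> = cycles (cycle_type f S + cycle_type g T)"
    by (simp add: cycles_cycle_type[OF S] cycles_cycle_type[OF T] plus_permutation.rep_eq)
  finally show ?thesis by (rule cycles_inject[THEN iffD1])
qed

lemma mset_set_UN_disjoint:
  assumes "finite I" "\<And>i. i \<in> I \<Longrightarrow> finite (A i)"
    "\<And>i j. i \<in> I \<Longrightarrow> j \<in> I \<Longrightarrow> i \<noteq> j \<Longrightarrow> A i \<inter> A j = {}"
  shows "mset_set (\<Union>i\<in>I. A i) = (\<Sum>i\<in>I. mset_set (A i))"
  using assms
proof (induction I)
  case (insert i I)
  have "A i \<inter> (\<Union>i\<in>I. A i) = {}" using insert.hyps insert.prems(2) by blast
  then show ?case using insert by (simp add: mset_set_Union)
qed simp

lemma cycle_type_prod: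
  assumes S: "finite S" "bij_betw f S S" and T: "finite T" "bij_betw g T T"
  shows "cycle_type (map_prod f g) (S \<times> T) = cycle_type f S * cycle_type g T"
proof -
  let ?h = "map_prod f g"
  have pw: "(?h ^^ n) (x, y) = ((f ^^ n) x, (g ^^ n) y)" for n x y by (induction n) auto
  have fin: "finite (orbits_on f S)" "finite (orbits_on g T)" "finite (S \<times> T)"
    using S T by (auto simp: orbits_on_def)
  have bij: "bij_betw ?h (S \<times> T) (S \<times> T)"
    using S T by (simp add: bij_betw_map_prod)
  note oS = orbit_bij[OF S] and oT = orbit_bij[OF T] and oST = orbit_bij[OF fin(3) bij]
  have sub: "orbit ?h (x, y) \<subseteq> orbit f x \<times> orbit g y" for x y
    by (auto simp: orbit_altdef pw)
  have card: "card (orbit ?h (x, y)) = lcm (card (orbit f x)) (card (orbit g y))"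
    if "x \<in> S" "y \<in> T" for x y
  proof (rule dvd_antisym)
    let ?l = "lcm (card (orbit f x)) (card (orbit g y))" and ?c = "card (orbit ?h (x, y))"
    have p: "(?h ^^ k) (x, y) = (x, y) \<longleftrightarrow> ?c dvd k" for k
      by (rule orbit_period) (use oST that in auto)
    have q: "(f ^^ k) x = x \<longleftrightarrow> card (orbit f x) dvd k" "(g ^^ k) y = y \<longleftrightarrow> card (orbit g y) dvd k" for k
      using oS oT that by (auto intro!: orbit_period)
    show "?c dvd ?l" using p[of ?l] q[of ?l] by (simp add: pw)
    show "?l dvd ?c" using p[of ?c] q[of ?c] by (simp add: pw)
  qed
  have blk: "image_mset card (mset_set (orbits_on ?h (U \<times> V)))
      = replicate_mset (gcd (card U) (card V)) (lcm (card U) (card V))"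
    if U: "U \<in> orbits_on f S" and V: "V \<in> orbits_on g T" for U V
  proof -
    obtain x y where xy: "x \<in> S" "y \<in> T" "U = orbit f x" "V = orbit g y"
      using U V by (auto simp: orbits_on_def)
    have UV: "U \<subseteq> S" "V \<subseteq> T" "finite U" "finite V" "x \<in> U" "y \<in> V"
      using oS[OF xy(1)] oT[OF xy(2)] xy by simp_all
    have oU: "\<And>u. u \<in> U \<Longrightarrow> orbit f u = U" and oV: "\<And>v. v \<in> V \<Longrightarrow> orbit g v = V"
      using orbit_same[OF S] orbit_same[OF T] xy by simp_all
    let ?l = "lcm (card U) (card V)" and ?C = "orbits_on ?h (U \<times> V)"
    have cl: "card W = ?l" if W: "W \<in> ?C" for W
    proof -
      obtain u v where "u \<in> U" "v \<in> V" "W = orbit ?h (u, v)"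
        using W by (auto simp: orbits_on_def)
      then show ?thesis using card[of u v] UV oU[of u] oV[of v] by auto
    qed
    have un: "\<Union>?C = U \<times> V"
    proof
      show "\<Union>?C \<subseteq> U \<times> V"
      proof (rule Union_least)
        fix W assume "W \<in> ?C"
        then obtain u v where "u \<in> U" "v \<in> V" "W = orbit ?h (u, v)"
          by (auto simp: orbits_on_def)
        then show "W \<subseteq> U \<times> V" using sub[of u v] oU[of u] oV[of v] by simp
      qed
      show "U \<times> V \<subseteq> \<Union>?C"
      proof
        fix z assume z: "z \<in> U \<times> V"
        then have "z \<in> orbit ?h z" using UV by (intro oST(2)) auto
        then show "z \<in> \<Union>?C" using z by (auto simp: orbits_on_def)
      qed
    qed
    have "?l * card ?C = card (\<Union>?C)"
    proof (rule card_partition)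
      show "finite ?C" using UV by (simp add: orbits_on_def)
      show "finite (\<Union>?C)" using UV un by simp
      show "\<And>c. c \<in> ?C \<Longrightarrow> card c = ?l" by (rule cl)
      fix c1 c2 assume c: "c1 \<in> ?C" "c2 \<in> ?C" "c1 \<noteq> c2"
      obtain p where p: "p \<in> U \<times> V" "c1 = orbit ?h p"
        using c(1) unfolding orbits_on_def by (rule imageE)
      obtain q where q: "q \<in> U \<times> V" "c2 = orbit ?h q"
        using c(2) unfolding orbits_on_def by (rule imageE)
      have pq: "p \<in> S \<times> T" "q \<in> S \<times> T" using p(1) q(1) UV(1,2) by auto
      show "c1 \<inter> c2 = {}"
      proof (rule equals0I)
        fix z assume z: "z \<in> c1 \<inter> c2"
        have "orbit ?h z = c1" unfolding p(2)
          by (rule orbit_same[OF fin(3) bij pq(1)]) (use z p(2) in blast)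
        moreover have "orbit ?h z = c2" unfolding q(2)
          by (rule orbit_same[OF fin(3) bij pq(2)]) (use z q(2) in blast)
        ultimately show False using c(3) by simp
      qed
    qed
    also have "\<dots> = card U * card V" by (simp add: un card_cartesian_product)
    also have "\<dots> = ?l * gcd (card U) (card V)" by (subst prod_gcd_lcm_nat) (rule mult.commute)
    finally have "?l * card ?C = ?l * gcd (card U) (card V)" .
    moreover have "?l \<noteq> 0" using UV by (auto simp: lcm_eq_0_iff)
    ultimately have n: "card ?C = gcd (card U) (card V)"
      by (simp only: mult_cancel1) simp
    have "image_mset card (mset_set ?C) = image_mset (\<lambda>_. ?l) (mset_set ?C)"
      using UV by (intro image_mset_cong cl) (simp add: orbits_on_def)
    then show ?thesis by (simp add: image_mset_const_eq n)
  qed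
  let ?I = "orbits_on f S \<times> orbits_on g T"
  have orb: "orbits_on ?h (S \<times> T) = (\<Union>i\<in>?I. orbits_on ?h (fst i \<times> snd i))"
  proof
    show "orbits_on ?h (S \<times> T) \<subseteq> (\<Union>i\<in>?I. orbits_on ?h (fst i \<times> snd i))"
    proof
      fix W assume "W \<in> orbits_on ?h (S \<times> T)"
      then obtain x y where "x \<in> S" "y \<in> T" "W = orbit ?h (x, y)"
        by (auto simp: orbits_on_def)
      then have "(orbit f x, orbit g y) \<in> ?I" "W \<in> orbits_on ?h (orbit f x \<times> orbit g y)"
        using oS(2) oT(2) by (auto simp: orbits_on_def)
      then show "W \<in> (\<Union>i\<in>?I. orbits_on ?h (fst i \<times> snd i))" by force
    qed
    show "(\<Union>i\<in>?I. orbits_on ?h (fst i \<times> snd i)) \<subseteq> orbits_on ?h (S \<times> T)"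
    proof (rule UN_least)
      fix i assume "i \<in> ?I"
      then obtain x y where "x \<in> S" "y \<in> T" "i = (orbit f x, orbit g y)"
        by (auto simp: orbits_on_def)
      then have "fst i \<subseteq> S" "snd i \<subseteq> T" using oS(1)[of x] oT(1)[of y] by simp_all
      then show "orbits_on ?h (fst i \<times> snd i) \<subseteq> orbits_on ?h (S \<times> T)"
        unfolding orbits_on_def by (intro image_mono Sigma_mono)
    qed
  qed
  have finI: "finite (orbits_on ?h (fst i \<times> snd i))" if "i \<in> ?I" for i
    using that oS(3) oT(3) by (auto simp: orbits_on_def)
  have disj: "orbits_on ?h (fst i \<times> snd i) \<inter> orbits_on ?h (fst j \<times> snd j) = {}"
    if i: "i \<in> ?I" "j \<in> ?I" "i \<noteq> j" for i j
  proof (rule equals0I)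
    have eq: "orbit f u = W" if "W \<in> orbits_on f S" "u \<in> W" for u W
      using that orbit_same[OF S] by (auto simp: orbits_on_def)
    have eq': "orbit g u = W" if "W \<in> orbits_on g T" "u \<in> W" for u W
      using that orbit_same[OF T] by (auto simp: orbits_on_def)
    have ij: "fst i \<in> orbits_on f S" "snd i \<in> orbits_on g T"
      "fst j \<in> orbits_on f S" "snd j \<in> orbits_on g T" using i by auto
    fix W assume W: "W \<in> orbits_on ?h (fst i \<times> snd i) \<inter> orbits_on ?h (fst j \<times> snd j)"
    obtain x y where p: "x \<in> fst i" "y \<in> snd i" "W = orbit ?h (x, y)"
      using W by (auto simp: orbits_on_def)
    obtain x' y' where p': "x' \<in> fst j" "y' \<in> snd j" "W = orbit ?h (x', y')"
      using W by (auto simp: orbits_on_def)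
    obtain z w where zw: "(z, w) \<in> W"
      using p(3) orbit_nonempty[of ?h "(x, y)"] by fastforce
    have "z \<in> fst i" "w \<in> snd i"
      using zw p sub[of x y] eq[OF ij(1) p(1)] eq'[OF ij(2) p(2)] by auto
    moreover have "z \<in> fst j" "w \<in> snd j"
      using zw p' sub[of x' y'] eq[OF ij(3) p'(1)] eq'[OF ij(4) p'(2)] by auto
    ultimately have "fst i = fst j" "snd i = snd j"
      using eq eq' ij by metis+
    then show False using i(3) by (simp add: prod_eq_iff)
  qed
  have finII: "finite ?I" using fin by simp
  have "cycles (cycle_type ?h (S \<times> T))
      = image_mset card (\<Sum>i\<in>?I. mset_set (orbits_on ?h (fst i \<times> snd i)))"
    unfolding cycles_cycle_type[OF fin(3) bij] orb
    by (subst mset_set_UN_disjoint[OF finII finI disj]) simp_all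
  also have "\<dots> = (\<Sum>i\<in>?I. image_mset card (mset_set (orbits_on ?h (fst i \<times> snd i))))"
    using finII by (induction rule: finite_induct) simp_all
  also have "\<dots> = (\<Sum>i\<in>?I. replicate_mset (gcd (card (fst i)) (card (snd i))) (lcm (card (fst i)) (card (snd i))))"
    by (rule sum.cong) (auto simp: blk)
  also have "\<dots> = (\<Sum>U\<in>orbits_on f S. \<Sum>V\<in>orbits_on g T.
      replicate_mset (gcd (card U) (card V)) (lcm (card U) (card V)))"
    by (simp add: sum.cartesian_product case_prod_unfold)
  also have "\<dots> = cycles (cycle_type f S * cycle_type g T)"
    unfolding times_permutation.rep_eq cycles_cycle_type[OF S] cycles_cycle_type[OF T] cyc_prod_def
      image_mset.compositionality comp_def sum_unfold_sum_mset ..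
  finally show ?thesis by (rule cycles_inject[THEN iffD1])
qed

section \<open>Pseudo-injective polynomials\<close>

definition nonconst_cycle_lengths :: "permutation poly \<Rightarrow> nat set" where
  "nonconst_cycle_lengths P = (\<Union>i\<in>{1..degree P}. cycle_lengths (coeff P i))"

definition pseudo_injective :: "permutation poly \<Rightarrow> nat \<Rightarrow> bool" where
  "pseudo_injective P g \<longleftrightarrow>
     g \<in> nonconst_cycle_lengths P \<and> (\<forall>l \<in> nonconst_cycle_lengths P. g \<le> l \<and> g dvd l)"

section \<open>Compact encoding\<close>

type_synonym perm_code = "(nat \<times> nat) list"
type_synonym poly_code = "(nat \<times> perm_code) list"

definition encodes_perm :: "perm_code \<Rightarrow> permutation \<Rightarrow> bool" where
  "encodes_perm as A \<longleftrightarrow>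
     (\<forall>(n, l) \<in> set as. 0 < n \<and> 0 < l) \<and> A = (\<Sum>(n, l)\<leftarrow>as. of_nat n * cycle l)"

definition encodes_poly :: "poly_code \<Rightarrow> permutation poly \<Rightarrow> bool" where
  "encodes_poly ps P \<longleftrightarrow>
     distinct (map fst ps) \<and>
     (\<forall>(i, as) \<in> set ps. coeff P i \<noteq> 0 \<and> encodes_perm as (coeff P i)) \<and>
     (\<forall>i. coeff P i \<noteq> 0 \<longrightarrow> i \<in> fst ` set ps)"

definition code_size :: "poly_code \<Rightarrow> perm_code \<Rightarrow> nat" where
  "code_size ps bs = (\<Sum>(i, as)\<leftarrow>ps. length as) + length bs"

text \<open>The empty permutation has maximal cycle length and maximal multiplicity \<open>0\<close>.\<close>

definition max_length :: "permutation \<Rightarrow> nat" where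
  "max_length B = Max (insert 0 (cycle_lengths B))"

definition max_multiplicity :: "permutation \<Rightarrow> nat" where
  "max_multiplicity B = Max (insert 0 (multiplicity_of B ` cycle_lengths B))"

text \<open>
  Inside an O-bound a logarithm is never smaller than 1. Otherwise the bound of the theorem,
  with greatest cycle length and greatest multiplicity equal to 1, would not even leave time to
  read the input.
\<close>

definition lg :: "real \<Rightarrow> real" where
  "lg x = max 1 (log 2 x)"

section \<open>Machine model\<close>

text \<open>
  Unit-cost integer RAM programs in structured form. The memory consists of named arrays indexed
  by integers, finitely many of which occur in a program. Every constant, array access,
  arithmetic operation and comparison costs one step. Division is \<open>div\<close> on \<open>int\<close>.
\<close>

type_synonym memory = "string \<Rightarrow> int \<Rightarrow> int"

datatype aexp =
    Const int
  | Read string aexp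
  | Plus aexp aexp
  | Minus aexp aexp
  | Times aexp aexp
  | Divide aexp aexp

fun aval :: "aexp \<Rightarrow> memory \<Rightarrow> int" where
  "aval (Const k) s = k"
| "aval (Read x e) s = s x (aval e s)"
| "aval (Plus e1 e2) s = aval e1 s + aval e2 s"
| "aval (Minus e1 e2) s = aval e1 s - aval e2 s"
| "aval (Times e1 e2) s = aval e1 s * aval e2 s"
| "aval (Divide e1 e2) s = aval e1 s div aval e2 s"

fun acost :: "aexp \<Rightarrow> nat" where
  "acost (Const k) = 1"
| "acost (Read x e) = 1 + acost e"
| "acost (Plus e1 e2) = 1 + acost e1 + acost e2"
| "acost (Minus e1 e2) = 1 + acost e1 + acost e2"
| "acost (Times e1 e2) = 1 + acost e1 + acost e2"
| "acost (Divide e1 e2) = 1 + acost e1 + acost e2"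

datatype bexp = Less aexp aexp | Neg bexp | Conj bexp bexp

fun bval :: "bexp \<Rightarrow> memory \<Rightarrow> bool" where
  "bval (Less e1 e2) s \<longleftrightarrow> aval e1 s < aval e2 s"
| "bval (Neg b) s \<longleftrightarrow> \<not> bval b s"
| "bval (Conj b1 b2) s \<longleftrightarrow> bval b1 s \<and> bval b2 s"

fun bcost :: "bexp \<Rightarrow> nat" where
  "bcost (Less e1 e2) = 1 + acost e1 + acost e2"
| "bcost (Neg b) = 1 + bcost b"
| "bcost (Conj b1 b2) = 1 + bcost b1 + bcost b2"

datatype com =
    Skip
  | Write string aexp aexp
  | Seq com com
  | Cond bexp com com
  | While bexp com

text \<open>\<open>run C s t s'\<close>: started in memory \<open>s\<close>, program \<open>C\<close> halts after
  exactly \<open>t\<close> steps in memory \<open>s'\<close>.\<close>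

inductive run :: "com \<Rightarrow> memory \<Rightarrow> nat \<Rightarrow> memory \<Rightarrow> bool" where
  run_Skip: "run Skip s 1 s"
| run_Write: "run (Write x i e) s (1 + acost i + acost e) (s(x := (s x)(aval i s := aval e s)))"
| run_Seq: "\<lbrakk>run C1 s t1 s1; run C2 s1 t2 s2\<rbrakk> \<Longrightarrow> run (Seq C1 C2) s (t1 + t2) s2"
| run_CondT: "\<lbrakk>bval b s; run C1 s t s'\<rbrakk> \<Longrightarrow> run (Cond b C1 C2) s (1 + bcost b + t) s'"
| run_CondF: "\<lbrakk>\<not> bval b s; run C2 s t s'\<rbrakk> \<Longrightarrow> run (Cond b C1 C2) s (1 + bcost b + t) s'"
| run_WhileF: "\<not> bval b s \<Longrightarrow> run (While b C) s (1 + bcost b) s"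
| run_WhileT: "\<lbrakk>bval b s; run C s t1 s1; run (While b C) s1 t2 s2\<rbrakk>
    \<Longrightarrow> run (While b C) s (1 + bcost b + t1 + t2) s2"

inductive_cases run_SkipE: "run Skip s t s'"
inductive_cases run_WriteE: "run (Write x i e) s t s'"
inductive_cases run_SeqE: "run (Seq C1 C2) s t s'"
inductive_cases run_CondE: "run (Cond b C1 C2) s t s'"
inductive_cases run_WhileE: "run (While b C) s t s'"

lemma run_deterministic: "run C s t s' \<Longrightarrow> run C s u s'' \<Longrightarrow> t = u \<and> s' = s''"
proof (induction arbitrary: u s'' rule: run.induct)
  case (run_Seq C1 s t1 s1 C2 t2 s2)
  from run_Seq.prems show ?case
    by (rule run_SeqE) (metis run_Seq.IH)
next
  case (run_WhileT b s C t1 s1 t2 s2)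
  from run_WhileT.prems show ?case
  proof (rule run_WhileE)
    fix t1' s1' t2'
    assume u: "u = Suc (bcost b + t1' + t2')"
      and "run C s t1' s1'" "run (While b C) s1' t2' s''"
    then have "t1 = t1'" "s1 = s1'" "t2 = t2'" "s2 = s''"
      using run_WhileT.IH(1)[of t1' s1'] run_WhileT.IH(2)[of t2' s''] by simp_all
    with u show ?thesis by simp
  qed (use run_WhileT.hyps(1) in simp)
next
  case (run_CondT b s C1 t s' C2)
  from run_CondT.prems show ?case
    by (rule run_CondE) (use run_CondT.hyps(1) run_CondT.IH in auto)
next
  case (run_CondF b s C2 t s' C1)
  from run_CondF.prems show ?case
    by (rule run_CondE) (use run_CondF.hyps(1) run_CondF.IH in auto)
next
  case (run_WhileF b s C)
  from run_WhileF.prems show ?case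
    by (rule run_WhileE) (use run_WhileF.hyps in simp_all)
qed (auto elim: run_SkipE run_WriteE)

section \<open>Input and output\<close>

text \<open>Every array is preceded by its length.\<close>

definition perm_words :: "perm_code \<Rightarrow> int list" where
  "perm_words as = int (length as) # concat (map (\<lambda>(n, l). [int n, int l]) as)"

definition poly_words :: "poly_code \<Rightarrow> int list" where
  "poly_words ps = int (length ps) # concat (map (\<lambda>(i, as). int i # perm_words as) ps)"

definition initial :: "poly_code \<Rightarrow> perm_code \<Rightarrow> memory" where
  "initial ps bs = (\<lambda>x k.
     let ws = poly_words ps @ perm_words bs
     in if x = ''input'' \<and> 0 \<le> k \<and> nat k < length ws then ws ! nat k else 0)"

definition output_starts_with :: "memory \<Rightarrow> int list \<Rightarrow> bool" where
  "output_starts_with s ws \<longleftrightarrow> (\<forall>k < length ws. s ''output'' (int k) = ws ! k)"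

text \<open>The first output word is the answer to the decision problem; if it is 1, the encoding of
  a solution follows.\<close>

definition solved :: "memory \<Rightarrow> permutation poly \<Rightarrow> permutation \<Rightarrow> bool" where
  "solved s P B \<longleftrightarrow>
     (if \<exists>X. poly P X = B
      then \<exists>X xs. poly P X = B \<and> encodes_perm xs X \<and> output_starts_with s (1 # perm_words xs)
      else output_starts_with s [0])"

end

theory Submission
  imports Defs
begin

text \<open>
  For every \<open>k\<close>, the number \<open>\<phi>\<^sub>k(A)\<close> of fixed points of the \<open>k\<close>-th power of a permutation \<open>A\<close>
  is a semiring homomorphism, and the family \<open>\<phi>\<^sub>k\<close> is injective. If \<open>g\<close> divides \<open>k\<close>, then the integer
  polynomial \<open>\<phi>\<^sub>k(P)\<close> is strictly increasing, so \<open>\<phi>\<^sub>k(X)\<close> is its unique root for the value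
  \<open>\<phi>\<^sub>k(B)\<close>; if \<open>g\<close> does not divide \<open>k\<close>, then \<open>\<phi>\<^sub>k(P)\<close> is constant. Moebius inversion over the
  cycle lengths of \<open>P\<close> and \<open>B\<close>, in increasing order, therefore yields the only possible value of
  \<open>C\<^sub>g X\<close>. A cycle length \<open>m\<close> of multiplicity \<open>z\<close> in \<open>C\<^sub>g X\<close> can be divided by \<open>C\<^sub>g\<close> iff \<open>d\<close> divides
  \<open>z\<close>, where \<open>d\<close> is the part of \<open>g\<close> built from the primes dividing \<open>m / g\<close>. The candidate solves
  the equation iff moreover all cycle lengths of \<open>P(X)\<close> occur among those of \<open>P\<close> and \<open>B\<close>; this is
  decided by propagating along \<open>n \<mapsto> lcm n t\<close>, in increasing order of \<open>n\<close>, the largest number of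
  factors \<open>X\<close> that may still be multiplied.

  All exponents can be capped at some \<open>K\<close> with \<open>\<bar>B\<bar> < 2\<^sup>K\<close> without moving a root. If \<open>e\<close> is the
  largest capped exponent, then the root is below \<open>2\<^bsup>K/e+1\<^esup>\<close>, so that a search with naive powers takes
  \<open>O(K / e)\<close> evaluations of cost \<open>O(c e)\<close>. This gives \<open>O(c\<^sup>2 K)\<close> altogether.
\<close>

section \<open>Fixed points of powers\<close>

text \<open>The equation determines \<open>cycle g * X\<close>, not \<open>X\<close>: with
  \<open>g = 2\<close>, both \<open>C_2\<close> and two copies of \<open>C_1\<close> give
  \<open>2 C_2\<close>. Since \<open>g\<close> divides every nonconstant length, \<open>P(X)\<close>
  depends on \<open>X\<close> only through that product, so any quotient by \<open>cycle g\<close>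
  will do; one cycle length per length \<open>m\<close> of the product is enough. Roots at finitely
  many \<open>k\<close> do not yet give equality: counts on a finite set separate only permutations
  whose lengths lie in that set. Hence the separate check of the support. Two quantities are not
  bounded by \<open>c\<close>, \<open>p\<close> and \<open>q\<close>: the exponents and the cycle
  lengths of \<open>P\<close>. Exponents enter the root search capped and the support check merely
  as counters. Long cycles could make a gcd expensive, so every Euclidean run has one argument known
  to be below \<open>2 ^ K\<close>: a length of positive multiplicity in the candidate, or
  \<open>g\<close> once a positive root has been found. Memory that is zero at the start serves as a
  table indexed by cycle lengths, so looking up an lcm costs one access.\<close>

definition fixed_count :: "nat \<Rightarrow> permutation \<Rightarrow> nat" where
  "fixed_count k A = (\<Sum>l\<in>#cycles A. if l dvd k then l else 0)"

lemma fixed_count_plus: "fixed_count k (A + B) = fixed_count k A + fixed_count k B"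
  by (simp add: fixed_count_def plus_permutation.rep_eq)

lemma fixed_count_0 [simp]: "fixed_count k 0 = 0"
  by (simp add: fixed_count_def zero_permutation.rep_eq)

lemma fixed_count_1 [simp]: "fixed_count k 1 = 1"
  by (simp add: fixed_count_def one_permutation.rep_eq)

text \<open>Only two single cycles need an argument: \<open>lcm a b\<close> divides \<open>k\<close>
  iff both lengths do, and then \<open>gcd a b\<close> cycles of length \<open>lcm a b\<close> carry
  \<open>a * b\<close> points. Everything else is bilinearity.\<close>

lemma fixed_count_times: "fixed_count k (A * B) = fixed_count k A * fixed_count k B"
proof -
  let ?w = "\<lambda>l::nat. if l dvd k then l else 0"
  let ?W = "\<lambda>M. \<Sum>l\<in>#M. ?w l"
  have sgl: "?W (replicate_mset (gcd a b) (lcm a b)) = ?w a * ?w b" for a b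
    by (auto simp flip: prod_gcd_lcm_nat)
  have "?W (\<Sum>b\<in>#N. replicate_mset (gcd a b) (lcm a b)) = ?w a * ?W N" for a N
  proof (induction N)
    case (add b N)
    then show ?case
      using sgl[of a b] by (simp only: image_mset_add_mset sum_mset.add_mset image_mset_union sum_mset.union distrib_left)
  qed simp
  then have "?W (cyc_prod M N) = ?W M * ?W N" for M N
  proof (induction M)
    case (add a M)
    then show ?case
      by (simp only: cyc_prod_def image_mset_add_mset sum_mset.add_mset image_mset_union sum_mset.union distrib_right)
  qed simp
  then show ?thesis by (simp add: fixed_count_def times_permutation.rep_eq)
qed

lemma fixed_count_power: "fixed_count k (A ^ n) = fixed_count k A ^ n"
  by (induction n) (simp_all add: fixed_count_times)

lemma fixed_count_of_nat [simp]: "fixed_count k (of_nat n) = n"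
  by (induction n) (simp_all add: fixed_count_plus)

lemma fixed_count_cycle: "fixed_count k (cycle l) = (if l dvd k then l else 0)"
  by (simp add: fixed_count_def cycle.rep_eq)

lemma fixed_count_sum: "fixed_count k (\<Sum>i\<in>I. f i) = (\<Sum>i\<in>I. fixed_count k (f i))"
  by (induction I rule: infinite_finite_induct) (simp_all add: fixed_count_plus)

lemma sum_mset_eq_sum_count:
  fixes w :: "'a \<Rightarrow> nat"
  assumes "finite \<Lambda>" "set_mset M \<subseteq> \<Lambda>"
  shows "(\<Sum>l\<in>#M. w l) = (\<Sum>l\<in>\<Lambda>. count M l * w l)"
  using assms(2)
proof (induction M)
  case (add x M)
  have "(\<Sum>l\<in>\<Lambda>. count (add_mset x M) l * w l)
      = (\<Sum>l\<in>\<Lambda>. (if x = l then w l else 0) + count M l * w l)"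
    by (rule sum.cong) auto
  then show ?case using add assms(1) by (simp add: sum.distrib)
qed simp

lemma fixed_count_eq_sum:
  assumes "finite \<Lambda>" "cycle_lengths A \<subseteq> \<Lambda>"
  shows "fixed_count k A = (\<Sum>l\<in>{l\<in>\<Lambda>. l dvd k}. l * multiplicity_of A l)"
proof -
  have "fixed_count k A = (\<Sum>l\<in>\<Lambda>. multiplicity_of A l * (if l dvd k then l else 0))"
    unfolding fixed_count_def by (rule sum_mset_eq_sum_count[OF assms])
  also have "\<dots> = (\<Sum>l\<in>\<Lambda>. if l dvd k then l * multiplicity_of A l else 0)"
    by (rule sum.cong) auto
  also have "\<dots> = (\<Sum>l\<in>{l\<in>\<Lambda>. l dvd k}. l * multiplicity_of A l)"
    using assms(1) by (rule sum.inter_filter[symmetric])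
  finally show ?thesis .
qed

lemma cycle_lengths_pos: "l \<in> cycle_lengths A \<Longrightarrow> 0 < l"
  using cycles[of A] by (cases l) auto

text \<open>Moebius inversion as an induction: all proper divisors of \<open>l\<close> already
  agree, so the count at \<open>l\<close> isolates \<open>l\<close> times its multiplicity. The two
  support conditions are what permits testing only \<open>k \<in> \<Lambda>\<close>.\<close>

lemma permutation_eqI:
  assumes fin: "finite \<Lambda>" and A: "cycle_lengths A \<subseteq> \<Lambda>" and B: "cycle_lengths B \<subseteq> \<Lambda>"
    and eq: "\<And>k. k \<in> \<Lambda> \<Longrightarrow> fixed_count k A = fixed_count k B"
  shows "A = B"
proof -
  have "multiplicity_of A l = multiplicity_of B l" for l
  proof (induction l rule: less_induct)
    case (less l)
    show ?case
    proof (cases "l \<in> \<Lambda> \<and> 0 < l")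
      case True
      let ?D = "{d\<in>\<Lambda>. d dvd l}"
      have "fixed_count l C = l * multiplicity_of C l + (\<Sum>d\<in>?D - {l}. d * multiplicity_of C d)"
        if "cycle_lengths C \<subseteq> \<Lambda>" for C
        unfolding fixed_count_eq_sum[OF fin that] using True fin by (subst sum.remove[of _ l]) auto
      moreover have "(\<Sum>d\<in>?D - {l}. d * multiplicity_of A d) = (\<Sum>d\<in>?D - {l}. d * multiplicity_of B d)"
        using True by (intro sum.cong refl) (metis (no_types, lifting) DiffE dvd_imp_le insertI1 le_neq_implies_less less mem_Collect_eq)
      ultimately show ?thesis using eq[of l] A B True by simp
    next
      case False
      then have "l \<notin> cycle_lengths A" "l \<notin> cycle_lengths B"
        using A B cycle_lengths_pos by blast+
      then show ?thesis by (simp add: not_in_iff)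
    qed
  qed
  then have "cycles A = cycles B" by (rule multiset_eqI)
  then show ?thesis by (simp add: cycles_inject)
qed

lemma cycle_lengths_plus [simp]: "cycle_lengths (A + B) = cycle_lengths A \<union> cycle_lengths B"
  by (simp add: plus_permutation.rep_eq)

lemma cycle_lengths_0 [simp]: "cycle_lengths 0 = {}"
  by (simp add: zero_permutation.rep_eq)

lemma in_sum_mset_iff: "y \<in># (\<Sum>x\<in>#M. f x) \<longleftrightarrow> (\<exists>x\<in>#M. y \<in># f x)"
  by (induction M) auto

lemma cycle_lengths_times:
  "l \<in> cycle_lengths (A * B) \<longleftrightarrow> (\<exists>a\<in>cycle_lengths A. \<exists>b\<in>cycle_lengths B. l = lcm a b)"
proof -
  have "gcd a b > 0" if "a \<in> cycle_lengths A" for a b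
    using cycle_lengths_pos[OF that] by simp
  then show ?thesis
    unfolding times_permutation.rep_eq cyc_prod_def in_sum_mset_iff in_replicate_mset
    by (metis (no_types))
qed

lemma cycle_lengths_cycle [simp]: "cycle_lengths (cycle l) = (if l = 0 then {} else {l})"
  by (simp add: cycle.rep_eq)

lemma cycle_lengths_of_nat_times:
  "0 < n \<Longrightarrow> cycle_lengths (of_nat n * A) = cycle_lengths A"
  by (induction n rule: nat_induct_non_zero) (auto simp: distrib_right)

lemma multiplicity_of_nat_times: "multiplicity_of (of_nat n * A) l = n * multiplicity_of A l"
  by (induction n) (simp_all add: distrib_right plus_permutation.rep_eq zero_permutation.rep_eq)

lemma multiplicity_sum: "multiplicity_of (\<Sum>i\<in>I. f i) l = (\<Sum>i\<in>I. multiplicity_of (f i) l)"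
  by (induction I rule: infinite_finite_induct)
    (simp_all add: plus_permutation.rep_eq zero_permutation.rep_eq)

lemma count_sum_mset: "count (\<Sum>x\<in>#M. f x) m = (\<Sum>x\<in>#M. count (f x) m)"
  by (induction M) simp_all

lemma multiplicity_cycle_times:
  "0 < g \<Longrightarrow> multiplicity_of (cycle g * X) m = (\<Sum>x\<in>#cycles X. if lcm g x = m then gcd g x else 0)"
  by (simp add: times_permutation.rep_eq cycle.rep_eq cyc_prod_def count_sum_mset eq_commute[of m])

section \<open>Division by a cycle\<close>

text \<open>The part of \<open>g\<close> built from the primes dividing \<open>e\<close>; the power stabilizes since each
  proper step at least doubles the gcd.\<close>

definition absorbed :: "nat \<Rightarrow> nat \<Rightarrow> nat" where
  "absorbed g e = gcd g (e ^ g)"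

lemma gcd_mult_gcd_nat: "gcd g (gcd g a * e) = gcd g (a * e)" for g a e :: nat
proof -
  have "gcd g (gcd g a * e) = gcd g (gcd (g * e) (a * e))" by (metis gcd_mult_distrib_nat mult.commute)
  also have "\<dots> = gcd (gcd g (g * e)) (a * e)" by (simp only: gcd.assoc)
  finally show ?thesis by simp
qed

lemma gcd_power_Suc: "gcd g (gcd g (e ^ j) * e) = gcd g (e ^ Suc j)" for g e :: nat
  by (simp only: gcd_mult_gcd_nat power_Suc2)

text \<open>Each gcd determines the next one by \<open>gcd_power_Suc\<close>, so a single stationary
  step makes all later ones stationary; and \<open>K + 1\<close> proper steps would push the gcd
  above \<open>g\<close>.\<close>

lemma gcd_power_stable:
  fixes g e :: nat
  assumes "0 < g" "g < 2 ^ Suc K" "K \<le> n"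
  shows "gcd g (e ^ n) = gcd g (e ^ K)"
proof -
  let ?a = "\<lambda>j. gcd g (e ^ j)"
  have step: "?a (Suc j) = gcd g (?a j * e)" for j by (rule gcd_power_Suc[symmetric])
  have mono: "?a j dvd ?a (Suc j)" for j by (simp add: step dvd_mult2)
  have "\<exists>j\<le>K. ?a (Suc j) = ?a j"
  proof (rule ccontr)
    assume *: "\<not> ?thesis"
    have "j \<le> Suc K \<Longrightarrow> 2 ^ j \<le> ?a j" for j
    proof (induction j)
      case (Suc j)
      then have ne: "?a (Suc j) \<noteq> ?a j" using * by auto
      obtain c where c: "?a (Suc j) = ?a j * c" using mono[of j] by (rule dvdE)
      have "c \<noteq> 0" using c assms(1) by (metis gcd_eq_0_iff mult_0_right not_gr0)
      moreover have "c \<noteq> 1" using c ne by auto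
      ultimately have "2 \<le> c" by simp
      then show ?case using Suc c by (simp add: mult.commute mult_le_mono)
    qed (use assms in simp)
    then have "2 ^ Suc K \<le> ?a (Suc K)" by blast
    moreover have "?a (Suc K) \<le> g" using assms(1) by (simp add: dvd_imp_le)
    ultimately show False using assms(2) by linarith
  qed
  then obtain j where j: "j \<le> K" "?a (Suc j) = ?a j" by blast
  have "?a (j + i) = ?a j" for i
  proof (induction i)
    case (Suc i)
    then show ?case using step[of "j + i"] step[of j] j(2) by (simp del: power_Suc)
  qed simp
  from this[of "n - j"] this[of "K - j"] show ?thesis using j assms(3) by simp
qed

text \<open>Frees the value from the exponent in its definition: any exponent with
  \<open>g < 2 ^ K\<close> will do, which brings it within reach of repeated squaring.\<close>

lemma absorbed_eq:
  assumes "0 < g" "g < 2 ^ K"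
  shows "absorbed g e = gcd g (e ^ K)"
proof -
  \<comment> \<open>Both exponents are compared with a common larger one, because stability is
    stated only upwards.\<close>
  have "gcd g (e ^ max g K) = gcd g (e ^ K)" using assms by (intro gcd_power_stable) auto
  moreover have "gcd g (e ^ max g K) = gcd g (e ^ g)"
    using assms(1) by (intro gcd_power_stable) (auto intro: less_trans[OF less_exp])
  ultimately show ?thesis by (simp add: absorbed_def)
qed

lemma absorbed_pos: "0 < g \<Longrightarrow> 0 < absorbed g e"
  by (simp add: absorbed_def)

text \<open>Together with \<open>lcm_absorbed\<close> this makes
  \<open>cycle g * cycle (d * e)\<close> equal to \<open>d\<close> copies of
  \<open>cycle (g * e)\<close> for \<open>d = absorbed g e\<close>: the quotient by
  \<open>cycle g\<close> is explicit.\<close>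

lemma gcd_absorbed:
  assumes "0 < g" shows "gcd g (absorbed g e * e) = absorbed g e"
proof -
  have "gcd g (absorbed g e * e) = gcd g (e ^ Suc g)"
    unfolding absorbed_def by (rule gcd_power_Suc)
  also have "\<dots> = gcd g (e ^ g)"
    using assms by (intro gcd_power_stable) (auto intro: less_trans[OF less_exp])
  finally show ?thesis by (simp add: absorbed_def)
qed

lemma lcm_absorbed:
  assumes "0 < g" shows "lcm g (absorbed g e * e) = g * e"
proof -
  have "absorbed g e * lcm g (absorbed g e * e) = g * (absorbed g e * e)"
    using prod_gcd_lcm_nat[of g "absorbed g e * e"] by (simp only: gcd_absorbed[OF assms, of e])
  also have "\<dots> = absorbed g e * (g * e)" by (simp only: ac_simps)
  finally show ?thesis using absorbed_pos[OF assms, of e] by (metis mult_left_cancel not_gr0)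
qed

text \<open>The optimality of \<open>absorbed\<close>. For \<open>h = gcd g x\<close> the hypothesis
  gives \<open>x = h * e\<close>, so multiplying \<open>h\<close> by \<open>e\<close> adds nothing
  to its gcd with \<open>g\<close>; inductively, \<open>h\<close> swallows every
  \<open>gcd g (e ^ j)\<close>.\<close>

lemma absorbed_dvd_gcd:
  assumes "0 < g" "lcm g x = g * e"
  shows "absorbed g e dvd gcd g x"
proof -
  define h where "h = gcd g x"
  have "g * x = g * (h * e)"
    using prod_gcd_lcm_nat[of g x] assms(2) by (simp add: h_def ac_simps)
  then have x: "x = h * e" using assms(1) by simp
  have "gcd g (e ^ j) dvd h" for j
  proof (induction j)
    case (Suc j)
    have "gcd g (e ^ Suc j) = gcd g (gcd g (e ^ j) * e)" by (rule gcd_power_Suc[symmetric])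
    also have "\<dots> dvd gcd g (h * e)" using Suc by (intro gcd_mono mult_dvd_mono) auto
    also have "\<dots> = h" using x by (simp add: h_def)
    finally show ?case .
  qed simp
  then show ?thesis by (simp add: absorbed_def h_def)
qed

section \<open>Solutions of the equation\<close>

text \<open>Counts the factors one at a time, since the support check spends them one at a time.
  With \<open>T\<close> the cycle lengths of \<open>X\<close>, this is the set of cycle lengths of
  \<open>cycle l * X ^ e\<close>.\<close>

primrec joins :: "nat set \<Rightarrow> nat \<Rightarrow> nat \<Rightarrow> nat set" where
  "joins T 0 l = {l}"
| "joins T (Suc e) l = {lcm k t | k t. k \<in> joins T e l \<and> t \<in> T}"

lemma cycle_lengths_cycle_times_power:
  assumes "0 < l" shows "cycle_lengths (cycle l * X ^ e) = joins (cycle_lengths X) e l"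
proof (induction e)
  case (Suc e)
  have "cycle l * X ^ Suc e = (cycle l * X ^ e) * X" by (simp add: ac_simps)
  then show ?case unfolding set_eq_iff joins.simps mem_Collect_eq
    by (simp only: cycle_lengths_times Suc) blast
qed (use assms in simp)

lemma joins_dvd: "k \<in> joins T e l \<Longrightarrow> l dvd k"
  by (induction e arbitrary: k) (auto intro: dvd_trans)

text \<open>Every element of a join is a multiple of \<open>l\<close>, hence of \<open>g\<close>,
  and absorbs an extra \<open>g\<close>. So the support condition can be read off
  \<open>cycle g * X\<close> without knowing \<open>X\<close>.\<close>

lemma joins_lcm_image:
  assumes "g dvd l" shows "joins (lcm g ` S) e l = joins S e l"
proof (induction e)
  case (Suc e)
  have "lcm k (lcm g t) = lcm k t" if "k \<in> joins S e l" for k t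
    using that joins_dvd[of k S e l] assms by (metis dvd_trans lcm.assoc lcm_proj1_if_dvd_nat)
  then show ?case using Suc by (auto simp: image_iff) metis+
qed simp

text \<open>The last factor may be repeated, \<open>lcm\<close> being idempotent. With no factor
  there is nothing to repeat, so monotonicity begins at one factor.\<close>

lemma joins_Suc_mono: "joins T (Suc j) l \<subseteq> joins T (Suc (Suc j)) l"
proof
  fix k assume "k \<in> joins T (Suc j) l"
  then obtain k' t where "k = lcm k' t" "k' \<in> joins T j l" "t \<in> T" by auto
  then have "k = lcm k t" "t \<in> T" by (auto simp: lcm.assoc)
  with \<open>k \<in> joins T (Suc j) l\<close> show "k \<in> joins T (Suc (Suc j)) l"
    by (subst joins.simps) blast
qed

lemma joins_mono: "0 < j \<Longrightarrow> j \<le> e \<Longrightarrow> joins T j l \<subseteq> joins T e l"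
proof (induction e)
  case (Suc e)
  then show ?case
    using joins_Suc_mono[of T "e - 1" l] by (cases "j = Suc e") auto
qed simp

section \<open>The polynomials \<open>\<phi>_m(P)\<close> and the capping of their exponents\<close>

definition value_at :: "(nat \<times> nat \<times> nat) list \<Rightarrow> nat \<Rightarrow> nat \<Rightarrow> nat" where
  "value_at qs m w = (\<Sum>(e, n, l)\<leftarrow>qs. if l dvd m then n * l * w ^ e else 0)"

definition cap :: "nat \<Rightarrow> (nat \<times> nat \<times> nat) list \<Rightarrow> (nat \<times> nat \<times> nat) list" where
  "cap k = map (\<lambda>(e, n, l). (min e k, n, l))"

lemma value_at_simps [simp]:
  "value_at [] m w = 0"
  "value_at ((e, n, l) # qs) m w = (if l dvd m then n * l * w ^ e else 0) + value_at qs m w"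
  "value_at (qs @ qs') m w = value_at qs m w + value_at qs' m w"
  by (simp_all add: value_at_def)

lemma value_at_mono: "w \<le> w' \<Longrightarrow> value_at qs m w \<le> value_at qs m w'"
  by (induction qs) (auto intro!: add_mono mult_le_mono power_mono)

lemma value_at_strict_mono:
  assumes "(e, n, l) \<in> set qs" "0 < e" "0 < n" "0 < l" "l dvd m" "w < w'"
  shows "value_at qs m w < value_at qs m w'"
proof -
  obtain xs ys where qs: "qs = xs @ (e, n, l) # ys" using split_list[OF assms(1)] by blast
  have "w ^ e < w' ^ e" using assms by (intro power_strict_mono) auto
  then have "n * l * w ^ e < n * l * w' ^ e" using assms by simp
  with value_at_mono[of w w' xs m] value_at_mono[of w w' ys m] assms(5,6) show ?thesis
    by (simp add: qs add_le_less_mono add_less_le_mono)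
qed

lemma value_at_ge:
  assumes "(e, n, l) \<in> set qs" "0 < n" "0 < l" "l dvd m"
  shows "l * w ^ e \<le> value_at qs m w"
proof -
  obtain xs ys where qs: "qs = xs @ (e, n, l) # ys" using split_list[OF assms(1)] by blast
  have "l * w ^ e \<le> n * (l * w ^ e)" using assms(2) by simp
  also have "\<dots> \<le> value_at qs m w" using assms(4) by (simp add: qs mult.assoc)
  finally show ?thesis .
qed

lemma value_at_const:
  assumes "\<And>e n l. (e, n, l) \<in> set qs \<Longrightarrow> 0 < e \<Longrightarrow> \<not> l dvd m"
  shows "value_at qs m w = value_at qs m w'"
  using assms
proof (induction qs)
  case (Cons x qs)
  obtain e n l where x: "x = (e, n, l)" by (cases x)
  have "value_at qs m w = value_at qs m w'" using Cons by (metis list.set_intros(2))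
  moreover have "l dvd m \<Longrightarrow> e = 0" using Cons.prems[of e n l] x by auto
  ultimately show ?case using x by simp
qed simp

text \<open>At arguments \<open>0\<close> and \<open>1\<close> capping changes nothing; at larger arguments every capped term
  exceeds \<open>V\<close>.\<close>

lemma value_at_cap:
  assumes "\<And>e n l. (e, n, l) \<in> set qs \<Longrightarrow> 0 < n \<and> 0 < l" "V < 2 ^ k" "0 < k"
  shows "value_at (cap k qs) m w = V \<longleftrightarrow> value_at qs m w = V"
proof (cases "w \<le> 1 \<or> (\<forall>(e, n, l) \<in> set qs. l dvd m \<longrightarrow> e \<le> k)")
  case True
  have "w ^ min e k = w ^ e" if "w \<le> 1 \<or> e \<le> k" for e
    using that assms(3) by (cases w) (auto simp: min_def power_0_left)
  with True have "value_at (cap k qs) m w = value_at qs m w"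
    by (induction qs) (auto simp: cap_def)
  then show ?thesis by simp
next
  case False
  then have w: "2 \<le> w" by simp
  from False obtain x where x: "x \<in> set qs" "\<not> (case x of (e, n, l) \<Rightarrow> l dvd m \<longrightarrow> e \<le> k)" by blast
  obtain e n l where "x = (e, n, l)" by (cases x)
  with x have e: "(e, n, l) \<in> set qs" "l dvd m" "k < e" by (simp_all add: not_le)
  have nl: "0 < n" "0 < l" using assms(1)[OF e(1)] by auto
  have big: "V < l * w ^ k'" if "k \<le> k'" for k'
  proof -
    have "V < 2 ^ k'" using assms(2) that by (metis less_le_trans one_le_numeral power_increasing)
    also have "\<dots> \<le> w ^ k'" using w by (intro power_mono) auto
    also have "\<dots> \<le> l * w ^ k'" using nl by simp
    finally show ?thesis .
  qed
  have "(k, n, l) \<in> set (cap k qs)" using e by (force simp: cap_def)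
  from value_at_ge[OF this nl e(2), of w] value_at_ge[OF e(1) nl e(2), of w]
    big[of k] big[of e] e(3) show ?thesis by simp
qed

section \<open>Both sides of the flattened equation\<close>

definition rhs_at :: "perm_code \<Rightarrow> nat \<Rightarrow> nat" where
  "rhs_at bs m = (\<Sum>(n, l)\<leftarrow>bs. if l dvd m then n * l else 0)"

definition lhs :: "(nat \<times> nat \<times> nat) list \<Rightarrow> permutation \<Rightarrow> permutation" where
  "lhs qs X = (\<Sum>(e, n, l)\<leftarrow>qs. of_nat n * cycle l * X ^ e)"

definition decode :: "perm_code \<Rightarrow> permutation" where
  "decode bs = (\<Sum>(n, l)\<leftarrow>bs. of_nat n * cycle l)"

lemma fixed_count_lhs: "fixed_count m (lhs qs X) = value_at qs m (fixed_count m X)"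
  by (induction qs) (auto simp: lhs_def fixed_count_plus fixed_count_times fixed_count_power fixed_count_cycle)

lemma fixed_count_decode: "fixed_count m (decode bs) = rhs_at bs m"
  by (induction bs) (auto simp: decode_def rhs_at_def fixed_count_plus fixed_count_times fixed_count_cycle)

lemma cycle_lengths_decode:
  assumes "\<And>n l. (n, l) \<in> set bs \<Longrightarrow> 0 < n \<and> 0 < l"
  shows "cycle_lengths (decode bs) = snd ` set bs"
  using assms
proof (induction bs)
  case (Cons x bs)
  obtain n l where x: "x = (n, l)" by (cases x)
  have "cycle_lengths (decode bs) = snd ` set bs" using Cons by (metis list.set_intros(2))
  moreover have "0 < n" "0 < l" using Cons.prems[of n l] x by auto
  ultimately show ?case using x by (simp add: decode_def cycle_lengths_of_nat_times)
qed (simp add: decode_def)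

lemma cycle_lengths_lhs:
  assumes "\<And>e n l. (e, n, l) \<in> set qs \<Longrightarrow> 0 < n \<and> 0 < l"
  shows "cycle_lengths (lhs qs X) = (\<Union>(e, n, l)\<in>set qs. joins (cycle_lengths X) e l)"
  using assms
proof (induction qs)
  case (Cons x qs)
  obtain e n l where x: "x = (e, n, l)" by (cases x)
  have "cycle_lengths (lhs qs X) = (\<Union>(e, n, l)\<in>set qs. joins (cycle_lengths X) e l)"
    using Cons by (metis list.set_intros(2))
  moreover have "0 < n" "0 < l" using Cons.prems[of e n l] x by auto
  ultimately show ?case
    using x by (simp add: lhs_def mult.assoc cycle_lengths_of_nat_times cycle_lengths_cycle_times_power)
qed (simp add: lhs_def)

lemma dvd_sum_mset: "(\<And>x. d dvd f x) \<Longrightarrow> d dvd (\<Sum>x\<in>#M. f x)" for d :: nat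
  by (induction M) auto

text \<open>The equation with both encodings flattened to lists of single terms. Encodings may
  repeat a cycle length, and so may these lists; multiplicities are therefore always obtained by
  summation.\<close>

locale cycle_equation =
  fixes qs :: "(nat \<times> nat \<times> nat) list" and bs :: perm_code and g :: nat
  assumes qs_pos: "(e, n, l) \<in> set qs \<Longrightarrow> 0 < n \<and> 0 < l"
    and bs_pos: "(n, l) \<in> set bs \<Longrightarrow> 0 < n \<and> 0 < l"
    and seed: "\<exists>e n. (e, n, g) \<in> set qs \<and> 0 < e"
    and seed_dvd: "(e, n, l) \<in> set qs \<Longrightarrow> 0 < e \<Longrightarrow> g dvd l"
begin

text \<open>The finite set on which all counts are compared. The lengths of \<open>P\<close> belong
  to it besides those of \<open>B\<close> because the chains of \<open>joins\<close> start
  there.\<close>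

definition lengths :: "nat set" where
  "lengths = (\<lambda>(e, n, l). l) ` set qs \<union> snd ` set bs"

lemma finite_lengths [simp]: "finite lengths"
  by (simp add: lengths_def)

lemma lengths_qs: "(e, n, l) \<in> set qs \<Longrightarrow> l \<in> lengths"
  by (force simp: lengths_def)

lemma lengths_pos: "l \<in> lengths \<Longrightarrow> 0 < l"
  using qs_pos bs_pos by (force simp: lengths_def)

lemma g_pos: "0 < g"
  using seed qs_pos by blast

lemma lengths_decode: "cycle_lengths (decode bs) \<subseteq> lengths"
  using cycle_lengths_decode[OF bs_pos] by (auto simp: lengths_def)

lemma value_at_indep: "\<not> g dvd m \<Longrightarrow> value_at qs m w = value_at qs m w'"
  by (rule value_at_const) (use seed_dvd dvd_trans in blast)

lemma cycle_lengths_seed_times: "cycle_lengths (cycle g * X) = lcm g ` cycle_lengths X"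
  using g_pos by (auto simp: cycle_lengths_times)

lemma solution_value:
  "lhs qs X = decode bs \<Longrightarrow> value_at qs m (fixed_count m X) = rhs_at bs m"
  by (metis fixed_count_lhs fixed_count_decode)

text \<open>Partial products are harmless for a genuine solution because the missing factors can be
  filled up by repetition (\<open>joins_mono\<close>). Conversely, one partial product outside
  \<open>lengths\<close> refutes all solutions.\<close>

lemma solution_joins:
  assumes X: "lhs qs X = decode bs" and q: "(e, n, l) \<in> set qs" "0 < e"
    and j: "0 < j" "j \<le> e" and k: "k \<in> joins (cycle_lengths (cycle g * X)) j l"
  shows "k \<in> lengths"
proof -
  have "k \<in> joins (cycle_lengths X) j l"
    using k joins_lcm_image[OF seed_dvd[OF q]] by (simp add: cycle_lengths_seed_times)
  then have "k \<in> joins (cycle_lengths X) e l" using joins_mono[OF j] by blast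
  then have "k \<in> cycle_lengths (lhs qs X)" using q(1) by (force simp: cycle_lengths_lhs[OF qs_pos])
  then show ?thesis using X lengths_decode by auto
qed

text \<open>The seed term alone forces this: a length \<open>k\<close> of \<open>cycle g * X\<close>
  is a multiple of \<open>g\<close>, so a single factor joined to \<open>g\<close> already produces
  \<open>k\<close>.\<close>

lemma solution_lengths:
  assumes X: "lhs qs X = decode bs" shows "cycle_lengths (cycle g * X) \<subseteq> lengths"
proof
  fix k assume k: "k \<in> cycle_lengths (cycle g * X)"
  obtain e n where q: "(e, n, g) \<in> set qs" "0 < e" using seed by blast
  have "g dvd k" using k by (auto simp: cycle_lengths_seed_times)
  then have "k = lcm g k" by (simp add: lcm_proj2_if_dvd_nat)
  then have "k \<in> joins (cycle_lengths (cycle g * X)) 1 g" using k by auto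
  then show "k \<in> lengths" using solution_joins[OF X q, of 1 k] q(2) by simp
qed

lemma solution_sum:
  assumes X: "lhs qs X = decode bs" and m: "g dvd m"
  shows "g * fixed_count m X = (\<Sum>l\<in>{l\<in>lengths. l dvd m}. l * multiplicity_of (cycle g * X) l)"
  using fixed_count_eq_sum[OF finite_lengths solution_lengths[OF X], of m] m
  by (simp add: fixed_count_times fixed_count_cycle)

text \<open>A cycle of length \<open>x\<close> in \<open>X\<close> contributes to \<open>m\<close>
  either nothing or \<open>gcd g x\<close> cycles, and \<open>absorbed_dvd_gcd\<close> applies to
  each contribution.\<close>

lemma multiplicity_seed_times:
  assumes "0 < multiplicity_of (cycle g * X) m"
  shows "g dvd m \<and> absorbed g (m div g) dvd multiplicity_of (cycle g * X) m"
proof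
  have "m \<in> cycle_lengths (cycle g * X)" using assms by simp
  then show g: "g dvd m" by (auto simp: cycle_lengths_seed_times)
  have "absorbed g (m div g) dvd (if lcm g x = m then gcd g x else 0)" for x
    using absorbed_dvd_gcd[OF g_pos, of x "m div g"] g by auto
  then show "absorbed g (m div g) dvd multiplicity_of (cycle g * X) m"
    unfolding multiplicity_cycle_times[OF g_pos] by (intro dvd_sum_mset)
qed

text \<open>Here \<open>z\<close> plays the multiplicities of \<open>cycle g * X\<close>, and
  \<open>X\<close> is the explicit quotient. The roots settle the counts on \<open>lengths\<close>,
  \<open>closed\<close> confines the support of \<open>P(X)\<close> to \<open>lengths\<close>, and
  \<open>permutation_eqI\<close> turns both into equality.\<close>

lemma solution_exists:
  fixes z :: "nat \<Rightarrow> nat"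
  defines "T \<equiv> {m \<in> lengths. 0 < z m}"
  defines "X \<equiv> \<Sum>m\<in>T. of_nat (z m div absorbed g (m div g)) * cycle (absorbed g (m div g) * (m div g))"
  assumes root: "\<And>m. m \<in> lengths \<Longrightarrow> \<exists>y. value_at qs m y = rhs_at bs m \<and>
      g * y = (\<Sum>l\<in>{l\<in>lengths. l dvd m}. l * z l)"
    and T: "\<And>m. m \<in> T \<Longrightarrow> g dvd m \<and> absorbed g (m div g) dvd z m"
    and closed: "\<And>e n l. (e, n, l) \<in> set qs \<Longrightarrow> 0 < e \<Longrightarrow> joins T e l \<subseteq> lengths"
  shows "lhs qs X = decode bs"
proof -
  have finT: "finite T" by (simp add: T_def)
  have c: "cycle g * (of_nat (z m div absorbed g (m div g)) * cycle (absorbed g (m div g) * (m div g)))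
      = of_nat (z m) * cycle m" if "m \<in> T" for m
  proof -
    let ?e = "m div g" let ?d = "absorbed g ?e"
    have "0 < m" using that lengths_pos by (auto simp: T_def)
    then have "0 < ?e" using T[OF that] by (auto simp: dvd_div_eq_0_iff)
    then have "cycle g * cycle (?d * ?e) = of_nat ?d * cycle m"
      using cycle_times_cycle[OF g_pos, of "?d * ?e"] T[OF that] absorbed_pos[OF g_pos, of ?e]
      by (simp add: gcd_absorbed[OF g_pos] lcm_absorbed[OF g_pos])
    then have "cycle g * (of_nat (z m div ?d) * cycle (?d * ?e)) = of_nat (z m div ?d) * (of_nat ?d * cycle m)"
      by (simp only: mult.left_commute[of "cycle g"])
    also have "\<dots> = of_nat (z m) * cycle m"
      using T[OF that] by (metis dvd_div_mult_self mult.assoc of_nat_mult)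
    finally show ?thesis .
  qed
  have gX: "cycle g * X = (\<Sum>m\<in>T. of_nat (z m) * cycle m)"
    unfolding X_def sum_distrib_left by (rule sum.cong) (auto simp: c)
  have len: "cycle_lengths (cycle g * X) = T"
  proof -
    have "m \<in> cycle_lengths (cycle g * X) \<longleftrightarrow> m \<in> T" for m
    proof -
      have "multiplicity_of (of_nat (z l) * cycle l) m = (if l = m then z m else 0)" if "l \<in> T" for l
        using that lengths_pos[of l] by (auto simp: multiplicity_of_nat_times cycle.rep_eq T_def)
      then have "multiplicity_of (cycle g * X) m = (\<Sum>l\<in>T. if l = m then z m else 0)"
        unfolding gX multiplicity_sum by (rule sum.cong[OF refl])
      also have "\<dots> = (if m \<in> T then z m else 0)" using finT by simp
      finally show ?thesis by (simp add: T_def flip: count_greater_zero_iff)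
    qed
    then show ?thesis by blast
  qed
  have fX: "fixed_count m X = y" if "g dvd m" "g * y = (\<Sum>l\<in>{l\<in>lengths. l dvd m}. l * z l)" for m y
  proof -
    have "g * fixed_count m X = fixed_count m (cycle g * X)"
      using that(1) by (simp add: fixed_count_times fixed_count_cycle)
    also have "\<dots> = (\<Sum>l\<in>T. if l dvd m then l * z l else 0)"
      unfolding gX fixed_count_sum by (rule sum.cong) (auto simp: fixed_count_times fixed_count_cycle)
    also have "\<dots> = (\<Sum>l\<in>{l\<in>lengths. l dvd m}. l * z l)"
      using finT by (subst sum.inter_filter[symmetric]) (auto intro!: sum.mono_neutral_left simp: T_def)
    finally show ?thesis using that(2) g_pos nat_mult_eq_cancel1 by metis
  qed
  show ?thesis
  proof (rule permutation_eqI[OF finite_lengths _ lengths_decode])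
    have "joins (cycle_lengths X) e l \<subseteq> lengths" if "(e, n, l) \<in> set qs" for e n l
    proof (cases "e = 0")
      case False
      then have "joins (lcm g ` cycle_lengths X) e l \<subseteq> lengths"
        using closed[OF that] len by (simp add: cycle_lengths_seed_times)
      then show ?thesis using False that by (simp add: joins_lcm_image[OF seed_dvd])
    qed (use that lengths_qs in auto)
    then show "cycle_lengths (lhs qs X) \<subseteq> lengths" by (force simp: cycle_lengths_lhs[OF qs_pos])
    fix m assume "m \<in> lengths"
    from root[OF this] obtain y where y: "value_at qs m y = rhs_at bs m"
      "g * y = (\<Sum>l\<in>{l\<in>lengths. l dvd m}. l * z l)" by blast
    \<comment> \<open>At multiples of \<open>g\<close> the given root is the count of
      \<open>X\<close>; elsewhere the polynomial is constant, and a root found at any argument is as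
      good.\<close>
    show "fixed_count m (lhs qs X) = fixed_count m (decode bs)"
      unfolding fixed_count_lhs fixed_count_decode
      using y fX[OF _ y(2)] value_at_indep[of m y "fixed_count m X"] by (cases "g dvd m") auto
  qed
qed

end

section \<open>Executing programs\<close>

text \<open>A scalar variable is cell 0 of an array bearing its name.\<close>

abbreviation V :: "string \<Rightarrow> aexp" where "V x \<equiv> Read x (Const 0)"
abbreviation assign :: "string \<Rightarrow> aexp \<Rightarrow> com" (infix "::=" 62) where "x ::= e \<equiv> Write x (Const 0) e"
abbreviation sequence :: "com \<Rightarrow> com \<Rightarrow> com" (infixr ";;" 61) where "C1;; C2 \<equiv> Seq C1 C2"
abbreviation Mod :: "aexp \<Rightarrow> aexp \<Rightarrow> aexp" where "Mod a b \<equiv> Minus a (Times (Divide a b) b)"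
abbreviation Positive :: "aexp \<Rightarrow> bexp" where "Positive a \<equiv> Less (Const 0) a"

definition for_loop :: "string \<Rightarrow> string \<Rightarrow> com \<Rightarrow> com" where
  "for_loop j hi C = (j ::= Const 0;; While (Less (V j) (V hi)) (C;; j ::= Plus (V j) (Const 1)))"

text \<open>An upper bound instead of the exact time lets branches of different cost be
  joined.\<close>

definition reach :: "com \<Rightarrow> memory \<Rightarrow> nat \<Rightarrow> memory \<Rightarrow> bool" where
  "reach C s n s' \<longleftrightarrow> (\<exists>t\<le>n. run C s t s')"

definition frame :: "string set \<Rightarrow> memory \<Rightarrow> memory \<Rightarrow> bool" where
  "frame F s s' \<longleftrightarrow> (\<forall>x. x \<notin> F \<longrightarrow> s' x = s x)"

lemma frame_refl [simp]: "frame F s s"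
  by (simp add: frame_def)

lemma frame_trans: "frame F s s1 \<Longrightarrow> frame G s1 s2 \<Longrightarrow> F \<union> G \<subseteq> H \<Longrightarrow> frame H s s2"
  unfolding frame_def by (metis UnCI subsetD)

lemma frame_mono: "frame F s s' \<Longrightarrow> F \<subseteq> G \<Longrightarrow> frame G s s'"
  by (auto simp: frame_def)

lemma frame_upd [simp]: "x \<in> F \<Longrightarrow> frame F s (s'(x := v)) = frame F s s'"
  by (auto simp: frame_def)

lemma frame_eq: "frame F s s' \<Longrightarrow> x \<notin> F \<Longrightarrow> s' x = s x"
  by (simp add: frame_def)

text \<open>Straight-line code is executed as a function. On \<open>While\<close> the functions
  \<open>effect\<close> and \<open>cost_bound\<close> return dummies, which this predicate
  excludes.\<close>

fun loop_free :: "com \<Rightarrow> bool" where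
  "loop_free (Seq C1 C2) = (loop_free C1 \<and> loop_free C2)"
| "loop_free (Cond b C1 C2) = (loop_free C1 \<and> loop_free C2)"
| "loop_free (While b C) = False"
| "loop_free _ = True"

fun effect :: "com \<Rightarrow> memory \<Rightarrow> memory" where
  "effect (Write x i e) s = s(x := (s x)(aval i s := aval e s))"
| "effect (Seq C1 C2) s = effect C2 (effect C1 s)"
| "effect (Cond b C1 C2) s = (if bval b s then effect C1 s else effect C2 s)"
| "effect _ s = s"

fun cost_bound :: "com \<Rightarrow> nat" where
  "cost_bound (Write x i e) = 1 + acost i + acost e"
| "cost_bound (Seq C1 C2) = cost_bound C1 + cost_bound C2"
| "cost_bound (Cond b C1 C2) = 1 + bcost b + max (cost_bound C1) (cost_bound C2)"
| "cost_bound _ = 1"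

lemma reach_mono: "reach C s n s' \<Longrightarrow> n \<le> n' \<Longrightarrow> reach C s n' s'"
  by (auto simp: reach_def intro: order_trans)

lemma reach_loop_free: "loop_free C \<Longrightarrow> reach C s (cost_bound C) (effect C s)"
proof (induction C arbitrary: s)
  case Skip
  show ?case using run_Skip unfolding reach_def by fastforce
next
  case (Write x i e)
  show ?case using run_Write[of x i e s] unfolding reach_def effect.simps cost_bound.simps by blast
next
  case (Seq C1 C2)
  then have "reach C1 s (cost_bound C1) (effect C1 s)"
    "reach C2 (effect C1 s) (cost_bound C2) (effect C2 (effect C1 s))" by simp_all
  then show ?case by (auto simp: reach_def intro!: add_mono run_Seq)
next
  case (Cond b C1 C2)
  show ?case
  proof (cases "bval b s")
    case True
    obtain t where "t \<le> cost_bound C1" "run C1 s t (effect C1 s)"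
      using Cond by (auto simp: reach_def)
    then show ?thesis using run_CondT[OF True, of C1 t _ C2] True
      by (auto simp: reach_def intro!: exI[of _ "1 + bcost b + t"])
  next
    case False
    obtain t where "t \<le> cost_bound C2" "run C2 s t (effect C2 s)"
      using Cond by (auto simp: reach_def)
    then show ?thesis using run_CondF[OF False, of C2 t _ C1] False
      by (auto simp: reach_def intro!: exI[of _ "1 + bcost b + t"])
  qed
qed simp

lemma reach_Skip: "reach Skip s 1 s"
  using reach_loop_free[of Skip s] by simp

lemma reach_Seq: "reach C1 s n1 s1 \<Longrightarrow> reach C2 s1 n2 s2 \<Longrightarrow> n1 + n2 \<le> n \<Longrightarrow> reach (C1;; C2) s n s2"
  unfolding reach_def by (meson add_mono order_trans run_Seq)

lemma reach_block_Seq: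
  "loop_free C1 \<Longrightarrow> reach C2 (effect C1 s) n2 s2 \<Longrightarrow> cost_bound C1 + n2 \<le> n \<Longrightarrow> reach (C1;; C2) s n s2"
  using reach_Seq reach_loop_free by blast

lemma reach_Seq_block:
  "reach C1 s n1 s1 \<Longrightarrow> loop_free C2 \<Longrightarrow> n1 + cost_bound C2 \<le> n \<Longrightarrow> reach (C1;; C2) s n (effect C2 s1)"
  using reach_Seq reach_loop_free by blast

lemma reach_CondT: "bval b s \<Longrightarrow> reach C1 s n1 s' \<Longrightarrow> 1 + bcost b + n1 \<le> n \<Longrightarrow> reach (Cond b C1 C2) s n s'"
  unfolding reach_def by (meson add_left_mono order_trans run_CondT)

lemma reach_CondF: "\<not> bval b s \<Longrightarrow> reach C2 s n1 s' \<Longrightarrow> 1 + bcost b + n1 \<le> n \<Longrightarrow> reach (Cond b C1 C2) s n s'"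
  unfolding reach_def by (meson add_left_mono order_trans run_CondF)

text \<open>The counter \<open>k\<close> bounds the number of remaining iterations.\<close>

lemma reach_While:
  assumes "I k s"
    and "\<And>k s. I k s \<Longrightarrow> bval b s \<Longrightarrow> \<exists>s' k'. k' < k \<and> reach C s c s' \<and> I k' s'"
  shows "\<exists>s' k'. reach (While b C) s (k * (c + 1 + bcost b) + 1 + bcost b) s' \<and> I k' s' \<and> \<not> bval b s'"
  using assms(1)
proof (induction k arbitrary: s rule: less_induct)
  case (less k)
  show ?case
  proof (cases "bval b s")
    case True
    obtain s1 k1 t1 where k1: "k1 < k" "t1 \<le> c" "run C s t1 s1" "I k1 s1"
      using assms(2)[OF less.prems True] by (auto simp: reach_def)
    obtain s2 k2 t2 where s2: "t2 \<le> k1 * (c + 1 + bcost b) + 1 + bcost b"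
      "run (While b C) s1 t2 s2" "I k2 s2" "\<not> bval b s2"
      using less.IH[OF k1(1,4)] by (auto simp: reach_def)
    have "Suc k1 * (c + 1 + bcost b) \<le> k * (c + 1 + bcost b)"
      using k1(1) by (intro mult_le_mono1) simp
    then have "1 + bcost b + t1 + t2 \<le> k * (c + 1 + bcost b) + 1 + bcost b"
      using k1(2) s2(1) by simp
    then show ?thesis using run_WhileT[OF True k1(3) s2(2)] s2(3,4) unfolding reach_def by blast
  next
    case False
    then show ?thesis using run_WhileF[OF False] less.prems unfolding reach_def
      by (metis add.assoc le_add2)
  qed
qed

text \<open>The frame refers back to the entry state \<open>s0\<close>, so a body may use whatever
  held before the loop. Beyond the body an iteration costs 6 for the test and 6 for the increment;
  the 9 pays for the initialisation and the final test.\<close>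

lemma reach_for:
  assumes hi: "s0 hi 0 = int n" "hi \<notin> insert j F" and j: "j \<notin> F"
    and P: "\<And>i s v. P i (s(j := v)) = P i s"
    and init: "P 0 s0"
    and body: "\<And>i s. i < n \<Longrightarrow> frame (insert j F) s0 s \<Longrightarrow> s j 0 = int i \<Longrightarrow> P i s \<Longrightarrow>
      \<exists>s'. reach C s c s' \<and> frame F s s' \<and> P (Suc i) s'"
  shows "\<exists>s'. reach (for_loop j hi C) s0 (n * (c + 12) + 9) s' \<and> frame (insert j F) s0 s' \<and> P n s'"
proof -
  let ?I = "\<lambda>k s. k \<le> n \<and> frame (insert j F) s0 s \<and> s j 0 = int (n - k) \<and> P (n - k) s"
  let ?s1 = "effect (j ::= Const 0) s0"
  let ?b = "Less (V j) (V hi)"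
  have "\<exists>s' k'. reach (While ?b (C;; j ::= Plus (V j) (Const 1))) ?s1
      (n * (c + 6 + 1 + bcost ?b) + 1 + bcost ?b) s' \<and> ?I k' s' \<and> \<not> bval ?b s'"
  proof (rule reach_While)
    show "?I n ?s1" using P init by simp
    fix k s assume I: "?I k s" and b: "bval ?b s"
    have hi': "s hi 0 = int n" using I hi frame_eq[of "insert j F" s0 s hi] by simp
    then have k: "0 < k" using b I by auto
    then obtain s1 where s1: "reach C s c s1" "frame F s s1" "P (Suc (n - k)) s1"
      using body[of "n - k" s] I by auto
    let ?s2 = "effect (j ::= Plus (V j) (Const 1)) s1"
    have "reach (C;; j ::= Plus (V j) (Const 1)) s (c + 6) ?s2"
      by (rule reach_Seq_block[OF s1(1)]) simp_all
    moreover have "frame (insert j F) s0 ?s2"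
      using frame_trans[of "insert j F" s0 s F s1 "insert j F"] I s1(2) by auto
    moreover have "s1 j = s j" using frame_eq[OF s1(2) j] .
    ultimately show "\<exists>s' k'. k' < k \<and> reach (C;; j ::= Plus (V j) (Const 1)) s (c + 6) s' \<and> ?I k' s'"
      using I k s1(3) P by (intro exI[of _ ?s2] exI[of _ "k - 1"]) (auto simp: Suc_diff_le of_nat_diff)
  qed
  then obtain s' k' where s': "reach (While ?b (C;; j ::= Plus (V j) (Const 1))) ?s1
      (n * (c + 6 + 1 + bcost ?b) + 1 + bcost ?b) s'" "?I k' s'" "\<not> bval ?b s'" by blast
  have "s' hi 0 = int n" using s'(2) hi frame_eq[of "insert j F" s0 s' hi] by simp
  then have "\<not> int (n - k') < int n" using s'(2,3) by simp
  then have "k' = 0" using s'(2) by auto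
  moreover have "reach (for_loop j hi C) s0 (n * (c + 12) + 9) s'"
    unfolding for_loop_def by (rule reach_block_Seq[OF _ s'(1)]) (simp_all add: algebra_simps)
  ultimately show ?thesis using s'(2) by auto
qed

section \<open>Evaluating the equation at a given number of fixed points\<close>

text \<open>The entry \<open>(e, u, l)\<close> stands for \<open>u C\<^sub>l X\<^sup>e\<close>; the cycles of \<open>B\<close> are stored with \<open>e = 0\<close> and
  negative \<open>u\<close>, so that the equation reads \<open>0\<close> on the right.\<close>

type_synonym entry = "nat \<times> int \<times> nat"

definition stores :: "entry list \<Rightarrow> memory \<Rightarrow> bool" where
  "stores es s \<longleftrightarrow> s ''n'' 0 = int (length es) \<and> (\<forall>j<length es. case es ! j of (e, u, l) \<Rightarrow>
     s ''E'' (int j) = int e \<and> s ''U'' (int j) = u \<and> s ''L'' (int j) = int l)"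

lemma stores_frame:
  "stores es s \<Longrightarrow> frame F s s' \<Longrightarrow> ''n'' \<notin> F \<Longrightarrow> ''E'' \<notin> F \<Longrightarrow> ''U'' \<notin> F \<Longrightarrow> ''L'' \<notin> F \<Longrightarrow> stores es s'"
  by (simp add: stores_def frame_def)

text \<open>The cap is applied during evaluation because \<open>k\<close> is known only after all of
  \<open>B\<close> has been read. The support check works with the true exponents.\<close>

definition residual :: "entry list \<Rightarrow> nat \<Rightarrow> nat \<Rightarrow> nat \<Rightarrow> int" where
  "residual es k m w = (\<Sum>(e, u, l)\<leftarrow>es. if l dvd m then u * int l * int w ^ min e k else 0)"

definition power_code :: com where
  "power_code = While (Positive (V ''h''))
     (''a'' ::= Times (V ''a'') (V ''w'');; ''h'' ::= Minus (V ''h'') (Const 1))"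

lemma power_code:
  assumes "s ''a'' 0 = 1" "s ''h'' 0 = int h"
  shows "\<exists>s'. reach power_code s (h * 20 + 10) s' \<and> frame {''a'', ''h''} s s' \<and> s' ''a'' 0 = s ''w'' 0 ^ h"
proof -
  let ?I = "\<lambda>k t. k \<le> h \<and> frame {''a'', ''h''} s t \<and> t ''h'' 0 = int k \<and> t ''a'' 0 = s ''w'' 0 ^ (h - k)"
  let ?b = "Positive (V ''h'')"
  let ?C = "''a'' ::= Times (V ''a'') (V ''w'');; ''h'' ::= Minus (V ''h'') (Const 1)"
  have "\<exists>s' k'. reach (While ?b ?C) s (h * (14 + 1 + bcost ?b) + 1 + bcost ?b) s' \<and> ?I k' s' \<and> \<not> bval ?b s'"
  proof (rule reach_While)
    show "?I h s" using assms by simp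
    fix k t assume I: "?I k t" and b: "bval ?b t"
    have "t ''w'' = s ''w''" using I frame_eq[of "{''a'', ''h''}" s t "''w''"] by simp
    moreover have "k > 0" using I b by simp
    ultimately show "\<exists>t' k'. k' < k \<and> reach ?C t 14 t' \<and> ?I k' t'"
      using I by (intro exI[of _ "effect ?C t"] exI[of _ "k - 1"] conjI reach_mono[OF reach_loop_free])
        (auto simp: of_nat_diff Suc_diff_le simp flip: power_Suc2)
  qed
  then obtain s' k' where "reach (While ?b ?C) s (h * (14 + 1 + bcost ?b) + 1 + bcost ?b) s'" "?I k' s'"
    "\<not> bval ?b s'" by blast
  moreover from this have "k' = 0" by simp
  moreover have "h * (14 + 1 + bcost ?b) + 1 + bcost ?b \<le> h * 20 + 10" by simp
  ultimately show ?thesis unfolding power_code_def using reach_mono by (intro exI[of _ s']) auto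
qed

definition evaluate :: com where
  "evaluate = (''T'' ::= Const 0;;
     for_loop ''j'' ''n''
       (Cond (Positive (Mod (V ''m'') (Read ''L'' (V ''j'')))) Skip
         ((''a'' ::= Const 1;; ''h'' ::= Read ''E'' (V ''j'');;
           Cond (Less (V ''k'') (V ''h'')) (''h'' ::= V ''k'') Skip);;
          power_code;;
          ''T'' ::= Plus (V ''T'') (Times (Times (Read ''U'' (V ''j'')) (Read ''L'' (V ''j''))) (V ''a'')))))"

lemma positive_mod_iff: "0 < int m - int m div int l * int l \<longleftrightarrow> \<not> l dvd m" if "0 < l"
proof -
  have "int m - int m div int l * int l = int (m mod l)"
    by (simp add: minus_div_mult_eq_mod zmod_int)
  then show ?thesis by (auto simp: dvd_eq_mod_eq_0)
qed

lemma residual_take_Suc: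
  assumes "i < length es" "es ! i = (e, u, l)"
  shows "residual (take (Suc i) es) k m w = residual (take i es) k m w
    + (if l dvd m then u * int l * int w ^ min e k else 0)"
  using assms by (simp add: residual_def take_Suc_conv_app_nth)

text \<open>\<open>X\<close> bounds only the exponents active at \<open>m\<close>; an inactive term
  costs a constant. The distinction matters because the search interval shrinks only with the
  largest active exponent.\<close>

lemma evaluate:
  assumes st: "stores es s" and v: "s ''m'' 0 = int m" "s ''k'' 0 = int k" "s ''w'' 0 = int w"
    and es: "\<And>e u l. (e, u, l) \<in> set es \<Longrightarrow> 0 < l \<and> (l dvd m \<longrightarrow> min e k \<le> X)"
  shows "\<exists>s'. reach evaluate s (length es * (20 * X + 100) + 20) s' \<and>
    frame {''T'', ''j'', ''a'', ''h''} s s' \<and> s' ''T'' 0 = residual es k m w"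
proof -
  let ?F = "{''T'', ''a'', ''h''}"
  let ?s1 = "effect (''T'' ::= Const 0) s"
  let ?B1 = "''a'' ::= Const 1;; ''h'' ::= Read ''E'' (V ''j'');;
           Cond (Less (V ''k'') (V ''h'')) (''h'' ::= V ''k'') Skip"
  let ?B2 = "''T'' ::= Plus (V ''T'') (Times (Times (Read ''U'' (V ''j'')) (Read ''L'' (V ''j''))) (V ''a''))"
  let ?b = "Positive (Mod (V ''m'') (Read ''L'' (V ''j'')))"
  have "\<exists>s'. reach (for_loop ''j'' ''n'' (Cond ?b Skip (?B1;; power_code;; ?B2))) ?s1
      (length es * (20 * X + 80 + 12) + 9) s' \<and> frame (insert ''j'' ?F) ?s1 s' \<and>
      s' ''T'' 0 = residual (take (length es) es) k m w"
  proof (rule reach_for)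
    fix i t assume i: "i < length es" and t: "frame (insert ''j'' ?F) ?s1 t" "t ''j'' 0 = int i"
      "t ''T'' 0 = residual (take i es) k m w"
    have st': "stores es t" using stores_frame[OF st, of "insert ''j'' ?F" t] t(1) by (simp add: frame_def)
    have v': "t ''m'' 0 = int m" "t ''k'' 0 = int k" "t ''w'' 0 = int w"
      using t(1) v by (simp_all add: frame_def)
    obtain e u l where el: "es ! i = (e, u, l)" by (cases "es ! i")
    have ei: "t ''E'' (int i) = int e" "t ''U'' (int i) = u" "t ''L'' (int i) = int l"
      using st' i el by (auto simp: stores_def)
    have l: "0 < l" "l dvd m \<longrightarrow> min e k \<le> X" using es[of e u l] i el nth_mem[OF i] by auto
    show "\<exists>t'. reach (Cond ?b Skip (?B1;; power_code;; ?B2)) t (20 * X + 80) t' \<and> frame ?F t t' \<and>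
      t' ''T'' 0 = residual (take (Suc i) es) k m w"
    proof (cases "l dvd m")
      case False
      then have "bval ?b t" using v' ei t(2) positive_mod_iff[OF l(1)] by simp
      then have "reach (Cond ?b Skip (?B1;; power_code;; ?B2)) t (20 * X + 80) t"
        by (rule reach_CondT[OF _ reach_Skip]) simp
      then show ?thesis using t(3) False residual_take_Suc[OF i el] by auto
    next
      case True
      then have b: "\<not> bval ?b t" using v' ei t(2) positive_mod_iff[OF l(1)] by simp
      let ?t1 = "effect ?B1 t"
      have t1: "?t1 ''a'' 0 = 1" "?t1 ''h'' 0 = int (min e k)" "frame ?F t ?t1"
        using v' ei t(2) by (auto simp: min_def)
      obtain t2 where t2: "reach power_code ?t1 (min e k * 20 + 10) t2" "frame {''a'', ''h''} ?t1 t2"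
        "t2 ''a'' 0 = ?t1 ''w'' 0 ^ min e k"
        using power_code[of ?t1 "min e k", OF t1(1,2)] by blast
      have w: "?t1 ''w'' = t ''w''" "?t1 ''j'' = t ''j''" "?t1 ''T'' = t ''T''" "?t1 ''U'' = t ''U''" "?t1 ''L'' = t ''L''"
        by simp_all
      have fr: "t2 ''w'' = t ''w''" "t2 ''j'' = t ''j''" "t2 ''T'' = t ''T''" "t2 ''U'' = t ''U''" "t2 ''L'' = t ''L''"
        using frame_eq[OF t2(2)] w by auto
      let ?t3 = "effect ?B2 t2"
      have "reach (?B1;; power_code;; ?B2) t (20 * X + 64) ?t3"
        by (rule reach_block_Seq, simp, rule reach_Seq_block[OF t2(1)]) (use l(2) True in auto)
      then have "reach (Cond ?b Skip (?B1;; power_code;; ?B2)) t (20 * X + 80) ?t3"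
        by (rule reach_CondF[OF b]) simp
      moreover have "frame ?F t ?t3"
        using frame_trans[OF t1(3) t2(2), of ?F] by simp
      moreover have "?t3 ''T'' 0 = residual (take (Suc i) es) k m w"
        unfolding residual_take_Suc[OF i el] using True t2(3) w fr v' ei t(2,3) by simp
      ultimately show ?thesis by blast
    qed
  qed (use st in \<open>auto simp: residual_def stores_def\<close>)
  then obtain s' where s': "reach (for_loop ''j'' ''n'' (Cond ?b Skip (?B1;; power_code;; ?B2))) ?s1
      (length es * (20 * X + 80 + 12) + 9) s'" "frame (insert ''j'' ?F) ?s1 s'"
      "s' ''T'' 0 = residual es k m w" by auto
  have "reach evaluate s (length es * (20 * X + 100) + 20) s'"
    unfolding evaluate_def by (rule reach_block_Seq[OF _ s'(1)]) (simp_all add: algebra_simps)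
  moreover have "frame {''T'', ''j'', ''a'', ''h''} s s'"
    using s'(2) by (auto simp: frame_def)
  ultimately show ?thesis using s'(3) by blast
qed

section \<open>Searching the root\<close>

lemma reach_While_False: "\<not> bval b s \<Longrightarrow> reach (While b C) s (1 + bcost b) s"
  unfolding reach_def by (metis order_refl run_WhileF)

text \<open>If \<open>g\<close> does not divide \<open>m\<close>, the step width 0 skips the search
  and leaves \<open>y = 0\<close>.\<close>

definition gallop_init :: com where
  "gallop_init = (''y'' ::= Const 0;;
     Cond (Positive (Mod (V ''m'') (V ''g''))) (''b'' ::= Const 0) (''b'' ::= Const 1);;
     ''up'' ::= Const 1)"

definition gallop_update :: com where
  "gallop_update = Cond (Positive (V ''T''))
     (''up'' ::= Const 0;; ''b'' ::= Divide (V ''b'') (Const 2))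
     (''y'' ::= V ''w'';; Cond (Positive (V ''up'')) (''b'' ::= Times (V ''b'') (Const 2))
        (''b'' ::= Divide (V ''b'') (Const 2)))"

definition gallop :: com where
  "gallop = (gallop_init;; While (Positive (V ''b''))
     (''w'' ::= Plus (V ''y'') (V ''b'');; evaluate;; gallop_update))"

text \<open>Doubling and bisection share one loop, with \<open>up\<close> as the phase. Argument 0
  is never probed, hence the alternative \<open>y = 0\<close>: the result is a candidate for a root,
  which the caller has to verify.\<close>

lemma gallop:
  fixes es :: "entry list" and A X k m g :: nat
  defines "f \<equiv> residual es k m"
  assumes st: "stores es s" and v: "s ''m'' 0 = int m" "s ''k'' 0 = int k" "s ''g'' 0 = int g" and g: "0 < g"
    and es: "\<And>e u l. (e, u, l) \<in> set es \<Longrightarrow> 0 < l \<and> (l dvd m \<longrightarrow> min e k \<le> X)"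
    and bound: "\<And>w. g dvd m \<Longrightarrow> f w \<le> 0 \<Longrightarrow> w < 2 ^ A"
  shows "\<exists>s' y. reach gallop s ((2 * A + 2) * (length es * (20 * X + 100) + 80) + 50) s' \<and>
    frame {''y'', ''b'', ''up'', ''w'', ''T'', ''j'', ''a'', ''h''} s s' \<and> s' ''y'' 0 = int y \<and>
    (if g dvd m then (y = 0 \<or> f y \<le> 0) \<and> 0 < f (y + 1) else y = 0)"
proof -
  let ?F = "{''y'', ''b'', ''up'', ''w'', ''T'', ''j'', ''a'', ''h''}"
  let ?E = "length es * (20 * X + 100) + 20"
  let ?b = "Positive (V ''b'')" and ?C = "''w'' ::= Plus (V ''y'') (V ''b'');; evaluate;; gallop_update"
  let ?s1 = "effect gallop_init s"
  have s1: "?s1 ''y'' 0 = 0" "?s1 ''up'' 0 = 1" "?s1 ''b'' 0 = (if g dvd m then 1 else 0)" "frame ?F s ?s1"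
    using v positive_mod_iff[OF g, of m] by (simp_all add: gallop_init_def)
  show ?thesis
  proof (cases "g dvd m")
    case False
    then have "\<not> bval ?b ?s1" using s1 by simp
    then have "reach gallop s ((2 * A + 2) * (length es * (20 * X + 100) + 80) + 50) ?s1"
      unfolding gallop_def by (intro reach_block_Seq[OF _ reach_While_False]) (simp_all add: gallop_init_def)
    then show ?thesis using s1 False by (intro exI[of _ ?s1] exI[of _ 0]) simp
  next
    case True
    \<comment> \<open>The rank is \<open>2 * A + 2 - d\<close> while rising, then the exponent of a
      window from \<open>y\<close> with a positive right end. Switching lowers it because
      \<open>d \<le> A\<close> gives \<open>d < 2 * A + 2 - d\<close>; in the end
      \<open>2 ^ 0 div 2 = 0\<close> stops the loop.\<close>
    let ?I = "\<lambda>i t. frame ?F s t \<and> (\<exists>y. t ''y'' 0 = int y \<and> (y = 0 \<or> f y \<le> 0) \<and>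
      ((\<exists>d\<le>A. t ''up'' 0 = 1 \<and> t ''b'' 0 = 2 ^ d \<and> y + 1 = 2 ^ d \<and> i = 2 * A + 2 - d) \<or>
       (t ''up'' 0 = 0 \<and> t ''b'' 0 = 2 ^ i div 2 \<and> 0 < f (y + 2 ^ i))))"
    have "\<exists>s' i. reach (While ?b ?C) ?s1 ((2 * A + 2) * (?E + 40 + 1 + bcost ?b) + 1 + bcost ?b) s' \<and>
      ?I i s' \<and> \<not> bval ?b s'"
    proof (rule reach_While)
      show "?I (2 * A + 2) ?s1" using s1 True by (intro conjI exI[of _ 0]) auto
      fix i t assume I: "?I i t" and b: "bval ?b t"
      then obtain y where y: "t ''y'' 0 = int y" "y = 0 \<or> f y \<le> 0"
        "(\<exists>d\<le>A. t ''up'' 0 = 1 \<and> t ''b'' 0 = 2 ^ d \<and> y + 1 = 2 ^ d \<and> i = 2 * A + 2 - d) \<or>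
         (t ''up'' 0 = 0 \<and> t ''b'' 0 = 2 ^ i div 2 \<and> 0 < f (y + 2 ^ i))" by blast
      obtain d where d: "t ''b'' 0 = 2 ^ d" "t ''up'' 0 = 1 \<and> d \<le> A \<and> y + 1 = 2 ^ d \<and> i = 2 * A + 2 - d \<or>
         t ''up'' 0 = 0 \<and> i = Suc d \<and> 0 < f (y + 2 * 2 ^ d)"
      proof (use y(3) in \<open>elim disjE exE conjE\<close>)
        fix d assume "d \<le> A" "t ''up'' 0 = 1" "t ''b'' 0 = 2 ^ d" "y + 1 = 2 ^ d" "i = 2 * A + 2 - d"
        then show thesis by (intro that[of d]) simp_all
      next
        assume *: "t ''up'' 0 = 0" "t ''b'' 0 = 2 ^ i div 2" "0 < f (y + 2 ^ i)"
        have "i \<noteq> 0" using b *(2) by (intro notI) simp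
        then obtain d where "i = Suc d" by (cases i) auto
        with * show thesis by (intro that[of d]) simp_all
      qed
      let ?w = "y + 2 ^ d"
      let ?t1 = "effect (''w'' ::= Plus (V ''y'') (V ''b'')) t"
      have fr: "frame ?F s ?t1" using I by simp
      have "stores es ?t1" using stores_frame[OF st fr] by simp
      moreover have "?t1 ''m'' 0 = int m" "?t1 ''k'' 0 = int k" using v I by (simp_all add: frame_def)
      moreover have "?t1 ''w'' 0 = int ?w" using y(1) d(1) by simp
      ultimately obtain t2 where t2: "reach evaluate ?t1 ?E t2" "frame {''T'', ''j'', ''a'', ''h''} ?t1 t2"
        "t2 ''T'' 0 = f ?w" using evaluate[of es ?t1 m k ?w X] es unfolding f_def by blast
      have w2: "t2 ''w'' 0 = int ?w" "t2 ''y'' 0 = int y" "t2 ''b'' 0 = 2 ^ d" "t2 ''up'' 0 = t ''up'' 0"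
        using t2(2) y(1) d(1) by (simp_all add: frame_def)
      let ?t3 = "effect gallop_update t2"
      have "reach ?C t (?E + 40) ?t3"
        by (rule reach_block_Seq[OF _ reach_Seq_block[OF t2(1) _ order_refl]]) (simp_all add: gallop_update_def)
      moreover have "frame ?F s ?t3"
        using frame_trans[OF fr t2(2), of ?F] by (simp add: gallop_update_def)
      moreover have "\<exists>i'<i. \<exists>y. ?t3 ''y'' 0 = int y \<and> (y = 0 \<or> f y \<le> 0) \<and>
         ((\<exists>d\<le>A. ?t3 ''up'' 0 = 1 \<and> ?t3 ''b'' 0 = 2 ^ d \<and> y + 1 = 2 ^ d \<and> i' = 2 * A + 2 - d) \<or>
          (?t3 ''up'' 0 = 0 \<and> ?t3 ''b'' 0 = 2 ^ i' div 2 \<and> 0 < f (y + 2 ^ i')))"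
      proof (cases "0 < f ?w")
        case fw: True
        have "d < i" using d(2) by auto
        moreover have "?t3 ''y'' 0 = int y" "?t3 ''up'' 0 = 0" "?t3 ''b'' 0 = 2 ^ d div 2"
          using t2(3) fw w2 by (simp_all add: gallop_update_def)
        ultimately show ?thesis using fw y(2) by blast
      next
        case fw: False
        have t3: "?t3 ''y'' 0 = int ?w" "?t3 ''up'' 0 = t ''up'' 0"
          "?t3 ''b'' 0 = (if t ''up'' 0 > 0 then 2 ^ Suc d else 2 ^ d div 2)"
          using t2(3) fw w2 by (simp_all add: gallop_update_def)
        from d(2) show ?thesis
        proof
          assume up: "t ''up'' 0 = 1 \<and> d \<le> A \<and> y + 1 = 2 ^ d \<and> i = 2 * A + 2 - d"
          \<comment> \<open>While rising, \<open>?w\<close> is \<open>2 ^ Suc d - 1\<close>, so the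
            bound on arguments with nonpositive residual leaves room for another doubling.\<close>
          have "?w < 2 ^ A" using bound[OF True] fw by simp
          then have "(2::nat) ^ d < 2 ^ A" by linarith
          then have "d < A" by simp
          then have "2 * A + 2 - Suc d < i" "Suc d \<le> A" "?w + 1 = 2 ^ Suc d"
            "?t3 ''up'' 0 = 1" "?t3 ''b'' 0 = 2 ^ Suc d" "f ?w \<le> 0"
            using up t3 fw by simp_all
          with t3(1) show ?thesis by blast
        next
          assume dn: "t ''up'' 0 = 0 \<and> i = Suc d \<and> 0 < f (y + 2 * 2 ^ d)"
          have "?w + 2 ^ d = y + 2 * 2 ^ d" by simp
          with dn have "0 < f (?w + 2 ^ d)" by (simp only:)
          moreover have "d < i" "?t3 ''up'' 0 = 0" "?t3 ''b'' 0 = 2 ^ d div 2" "f ?w \<le> 0"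
            using dn t3 fw by simp_all
          ultimately show ?thesis using t3(1) by blast
        qed
      qed
      ultimately show "\<exists>t' i'. i' < i \<and> reach ?C t (?E + 40) t' \<and> ?I i' t'" by blast
    qed
    then obtain s' i where s': "reach (While ?b ?C) ?s1 ((2 * A + 2) * (?E + 40 + 1 + bcost ?b) + 1 + bcost ?b) s'"
      "?I i s'" "\<not> bval ?b s'" by blast
    obtain y where y: "s' ''y'' 0 = int y" "y = 0 \<or> f y \<le> 0"
        "(\<exists>d\<le>A. s' ''up'' 0 = 1 \<and> s' ''b'' 0 = 2 ^ d \<and> y + 1 = 2 ^ d \<and> i = 2 * A + 2 - d) \<or>
         (s' ''up'' 0 = 0 \<and> s' ''b'' 0 = 2 ^ i div 2 \<and> 0 < f (y + 2 ^ i))" using s'(2) by blast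
    have "0 < f (y + 1)"
    proof -
      have i: "\<not> 0 < (2::int) ^ i div 2" "0 < f (y + 2 ^ i)" using y(3) s'(3) by auto
      have "i = 0" using i(1) by (cases i) auto
      then show ?thesis using i(2) by simp
    qed
    moreover have "reach gallop s ((2 * A + 2) * (length es * (20 * X + 100) + 80) + 50) s'"
      unfolding gallop_def by (rule reach_block_Seq[OF _ s'(1)]) (simp_all add: gallop_init_def algebra_simps)
    ultimately show ?thesis using True s'(2) y(1,2) by auto
  qed
qed

section \<open>Gcds and saturated powers\<close>

definition euclid :: com where
  "euclid = While (Positive (V ''B''))
     (''t'' ::= Mod (V ''A'') (V ''B'');; ''A'' ::= V ''B'';; ''B'' ::= V ''t'')"

text \<open>From the second step on \<open>B \<le> A\<close>, and then the product \<open>A * B\<close> is at least halved.\<close>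

lemma euclid:
  assumes v: "s ''A'' 0 = int a" "s ''B'' 0 = int b" and b: "b < 2 ^ K"
  shows "\<exists>s'. reach euclid s ((2 * K + 1) * 26 + 5) s' \<and> frame {''A'', ''B'', ''t''} s s' \<and>
    s' ''A'' 0 = int (gcd a b)"
proof -
  let ?F = "{''A'', ''B'', ''t''}"
  let ?b = "Positive (V ''B'')"
  let ?C = "''t'' ::= Mod (V ''A'') (V ''B'');; ''A'' ::= V ''B'';; ''B'' ::= V ''t''"
  \<comment> \<open>The last alternative is the state before the first step, where only
    \<open>b\<close> is bounded. Thus the cost does not depend on \<open>a\<close>, which in one use
    is a very large power.\<close>
  let ?I = "\<lambda>k t. frame ?F s t \<and> (\<exists>c d. t ''A'' 0 = int c \<and> t ''B'' 0 = int d \<and> gcd c d = gcd a b \<and>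
    (d \<le> c \<and> c * d < 2 ^ k \<or> k = 2 * K + 1 \<and> d < 2 ^ K))"
  have "\<exists>s' k. reach (While ?b ?C) s ((2 * K + 1) * (21 + 1 + bcost ?b) + 1 + bcost ?b) s' \<and>
    ?I k s' \<and> \<not> bval ?b s'"
  proof (rule reach_While)
    show "?I (2 * K + 1) s" using v b by auto
    fix k t assume I: "?I k t" and "bval ?b t"
    then obtain c d where cd: "t ''A'' 0 = int c" "t ''B'' 0 = int d" "gcd c d = gcd a b" "0 < d"
      and kd: "d \<le> c \<and> c * d < 2 ^ k \<or> k = 2 * K + 1 \<and> d < 2 ^ K" by auto
    have r: "c mod d < d" using cd(4) by simp
    have k: "0 < k \<and> d * (c mod d) < 2 ^ (k - 1)"
      using kd
    proof
      assume *: "d \<le> c \<and> c * d < 2 ^ k"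
      then have k: "0 < k" using cd(4) by (cases k) auto
      have "c mod d \<le> c - d" using * cd(4) by (metis le_mod_geq mod_less_eq_dividend)
      then have "2 * (c mod d) \<le> c" using r * by linarith
      then have "2 * (d * (c mod d)) \<le> c * d" by (metis mult.assoc mult.commute mult_le_mono2)
      also have "\<dots> < 2 * 2 ^ (k - 1)" using * k by (simp flip: power_Suc)
      finally show ?thesis using k by simp
    next
      assume *: "k = 2 * K + 1 \<and> d < 2 ^ K"
      then have "d * (c mod d) < 2 ^ K * 2 ^ K" using r by (intro mult_strict_mono) auto
      then show ?thesis using * by (simp add: power_add mult_2)
    qed
    moreover have "effect ?C t ''A'' 0 = int d" "effect ?C t ''B'' 0 = int (c mod d)"
      using cd by (simp_all add: minus_div_mult_eq_mod zmod_int)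
    moreover have "gcd d (c mod d) = gcd a b" using cd(3) by (metis gcd.commute gcd_red_nat)
    moreover have "frame ?F s (effect ?C t)" using I by simp
    moreover have "reach ?C t 21 (effect ?C t)" by (rule reach_mono[OF reach_loop_free]) simp_all
    moreover have "k - 1 < k" using k by simp
    ultimately show "\<exists>t' k'. k' < k \<and> reach ?C t 21 t' \<and> ?I k' t'"
      using less_imp_le[OF r] by blast
  qed
  then obtain s' k where s': "reach (While ?b ?C) s ((2 * K + 1) * (21 + 1 + bcost ?b) + 1 + bcost ?b) s'"
    "?I k s'" "\<not> bval ?b s'" by blast
  then obtain c d where "s' ''A'' 0 = int c" "s' ''B'' 0 = int d" "gcd c d = gcd a b" "d = 0" by auto
  then have "s' ''A'' 0 = int (gcd a b)" by simp
  with s' show ?thesis unfolding euclid_def by auto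
qed

definition squaring :: com where
  "squaring = While (Neg (Less (V ''g'') (V ''u'')))
     (''u'' ::= Times (V ''u'') (V ''u'');; ''q'' ::= Times (V ''q'') (V ''q''))"

text \<open>\<open>u\<close> runs through \<open>2 ^ 2 ^ i\<close> in step with
  \<open>e ^ 2 ^ i\<close>; as soon as it exceeds \<open>g\<close>, the exponent meets the condition
  of \<open>absorbed_eq\<close>. The bound of \<open>K\<close> rounds is generous, but no worse in
  order than the bound for the gcd that follows.\<close>

lemma squaring:
  assumes v: "s ''g'' 0 = int g" "s ''u'' 0 = 2" "s ''q'' 0 = int e" and g: "g < 2 ^ K"
  shows "\<exists>s' p. reach squaring s (K * 30 + 10) s' \<and> frame {''u'', ''q''} s s' \<and>
    s' ''q'' 0 = int (e ^ p) \<and> g < 2 ^ p"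
proof -
  let ?F = "{''u'', ''q''}"
  let ?b = "Neg (Less (V ''g'') (V ''u''))"
  let ?C = "''u'' ::= Times (V ''u'') (V ''u'');; ''q'' ::= Times (V ''q'') (V ''q'')"
  let ?I = "\<lambda>k t. frame ?F s t \<and> (\<exists>i\<le>K. k = K - i \<and> t ''u'' 0 = 2 ^ 2 ^ i \<and> t ''q'' 0 = int (e ^ 2 ^ i))"
  have gt: "t ''g'' 0 = int g" if "frame ?F s t" for t using that v by (simp add: frame_def)
  have "\<exists>s' k. reach (While ?b ?C) s (K * (20 + 1 + bcost ?b) + 1 + bcost ?b) s' \<and>
    ?I k s' \<and> \<not> bval ?b s'"
  proof (rule reach_While)
    show "?I K s" using v by (auto intro: exI[of _ 0])
    fix k t assume I: "?I k t" and b: "bval ?b t"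
    then obtain i where i: "i \<le> K" "k = K - i" "t ''u'' 0 = 2 ^ 2 ^ i" "t ''q'' 0 = int (e ^ 2 ^ i)" by blast
    have "t ''g'' 0 = int g" using gt I by blast
    then have "(2::int) ^ 2 ^ i \<le> int g" using b i(3) by simp
    then have "2 ^ 2 ^ i \<le> g" by (metis of_nat_le_iff of_nat_numeral of_nat_power)
    also have "\<dots> < 2 ^ K" by (rule g)
    finally have "2 ^ i < K" by simp
    then have iK: "i < K" using less_exp[of i] by linarith
    have "x ^ 2 ^ i * x ^ 2 ^ i = x ^ 2 ^ Suc i" for x :: int by (simp add: power_add mult_2 flip: power_add)
    then have "effect ?C t ''u'' 0 = 2 ^ 2 ^ Suc i" "effect ?C t ''q'' 0 = int (e ^ 2 ^ Suc i)"
      using i by (simp_all del: power_Suc)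
    moreover have "reach ?C t 20 (effect ?C t)" by (rule reach_mono[OF reach_loop_free]) simp_all
    moreover have "K - Suc i < k" "Suc i \<le> K" "frame ?F s (effect ?C t)" using iK i(2) I by simp_all
    ultimately show "\<exists>t' k'. k' < k \<and> reach ?C t 20 t' \<and> ?I k' t'" by blast
  qed
  then obtain s' k where s': "reach (While ?b ?C) s (K * (20 + 1 + bcost ?b) + 1 + bcost ?b) s'"
    "?I k s'" "\<not> bval ?b s'" by blast
  then obtain i where i: "s' ''u'' 0 = 2 ^ 2 ^ i" "s' ''q'' 0 = int (e ^ 2 ^ i)" by blast
  have "s' ''g'' 0 = int g" using gt s'(2) by blast
  then have "int g < 2 ^ 2 ^ i" using s'(3) i by simp
  then have "g < 2 ^ 2 ^ i" by (metis of_nat_less_iff of_nat_numeral of_nat_power)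
  moreover have "reach squaring s (K * 30 + 10) s'"
    unfolding squaring_def using s'(1) by (rule reach_mono) simp
  ultimately show ?thesis using s'(2) i(2) by blast
qed

section \<open>Contribution of the smaller divisors, and output of one quotient cycle\<close>

definition partial_sum :: com where
  "partial_sum = (''S'' ::= Const 0;;
     for_loop ''j'' ''r'' (Cond (Positive (Mod (V ''m'') (Read ''M'' (V ''j'')))) Skip
       (''S'' ::= Plus (V ''S'') (Times (Read ''M'' (V ''j'')) (Read ''Z'' (V ''j''))))))"

lemma partial_sum:
  assumes v: "s ''m'' 0 = int m" "s ''r'' 0 = int i"
    and M: "\<And>j. j < i \<Longrightarrow> s ''M'' (int j) = int (M j) \<and> 0 < M j \<and> s ''Z'' (int j) = int (z (M j))"
  shows "\<exists>s'. reach partial_sum s (i * 60 + 20) s' \<and> frame {''S'', ''j''} s s' \<and>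
    s' ''S'' 0 = int (\<Sum>j<i. if M j dvd m then M j * z (M j) else 0)"
proof -
  let ?s1 = "effect (''S'' ::= Const 0) s"
  let ?C = "Cond (Positive (Mod (V ''m'') (Read ''M'' (V ''j'')))) Skip
       (''S'' ::= Plus (V ''S'') (Times (Read ''M'' (V ''j'')) (Read ''Z'' (V ''j''))))"
  have "\<exists>s'. reach (for_loop ''j'' ''r'' ?C) ?s1 (i * (40 + 12) + 9) s' \<and> frame {''j'', ''S''} ?s1 s' \<and>
    s' ''S'' 0 = int (\<Sum>j<i. if M j dvd m then M j * z (M j) else 0)"
  proof (rule reach_for)
    fix j t assume j: "j < i" and t: "frame {''j'', ''S''} ?s1 t" "t ''j'' 0 = int j"
      "t ''S'' 0 = int (\<Sum>j<j. if M j dvd m then M j * z (M j) else 0)"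
    have "t ''m'' 0 = int m" "t ''M'' (int j) = int (M j)" "t ''Z'' (int j) = int (z (M j))" "0 < M j"
      using t(1) v M[OF j] by (simp_all add: frame_def)
    then show "\<exists>t'. reach ?C t 40 t' \<and> frame {''S''} t t' \<and>
        t' ''S'' 0 = int (\<Sum>j<Suc j. if M j dvd m then M j * z (M j) else 0)"
      using t(2,3) positive_mod_iff[of "M j" m]
      by (intro exI[of _ "effect ?C t"] conjI reach_mono[OF reach_loop_free]) auto
  qed (use v in auto)
  then obtain s' where s': "reach (for_loop ''j'' ''r'' ?C) ?s1 (i * (40 + 12) + 9) s'" "frame {''j'', ''S''} ?s1 s'"
    "s' ''S'' 0 = int (\<Sum>j<i. if M j dvd m then M j * z (M j) else 0)" by blast
  have "reach partial_sum s (i * 60 + 20) s'"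
    unfolding partial_sum_def by (rule reach_block_Seq[OF _ s'(1)]) simp_all
  moreover have "frame {''S'', ''j''} s s'" using s'(2) by (auto simp: frame_def)
  ultimately show ?thesis using s'(3) by blast
qed

definition emit_cycle :: com where
  "emit_cycle = ((''e'' ::= Divide (V ''m'') (V ''g'');; ''q'' ::= V ''e'';; ''u'' ::= Const 2);; squaring;;
     (''A'' ::= V ''q'';; ''B'' ::= V ''g'');; euclid;;
     Cond (Positive (Mod (Read ''Z'' (V ''r'')) (V ''A''))) (''ok'' ::= Const 0)
       (Write ''output'' (Plus (Times (Const 2) (V ''X'')) (Const 2)) (Divide (Read ''Z'' (V ''r'')) (V ''A''));;
        Write ''output'' (Plus (Times (Const 2) (V ''X'')) (Const 3)) (Times (V ''A'') (V ''e''));;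
        ''X'' ::= Plus (V ''X'') (Const 1)))"

text \<open>The offsets 2 and 3 leave room for the answer and the number of pairs, which are known
  only at the end.\<close>

definition outputs :: "perm_code \<Rightarrow> memory \<Rightarrow> bool" where
  "outputs xs s \<longleftrightarrow> s ''X'' 0 = int (length xs) \<and> (\<forall>t<length xs.
     s ''output'' (2 * int t + 2) = int (fst (xs ! t)) \<and> s ''output'' (2 * int t + 3) = int (snd (xs ! t)))"

lemma emit_cycle:
  assumes v: "s ''m'' 0 = int m" "s ''g'' 0 = int g" "s ''r'' 0 = int i" "s ''Z'' (int i) = int z" "s ''ok'' 0 = 1"
    and out: "outputs xs s" and g: "0 < g" "g < 2 ^ k"
  defines "d \<equiv> absorbed g (m div g)"
  shows "\<exists>s'. reach emit_cycle s (k * 82 + 160) s' \<and>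
    frame {''e'', ''q'', ''u'', ''A'', ''B'', ''t'', ''ok'', ''output'', ''X''} s s' \<and>
    (if d dvd z then s' ''ok'' 0 = 1 \<and> outputs (xs @ [(z div d, d * (m div g))]) s'
     else s' ''ok'' 0 = 0)"
proof -
  let ?F = "{''e'', ''q'', ''u'', ''A'', ''B'', ''t'', ''ok'', ''output'', ''X''}"
  let ?B1 = "''e'' ::= Divide (V ''m'') (V ''g'');; ''q'' ::= V ''e'';; ''u'' ::= Const 2"
  let ?B2 = "''A'' ::= V ''q'';; ''B'' ::= V ''g''"
  let ?B3 = "Cond (Positive (Mod (Read ''Z'' (V ''r'')) (V ''A''))) (''ok'' ::= Const 0)
       (Write ''output'' (Plus (Times (Const 2) (V ''X'')) (Const 2)) (Divide (Read ''Z'' (V ''r'')) (V ''A''));;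
        Write ''output'' (Plus (Times (Const 2) (V ''X'')) (Const 3)) (Times (V ''A'') (V ''e''));;
        ''X'' ::= Plus (V ''X'') (Const 1))"
  let ?e = "m div g"
  let ?s1 = "effect ?B1 s"
  have s1: "?s1 ''g'' 0 = int g" "?s1 ''u'' 0 = 2" "?s1 ''q'' 0 = int ?e" "?s1 ''e'' 0 = int ?e"
    using v by (simp_all add: zdiv_int)
  obtain s2 p where s2: "reach squaring ?s1 (k * 30 + 10) s2" "frame {''u'', ''q''} ?s1 s2"
    "s2 ''q'' 0 = int (?e ^ p)" "g < 2 ^ p" using squaring[of ?s1 g ?e k, OF s1(1-3) g(2)] by blast
  have e2: "s2 ''e'' 0 = int ?e" "s2 ''g'' 0 = int g" using s2(2) s1 by (simp_all add: frame_def)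
  let ?s3 = "effect ?B2 s2"
  have "?s3 ''A'' 0 = int (?e ^ p)" "?s3 ''B'' 0 = int g" using s2(3) e2 by simp_all
  then obtain s4 where s4: "reach euclid ?s3 ((2 * k + 1) * 26 + 5) s4" "frame {''A'', ''B'', ''t''} ?s3 s4"
    "s4 ''A'' 0 = int (gcd (?e ^ p) g)" using euclid[of ?s3 "?e ^ p" g k] g(2) by blast
  have A: "s4 ''A'' 0 = int d"
    using s4(3) absorbed_eq[OF g(1) s2(4), of ?e] by (simp add: d_def gcd.commute)
  let ?G = "{''u'', ''q'', ''A'', ''B'', ''t'', ''e''}"
  have "frame ?G s ?s1" by simp
  then have "frame ?G s s2" using frame_trans[OF _ s2(2), of ?G s ?G] by simp
  then have "frame ?G s ?s3" by simp
  then have "frame ?G s s4" using frame_trans[OF _ s4(2), of ?G s ?G] by simp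
  then have fr4: "frame ?F s s4" and v4: "s4 ''Z'' = s ''Z''" "s4 ''r'' = s ''r''" "s4 ''ok'' = s ''ok''" "s4 ''output'' = s ''output''" "s4 ''X'' = s ''X''"
    by (simp_all add: frame_def)
  have e4: "s4 ''e'' 0 = int ?e" using s4(2) e2 by (simp add: frame_def)
  let ?s5 = "effect ?B3 s4"
  have d: "0 < d" using absorbed_pos[OF g(1)] by (simp add: d_def)
  have "reach emit_cycle s (k * 82 + 160) ?s5"
    unfolding emit_cycle_def
    by (rule reach_block_Seq[OF _ reach_Seq[OF s2(1) reach_block_Seq[OF _ reach_Seq_block[OF s4(1) _ order_refl] order_refl]
      order_refl]]) simp_all
  moreover have "frame ?F s ?s5" using fr4 by simp
  moreover have "if d dvd z then ?s5 ''ok'' 0 = 1 \<and> outputs (xs @ [(z div d, d * ?e)]) ?s5 else ?s5 ''ok'' 0 = 0"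
  proof (cases "d dvd z")
    case True
    then have "\<not> 0 < int z - int z div int d * int d" using positive_mod_iff[OF d] by simp
    then have s5: "?s5 ''ok'' 0 = 1" "?s5 ''X'' 0 = int (length xs) + 1"
      "?s5 ''output'' = (s ''output'')(2 * int (length xs) + 2 := int (z div d), 2 * int (length xs) + 3 := int (d * ?e))"
      using out v v4 A e4 by (simp_all add: outputs_def zdiv_int)
    have "outputs (xs @ [(z div d, d * ?e)]) ?s5"
      using out s5(2,3) by (auto simp: outputs_def nth_append less_Suc_eq simp del: effect.simps)
    then show ?thesis using True s5(1) by simp
  next
    case False
    then have "0 < int z - int z div int d * int d" using positive_mod_iff[OF d] by simp
    then show ?thesis using False v v4 A by simp
  qed
  ultimately show ?thesis by blast
qed

section \<open>Recovering the solution length by length\<close>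

text \<open>The second evaluation is essential: the search leaves in \<open>T\<close> the residual
  of its last probe, which need not be that of \<open>y\<close>. For a solution, \<open>v\<close> is
  \<open>m\<close> times the multiplicity of \<open>m\<close> in \<open>cycle g * X\<close>, so a
  nonzero residual, a negative \<open>v\<close> or a remainder refutes solvability.\<close>

definition node :: com where
  "node = (''m'' ::= Read ''M'' (V ''r'');; partial_sum;; gallop;; ''w'' ::= V ''y'';; evaluate;;
     ''v'' ::= Minus (Times (V ''g'') (V ''y'')) (V ''S'');;
     Cond (Conj (Conj (Neg (Less (V ''T'') (Const 0))) (Neg (Less (Const 0) (V ''T''))))
             (Conj (Neg (Less (V ''v'') (Const 0))) (Neg (Positive (Mod (V ''v'') (V ''m''))))))
       (Write ''Z'' (V ''r'') (Divide (V ''v'') (V ''m''));; Cond (Positive (V ''v'')) emit_cycle Skip)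
       (''ok'' ::= Const 0))"

section \<open>Arithmetic of the recovery in increasing order of length\<close>

context cycle_equation
begin

definition entries :: "entry list" where
  "entries = map (\<lambda>(e, n, l). (e, int n, l)) qs @ map (\<lambda>(n, l). (0, - int n, l)) bs"

definition nodes :: "nat list" where
  "nodes = sorted_list_of_set lengths"

definition total :: nat where
  "total = (\<Sum>(n, l)\<leftarrow>bs. n * l)"

abbreviation solution :: "permutation \<Rightarrow> bool" where
  "solution X \<equiv> lhs qs X = decode bs"

lemma residual_entries: "residual entries k m w = int (value_at (cap k qs) m w) - int (rhs_at bs m)"
proof -
  have "(\<Sum>(e, u, l)\<leftarrow>map (\<lambda>(e, n, l). (e, int n, l)) qs. if l dvd m then u * int l * int w ^ min e k else 0)
      = int (value_at (cap k qs) m w)"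
    by (induction qs) (auto simp: cap_def)
  moreover have "(\<Sum>(e, u, l)\<leftarrow>map (\<lambda>(n, l). (0, - int n, l)) bs. if l dvd m then u * int l * int w ^ min e k else 0)
      = - int (rhs_at bs m)"
    by (induction bs) (auto simp: rhs_at_def)
  ultimately show ?thesis by (simp add: residual_def entries_def)
qed

lemma rhs_at_le_total: "rhs_at bs m \<le> total"
  unfolding rhs_at_def total_def by (induction bs) auto

lemma length_entries: "length entries = length qs + length bs"
  by (simp add: entries_def)

lemma length_entries_pos: "0 < length entries"
  using seed by (auto simp: length_entries)

lemma set_nodes [simp]: "set nodes = lengths"
  by (simp add: nodes_def)

lemma distinct_nodes: "distinct nodes"
  by (simp add: nodes_def)

lemma sorted_nodes: "sorted nodes"
  by (simp add: nodes_def)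

lemma length_nodes: "length nodes \<le> length entries"
proof -
  have "length nodes = card lengths" by (simp add: nodes_def)
  also have "\<dots> \<le> card ((\<lambda>(e, n, l). l) ` set qs) + card (snd ` set bs)"
    unfolding lengths_def by (rule card_Un_le)
  also have "\<dots> \<le> length qs + length bs"
    by (intro add_mono order_trans[OF card_image_le card_length]) simp_all
  finally show ?thesis by (simp add: length_entries)
qed

text \<open>In increasing order proper divisors come first, so the sum at a node has exactly one new
  unknown; and no earlier node is a multiple, so fixing this unknown disturbs no sum settled
  before.\<close>

lemma nodes_dvd:
  assumes "i < length nodes"
  shows "{l \<in> lengths. l dvd nodes ! i} = insert (nodes ! i) {l \<in> set (take i nodes). l dvd nodes ! i}"
    and "nodes ! i \<notin> set (take i nodes)"
    and "\<And>m. m \<in> set (take i nodes) \<Longrightarrow> \<not> nodes ! i dvd m"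
proof -
  have less: "m < nodes ! i" if m: "m \<in> set (take i nodes)" for m
  proof -
    obtain j where j: "j < i" "m = nodes ! j" using m assms by (auto simp: in_set_conv_nth)
    then have "m \<le> nodes ! i" using sorted_nodes assms by (simp add: sorted_nth_mono)
    moreover have "m \<noteq> nodes ! i" using j assms distinct_nodes by (simp add: nth_eq_iff_index_eq)
    ultimately show ?thesis by simp
  qed
  show "nodes ! i \<notin> set (take i nodes)" using less by blast
  show "\<not> nodes ! i dvd m" if "m \<in> set (take i nodes)" for m
    using less[OF that] that lengths_pos in_set_takeD[OF that] by (auto dest: dvd_imp_le)
  have 1: "l \<in> set (take i nodes)" if "l \<in> lengths" "l dvd nodes ! i" "l \<noteq> nodes ! i" for l
  proof -
    have "0 < nodes ! i" using assms lengths_pos nth_mem by fastforce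
    with that(2) have "l \<le> nodes ! i" by (rule dvd_imp_le)
    then have "l < nodes ! i" using that(3) by (rule le_neq_implies_less)
    moreover have "l \<in> set nodes" using that(1) by (simp only: set_nodes)
    then obtain j where j: "j < length nodes" "nodes ! j = l" unfolding in_set_conv_nth by blast
    ultimately have "j < i" using sorted_nth_mono[OF sorted_nodes, of i j] by (cases "j < i") auto
    then show ?thesis using j by (auto simp: in_set_conv_nth)
  qed
  have 2: "set (take i nodes) \<subseteq> lengths" using set_take_subset[of i nodes] by simp
  have 3: "nodes ! i \<in> lengths" using assms nth_mem by fastforce
  show "{l \<in> lengths. l dvd nodes ! i} = insert (nodes ! i) {l \<in> set (take i nodes). l dvd nodes ! i}"
  proof (intro set_eqI iffI)
    fix x assume "x \<in> {l \<in> lengths. l dvd nodes ! i}"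
    then show "x \<in> insert (nodes ! i) {l \<in> set (take i nodes). l dvd nodes ! i}"
      using 1[of x] by (cases "x = nodes ! i") simp_all
  next
    fix x assume "x \<in> insert (nodes ! i) {l \<in> set (take i nodes). l dvd nodes ! i}"
    then show "x \<in> {l \<in> lengths. l dvd nodes ! i}" using 2 3 by (cases "x = nodes ! i") auto
  qed
qed

text \<open>Agreement with every solution turns a failing test into a proof of unsolvability. The
  bound \<open>m < 2 ^ k\<close> is recorded to keep later gcds cheap.\<close>

definition consistent :: "nat \<Rightarrow> nat \<Rightarrow> (nat \<Rightarrow> nat) \<Rightarrow> bool" where
  "consistent k i z \<longleftrightarrow> (\<forall>m\<in>set (take i nodes).
     (\<exists>y. value_at qs m y = rhs_at bs m \<and> g * y = (\<Sum>l\<in>{l\<in>lengths. l dvd m}. l * z l)) \<and>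
     (0 < z m \<longrightarrow> g dvd m \<and> m < 2 ^ k \<and> absorbed g (m div g) dvd z m) \<and>
     (\<forall>X. solution X \<longrightarrow> z m = multiplicity_of (cycle g * X) m))"

definition solution_code :: "nat \<Rightarrow> (nat \<Rightarrow> nat) \<Rightarrow> perm_code" where
  "solution_code i z = map (\<lambda>m. (z m div absorbed g (m div g), absorbed g (m div g) * (m div g)))
     (filter (\<lambda>m. 0 < z m) (take i nodes))"

definition search_result :: "nat \<Rightarrow> nat \<Rightarrow> nat \<Rightarrow> bool" where
  "search_result k m y \<longleftrightarrow> (let f = residual entries k m in
     if g dvd m then (y = 0 \<or> f y \<le> 0) \<and> 0 < f (y + 1) else y = 0)"

lemma residual_zero_iff:
  assumes "total < 2 ^ k" "0 < k"
  shows "residual entries k m w = 0 \<longleftrightarrow> value_at qs m w = rhs_at bs m"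
  using value_at_cap[OF qs_pos, where V = "rhs_at bs m" and k = k and m = m and w = w] rhs_at_le_total[of m] assms
  by (simp add: residual_entries)

lemma residual_strict_mono:
  assumes "0 < k" "g dvd m" "w < w'"
  shows "residual entries k m w < residual entries k m w'"
proof -
  obtain e n where e: "(e, n, g) \<in> set qs" "0 < e" using seed by blast
  then have "(min e k, n, g) \<in> set (cap k qs)" by (force simp: cap_def)
  from value_at_strict_mono[OF this, of m w w'] show ?thesis
    using assms e qs_pos[OF e(1)] by (simp add: residual_entries)
qed

lemma consistent_divisor_not_multiple:
  assumes "consistent k i z" "i < length nodes" "\<not> g dvd nodes ! i" "l \<in> set (take i nodes)" "l dvd nodes ! i"
  shows "z l = 0"
  using assms unfolding consistent_def by (metis dvd_trans gr0I)

text \<open>At a multiple of \<open>g\<close>, strict monotonicity squeezes the count of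
  \<open>X\<close> between \<open>y\<close> and \<open>y + 1\<close>, the latter excluded. Otherwise
  the residual is constant and every term of the second equation vanishes.\<close>

lemma search_result_solution:
  assumes k: "total < 2 ^ k" "0 < k" and c: "consistent k i z" and i: "i < length nodes"
    and y: "search_result k (nodes ! i) y" and X: "solution X"
  shows "residual entries k (nodes ! i) y = 0"
    and "g * y = (\<Sum>l\<in>{l\<in>set (take i nodes). l dvd nodes ! i}. l * z l)
      + nodes ! i * multiplicity_of (cycle g * X) (nodes ! i)"
proof -
  let ?m = "nodes ! i" let ?f = "residual entries k ?m" let ?x = "fixed_count ?m X"
  let ?D = "{l\<in>set (take i nodes). l dvd ?m}"
  have x: "?f ?x = 0" using solution_value[OF X] residual_zero_iff[OF k] by simp
  have zX: "(\<Sum>l\<in>?D. l * z l) = (\<Sum>l\<in>?D. l * multiplicity_of (cycle g * X) l)"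
    using c X by (intro sum.cong) (auto simp: consistent_def)
  have root: "y = ?x" if m: "g dvd ?m"
  proof -
    have y1: "y = 0 \<or> ?f y \<le> 0" "0 < ?f (y + 1)"
      using y m by (auto simp: search_result_def Let_def)
    have "\<not> y + 1 < ?x" using residual_strict_mono[OF k(2) m, of "y + 1" ?x] x y1(2) by auto
    moreover have "?x \<noteq> y + 1" using x y1(2) by auto
    moreover have "\<not> ?x < y" using residual_strict_mono[OF k(2) m, of ?x y] x y1(1) by auto
    ultimately show ?thesis by linarith
  qed
  show "?f y = 0"
  proof (cases "g dvd ?m")
    case True
    then show ?thesis using root x by simp
  next
    case False
    then show ?thesis
      using x unfolding residual_zero_iff[OF k] using value_at_indep[of ?m y ?x] by simp
  qed
  show "g * y = (\<Sum>l\<in>?D. l * z l) + ?m * multiplicity_of (cycle g * X) ?m"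
  proof (cases "g dvd ?m")
    case True
    have "g * y = (\<Sum>l\<in>insert ?m ?D. l * multiplicity_of (cycle g * X) l)"
      using solution_sum[OF X True] root[OF True] unfolding nodes_dvd(1)[OF i] by simp
    also have "\<dots> = ?m * multiplicity_of (cycle g * X) ?m + (\<Sum>l\<in>?D. l * z l)"
      using nodes_dvd(2)[OF i] by (subst sum.insert) (simp_all add: zX)
    finally show ?thesis by simp
  next
    case False
    have "y = 0" using y False by (simp add: search_result_def Let_def)
    moreover have "(\<Sum>l\<in>?D. l * z l) = 0" using consistent_divisor_not_multiple[OF c i False] by simp
    moreover have "multiplicity_of (cycle g * X) ?m = 0" using multiplicity_seed_times False by blast
    ultimately show ?thesis by (simp only: mult_0_right add_0)
  qed
qed

lemma consistent_Suc:
  assumes k: "total < 2 ^ k" "0 < k" and c: "consistent k i z" and i: "i < length nodes"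
    and y: "search_result k (nodes ! i) y" "residual entries k (nodes ! i) y = 0"
    and v: "g * y = (\<Sum>l\<in>{l\<in>set (take i nodes). l dvd nodes ! i}. l * z l) + nodes ! i * x"
    and x: "0 < x \<Longrightarrow> absorbed g (nodes ! i div g) dvd x"
  shows "consistent k (Suc i) (z(nodes ! i := x))"
proof -
  let ?m = "nodes ! i" let ?z = "z(?m := x)"
  have old: "(\<Sum>l\<in>{l\<in>lengths. l dvd m}. l * ?z l) = (\<Sum>l\<in>{l\<in>lengths. l dvd m}. l * z l)"
    if "m \<in> set (take i nodes)" for m
    using nodes_dvd(3)[OF i that] by (intro sum.cong) auto
  have "(\<Sum>l\<in>{l\<in>set (take i nodes). l dvd ?m}. l * ?z l) = (\<Sum>l\<in>{l\<in>set (take i nodes). l dvd ?m}. l * z l)"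
    using nodes_dvd(2)[OF i] by (intro sum.cong) auto
  then have new: "g * y = (\<Sum>l\<in>{l\<in>lengths. l dvd ?m}. l * ?z l)"
    unfolding nodes_dvd(1)[OF i] using nodes_dvd(2)[OF i] v by simp
  have val: "value_at qs ?m y = rhs_at bs ?m" using y(2) residual_zero_iff[OF k] by simp
  have mpos: "0 < ?m" using i lengths_pos nth_mem by fastforce
  \<comment> \<open>A positive \<open>x\<close> forces \<open>y > 0\<close>, which the search yields
    only if \<open>g\<close> divides \<open>?m\<close>. Then the seed term dominates:
    \<open>?m \<le> g * y \<le> g * y ^ e\<close>, and this is at most the number of points of
    \<open>B\<close>.\<close>
  have pos: "g dvd ?m \<and> ?m < 2 ^ k" if "0 < x"
  proof
    have "0 < ?m * x" using that mpos by simp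
    then have "0 < y" using v by (cases y) auto
    then show "g dvd ?m" using y(1) by (auto simp: search_result_def Let_def split: if_splits)
    obtain e n where e: "(e, n, g) \<in> set qs" "0 < e" using seed by blast
    have "?m \<le> ?m * x" using that by simp
    also have "\<dots> \<le> g * y" using v by simp
    also have "\<dots> \<le> g * y ^ e" using \<open>0 < y\<close> e(2) by (simp add: self_le_power)
    also have "\<dots> \<le> value_at qs ?m y" using value_at_ge[OF e(1) _ g_pos \<open>g dvd ?m\<close>] qs_pos[OF e(1)] by simp
    also have "\<dots> \<le> total" using val rhs_at_le_total by simp
    finally show "?m < 2 ^ k" using k(1) by simp
  qed
  have uniq: "x = multiplicity_of (cycle g * X) ?m" if "solution X" for X
    using search_result_solution(2)[OF k c i y(1) that] v mpos by simp
  have "take (Suc i) nodes = take i nodes @ [?m]" using i by (rule take_Suc_conv_app_nth)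
  then show ?thesis
    using c old new val pos x uniq nodes_dvd(2)[OF i] unfolding consistent_def by auto
qed

lemma search_bound:
  assumes k: "total < 2 ^ k" "0 < k" and m: "g dvd m"
  obtains X A where "\<And>e u l. (e, u, l) \<in> set entries \<Longrightarrow> l dvd m \<Longrightarrow> min e k \<le> X"
    and "\<And>w. residual entries k m w \<le> 0 \<Longrightarrow> w < 2 ^ A"
    and "(2 * A + 2) * (20 * X + 100) \<le> 720 * k" "A \<le> 2 * k" "X \<le> k"
proof -
  let ?S = "{min e k | e u l. (e, u, l) \<in> set entries \<and> l dvd m}"
  have fin: "finite ?S"
    by (rule finite_subset[of _ "(\<lambda>(e, u, l). min e k) ` set entries"]) force+
  obtain e n where e: "(e, n, g) \<in> set qs" "0 < e" using seed by blast
  \<comment> \<open>The seed term is active at every multiple of \<open>g\<close>, so the maximum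
    below exists and is at least 1.\<close>
  then have mem: "min e k \<in> ?S" using m by (force simp: entries_def)
  define X where "X = Max ?S"
  have ge: "min e' k \<le> X" if "(e', u, l) \<in> set entries" "l dvd m" for e' u l
    unfolding X_def using fin that by (intro Max_ge) blast+
  have "min e k \<le> X" unfolding X_def using fin mem by (rule Max_ge)
  then have X0: "0 < X" using e k(2) by simp
  have "X \<in> ?S" unfolding X_def using fin mem by (intro Max_in) auto
  then obtain e' u l where "(e', u, l) \<in> set entries" and l: "l dvd m" "X = min e' k" by blast
  then obtain n' where q: "(e', n', l) \<in> set qs" using X0 by (auto simp: entries_def)
  have Xk: "X \<le> k" using l by simp
  define A where "A = k div X + 1"
  have "A * X = X * (k div X) + X" by (simp add: A_def algebra_simps)
  then have AX: "k \<le> A * X" "A * X \<le> k + X"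
    using mult_div_mod_eq[of X k] mod_less_divisor[OF X0, of k] by linarith+
  have "w < 2 ^ A" if w: "residual entries k m w \<le> 0" for w
  proof (rule ccontr)
    assume "\<not> ?thesis"
    then have "(2 ^ A) ^ X \<le> w ^ X" by (intro power_mono) auto
    moreover have "(2::nat) ^ k \<le> (2 ^ A) ^ X" using AX(1) by (simp flip: power_mult)
    moreover have "w ^ X \<le> l * w ^ X" using qs_pos[OF q] by simp
    moreover have "(X, n', l) \<in> set (cap k qs)" using q l(2) by (force simp: cap_def)
    from value_at_ge[OF this _ _ l(1), of w] have "l * w ^ X \<le> value_at (cap k qs) m w"
      using qs_pos[OF q] by simp
    moreover have "value_at (cap k qs) m w \<le> rhs_at bs m" using w by (simp add: residual_entries)
    ultimately show False using rhs_at_le_total[of m] k(1) by simp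
  qed
  moreover have Ak: "A \<le> k + 1" using div_le_dividend[of k X] by (simp add: A_def)
  then have "A \<le> 2 * k" using k(2) by linarith
  moreover have "(2 * A + 2) * (20 * X + 100) \<le> 720 * k"
  proof -
    \<comment> \<open>The four summands are at most \<open>80 * k\<close>,
      \<open>200 * k + 200\<close>, \<open>40 * k\<close> and \<open>200\<close>; with
      \<open>1 \<le> k\<close> this gives 720.\<close>
    have "(2 * A + 2) * (20 * X + 100) = 40 * (A * X) + 200 * A + 40 * X + 200"
      by (simp add: algebra_simps)
    then show ?thesis using AX(2) Xk k(2) Ak by linarith
  qed
  ultimately show thesis using that ge Xk by blast
qed

end

section \<open>Correctness and cost of the program at one length\<close>

context cycle_equation
begin

definition env :: "nat \<Rightarrow> memory \<Rightarrow> bool" where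
  "env k s \<longleftrightarrow> stores entries s \<and> s ''g'' 0 = int g \<and> s ''k'' 0 = int k \<and>
     s ''R'' 0 = int (length nodes) \<and> (\<forall>j<length nodes. s ''M'' (int j) = int (nodes ! j))"

lemma env_frame:
  "env k s \<Longrightarrow> frame F s s' \<Longrightarrow> {''n'', ''E'', ''U'', ''L'', ''g'', ''k'', ''R'', ''M''} \<inter> F = {} \<Longrightarrow> env k s'"
  unfolding env_def by (auto simp: frame_eq intro: stores_frame)

text \<open>Pairs are written before solvability is known. This does no harm: a negative answer
  prescribes only word 0, which is written at the very end.\<close>

definition progress :: "nat \<Rightarrow> nat \<Rightarrow> memory \<Rightarrow> bool" where
  "progress k i s \<longleftrightarrow>
     s ''ok'' 0 = 1 \<and> (\<exists>z. consistent k i z \<and> (\<forall>j<i. s ''Z'' (int j) = int (z (nodes ! j))) \<and>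
       outputs (solution_code i z) s) \<or>
     s ''ok'' 0 = 0 \<and> (\<forall>X. \<not> solution X)"

lemma sum_take_nodes:
  assumes "i \<le> length nodes"
  shows "(\<Sum>j<i. if nodes ! j dvd m then nodes ! j * z (nodes ! j) else 0)
    = (\<Sum>l\<in>{l\<in>set (take i nodes). l dvd m}. l * z l)"
proof -
  have "bij_betw ((!) (take i nodes)) {..<i} (set (take i nodes))"
    using assms distinct_nodes by (intro bij_betw_nth) auto
  then have "(\<Sum>l\<in>set (take i nodes). if l dvd m then l * z l else 0)
      = (\<Sum>j<i. if take i nodes ! j dvd m then take i nodes ! j * z (take i nodes ! j) else 0)"
    by (rule sum.reindex_bij_betw[symmetric])
  also have "\<dots> = (\<Sum>j<i. if nodes ! j dvd m then nodes ! j * z (nodes ! j) else 0)"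
    by (rule sum.cong) auto
  finally show ?thesis by (simp add: sum.inter_filter)
qed

text \<open>If \<open>g\<close> does not divide \<open>m\<close>, only constant terms are active at
  \<open>m\<close>, and both bounds can be 0.\<close>

lemma search_bound_nodes:
  assumes k: "total < 2 ^ k" "0 < k"
  obtains X A where "\<And>e u l. (e, u, l) \<in> set entries \<Longrightarrow> l dvd m \<Longrightarrow> min e k \<le> X"
    and "\<And>w. g dvd m \<Longrightarrow> residual entries k m w \<le> 0 \<Longrightarrow> w < 2 ^ A"
    and "(2 * A + 2) * (20 * X + 100) \<le> 720 * k" "A \<le> 2 * k" "X \<le> k"
proof (cases "g dvd m")
  case True
  then show ?thesis using search_bound[OF k True] that by metis
next
  case False
  have e0: "e = 0" if el: "(e, u, l) \<in> set entries" "l dvd m" for e u l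
  proof (rule ccontr)
    assume "e \<noteq> 0"
    then obtain n where "(e, n, l) \<in> set qs" using el(1) by (auto simp: entries_def)
    then have "g dvd l" using seed_dvd \<open>e \<noteq> 0\<close> by blast
    then show False using False el(2) dvd_trans by blast
  qed
  show ?thesis
  proof (rule that[of 0 0])
    show "min e k \<le> 0" if "(e, u, l) \<in> set entries" "l dvd m" for e u l
      using e0[OF that] by simp
  qed (use False k(2) in auto)
qed

lemma node_time:
  fixes N k A X i :: nat
  assumes "0 < N" "0 < k" "(2 * A + 2) * (20 * X + 100) \<le> 720 * k" "A \<le> 2 * k" "X \<le> k" "i \<le> N"
  shows "(i * 60 + 20) + ((2 * A + 2) * (N * (20 * X + 100) + 80) + 50) + (N * (20 * X + 100) + 20) + (k * 82 + 160) + 300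
    \<le> 3000 * (N * k)"
proof -
  define P where "P = N * (20 * X + 100)"
  have "(2 * A + 2) * P = N * ((2 * A + 2) * (20 * X + 100))" by (simp add: P_def algebra_simps)
  also have "\<dots> \<le> N * (720 * k)" using assms(3) by (rule mult_le_mono2)
  finally have "(2 * A + 2) * P \<le> 720 * (N * k)" by simp
  moreover have "(2 * A + 2) * (P + 80) = (2 * A + 2) * P + (160 * A + 160)" by (simp add: algebra_simps)
  moreover have "P \<le> N * (120 * k)" unfolding P_def using assms(2,5) by (intro mult_le_mono2) simp
  moreover have "N * (120 * k) = 120 * (N * k)" by simp
  moreover have "N \<le> N * k" "k \<le> N * k" "1 \<le> N * k" using assms(1,2) by simp_all
  ultimately show ?thesis using assms(4,6) unfolding P_def[symmetric] by linarith
qed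

lemma entries_pos: "(e, u, l) \<in> set entries \<Longrightarrow> 0 < l"
  using qs_pos bs_pos by (auto simp: entries_def)

lemma node:
  assumes k: "total < 2 ^ k" "0 < k" and env: "env k s" and i: "i < length nodes" "s ''r'' 0 = int i"
    and ok: "s ''ok'' 0 = 1" and pr: "progress k i s"
  defines "F \<equiv> {''m'', ''S'', ''j'', ''y'', ''b'', ''up'', ''w'', ''T'', ''a'', ''h'', ''v'', ''Z'',
    ''e'', ''q'', ''u'', ''A'', ''B'', ''t'', ''ok'', ''output'', ''X''}"
  shows "\<exists>s'. reach node s (3000 * (length entries * k)) s' \<and> frame F s s' \<and> progress k (Suc i) s'"
proof -
  let ?m = "nodes ! i" let ?N = "length entries"
  let ?D = "{l\<in>set (take i nodes). l dvd ?m}"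
  have mpos: "0 < ?m" using i lengths_pos nth_mem by fastforce
  from pr ok obtain z where z: "consistent k i z" "\<And>j. j < i \<Longrightarrow> s ''Z'' (int j) = int (z (nodes ! j))"
    "outputs (solution_code i z) s" by (auto simp: progress_def)
  obtain X A where XA: "\<And>e u l. (e, u, l) \<in> set entries \<Longrightarrow> l dvd ?m \<Longrightarrow> min e k \<le> X"
    "\<And>w. g dvd ?m \<Longrightarrow> residual entries k ?m w \<le> 0 \<Longrightarrow> w < 2 ^ A"
    "(2 * A + 2) * (20 * X + 100) \<le> 720 * k" "A \<le> 2 * k" "X \<le> k" by (rule search_bound_nodes[OF k, of "nodes ! i"]) (rule that)
  let ?s1 = "effect (''m'' ::= Read ''M'' (V ''r'')) s"
  have m1: "?s1 ''m'' 0 = int ?m" using env i by (simp add: env_def)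
  have fr1: "frame F s ?s1" by (simp add: F_def)
  have M1: "?s1 ''M'' (int j) = int (nodes ! j) \<and> 0 < nodes ! j \<and> ?s1 ''Z'' (int j) = int (z (nodes ! j))"
    if "j < i" for j
    using env i z(2)[OF that] that lengths_pos[of "nodes ! j"] nth_mem[of j nodes] by (simp add: env_def)
  have r1: "?s1 ''r'' 0 = int i" using i by simp
  obtain s2 where s2: "reach partial_sum ?s1 (i * 60 + 20) s2" "frame {''S'', ''j''} ?s1 s2"
    "s2 ''S'' 0 = int (\<Sum>l\<in>?D. l * z l)"
    using partial_sum[of ?s1 ?m i "(!) nodes" z, OF m1 r1 M1] i(1)
    by (simp only: sum_take_nodes less_imp_le) blast
  have fr2: "frame F s s2" using frame_trans[OF fr1 s2(2), of F] by (simp add: F_def)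
  have e2: "env k s2" using env_frame[OF env fr2] by (simp add: F_def)
  have m2: "s2 ''m'' 0 = int ?m" using s2(2) m1 by (simp add: frame_def)
  obtain s3 y where s3: "reach gallop s2 ((2 * A + 2) * (?N * (20 * X + 100) + 80) + 50) s3"
    "frame {''y'', ''b'', ''up'', ''w'', ''T'', ''j'', ''a'', ''h''} s2 s3" "s3 ''y'' 0 = int y"
    "search_result k ?m y"
    using gallop[of entries s2 ?m k g X A] e2 m2 g_pos XA(1,2) entries_pos
    unfolding env_def search_result_def Let_def by blast
  have fr3: "frame F s s3" using frame_trans[OF fr2 s3(2), of F] by (simp add: F_def)
  let ?s4 = "effect (''w'' ::= V ''y'') s3"
  have fr4: "frame F s ?s4" using fr3 by (simp add: F_def)
  have e4: "env k ?s4" using env_frame[OF env fr4] by (simp add: F_def)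
  have m4: "?s4 ''m'' 0 = int ?m" "?s4 ''w'' 0 = int y" "?s4 ''y'' 0 = int y" "?s4 ''S'' 0 = int (\<Sum>l\<in>?D. l * z l)"
    using s2(3) s3(2,3) m2 by (simp_all add: frame_def)
  obtain s5 where s5: "reach evaluate ?s4 (?N * (20 * X + 100) + 20) s5" "frame {''T'', ''j'', ''a'', ''h''} ?s4 s5"
    "s5 ''T'' 0 = residual entries k ?m y"
    using evaluate[of entries ?s4 ?m k y X] e4 m4 XA(1) entries_pos unfolding env_def by blast
  have fr5: "frame F s s5" using frame_trans[OF fr4 s5(2), of F] by (simp add: F_def)
  have e5: "env k s5" using env_frame[OF env fr5] by (simp add: F_def)
  have m5: "s5 ''m'' 0 = int ?m" "s5 ''y'' 0 = int y" "s5 ''S'' 0 = int (\<Sum>l\<in>?D. l * z l)"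
    using s5(2) m4 by (simp_all add: frame_def)
  \<comment> \<open>A sharper frame: up to the tests, the arrays holding the results are untouched,
    which \<open>F\<close> itself cannot express.\<close>
  have "frame (F - {''Z'', ''ok'', ''output'', ''X''}) s ?s1" by (simp add: F_def)
  then have "frame (F - {''Z'', ''ok'', ''output'', ''X''}) s s2"
    using frame_trans[OF _ s2(2), of "F - {''Z'', ''ok'', ''output'', ''X''}" s] by (simp add: F_def)
  then have "frame (F - {''Z'', ''ok'', ''output'', ''X''}) s s3"
    using frame_trans[OF _ s3(2), of "F - {''Z'', ''ok'', ''output'', ''X''}" s] by (simp add: F_def)
  then have "frame (F - {''Z'', ''ok'', ''output'', ''X''}) s ?s4" by (simp add: F_def)
  then have "frame (F - {''Z'', ''ok'', ''output'', ''X''}) s s5"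
    using frame_trans[OF _ s5(2), of "F - {''Z'', ''ok'', ''output'', ''X''}" s] by (simp add: F_def)
  then have same5: "s5 ''Z'' = s ''Z''" "s5 ''ok'' = s ''ok''" "s5 ''output'' = s ''output''" "s5 ''X'' = s ''X''" "s5 ''r'' = s ''r''"
    by (simp_all add: frame_def F_def)
  let ?B = "''v'' ::= Minus (Times (V ''g'') (V ''y'')) (V ''S'')"
  let ?s6 = "effect ?B s5"
  define v where "v = int (g * y) - int (\<Sum>l\<in>?D. l * z l)"
  have v6: "?s6 ''v'' 0 = v" "?s6 ''T'' 0 = residual entries k ?m y" "?s6 ''m'' 0 = int ?m"
    "?s6 ''Z'' = s ''Z''" "?s6 ''ok'' = s ''ok''" "?s6 ''output'' = s ''output''" "?s6 ''X'' = s ''X''" "?s6 ''r'' = s ''r''"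
    "?s6 ''g'' 0 = int g"
    using m5 s5(3) same5 e5 by (simp_all add: v_def env_def)
  have fr6: "frame F s ?s6" using fr5 by (simp add: F_def)
  let ?b = "Conj (Conj (Neg (Less (V ''T'') (Const 0))) (Neg (Less (Const 0) (V ''T''))))
             (Conj (Neg (Less (V ''v'') (Const 0))) (Neg (Positive (Mod (V ''v'') (V ''m'')))))"
  let ?W = "Write ''Z'' (V ''r'') (Divide (V ''v'') (V ''m''))"
  let ?C = "Cond ?b (?W;; Cond (Positive (V ''v'')) emit_cycle Skip) (''ok'' ::= Const 0)"
  have b_iff: "bval ?b ?s6 \<longleftrightarrow> residual entries k ?m y = 0 \<and> 0 \<le> v \<and> \<not> 0 < v - v div int ?m * int ?m"
    unfolding bval.simps aval.simps v6(1-3) by linarith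
  have take: "take (Suc i) nodes = take i nodes @ [?m]" using i(1) by (rule take_Suc_conv_app_nth)
  have "\<exists>s'. reach ?C ?s6 (k * 82 + 160 + 100) s' \<and> frame F s s' \<and> progress k (Suc i) s'"
  proof (cases "bval ?b ?s6")
    case False
    let ?s7 = "effect (''ok'' ::= Const 0) ?s6"
    have "\<not> solution X" for X
    proof
      assume X: "solution X"
      let ?x = "multiplicity_of (cycle g * X) ?m"
      have "residual entries k ?m y = 0" "g * y = (\<Sum>l\<in>?D. l * z l) + ?m * ?x"
        using search_result_solution[OF k z(1) i(1) s3(4) X] by blast+
      then have "residual entries k ?m y = 0" "v = int ?m * int ?x" by (simp_all add: v_def)
      then show False using False mpos unfolding b_iff by simp
    qed
    moreover have "reach ?C ?s6 (k * 82 + 160 + 100) ?s7"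
      using False by (rule reach_CondF[OF _ reach_loop_free]) simp_all
    moreover have "frame F s ?s7" using fr6 by (simp add: F_def)
    ultimately show ?thesis by (intro exI[of _ ?s7]) (simp add: progress_def)
  next
    case True
    then have T0: "residual entries k ?m y = 0" and v0: "0 \<le> v" and "\<not> 0 < v - v div int ?m * int ?m"
      unfolding b_iff by auto
    \<comment> \<open>For a positive divisor the remainder is nonnegative, so failing to be positive
      means being zero.\<close>
    then have "v mod int ?m = 0"
      using mpos pos_mod_sign[of "int ?m" v] unfolding minus_div_mult_eq_mod by linarith
    then obtain c where c: "v = int ?m * c" by auto
    have "0 \<le> c" using v0 mpos c by (simp add: zero_le_mult_iff)
    then obtain x where x: "v = int (?m * x)" using c by (metis nonneg_int_cases of_nat_mult)
    then have "int (g * y) = int ((\<Sum>l\<in>?D. l * z l) + ?m * x)" unfolding v_def of_nat_add by linarith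
    then have gy: "g * y = (\<Sum>l\<in>?D. l * z l) + ?m * x" by (simp only: of_nat_eq_iff)
    let ?s7 = "effect ?W ?s6"
    have vdiv: "v div int ?m = int x" using x mpos by simp
    have v7: "?s7 ''Z'' = (s ''Z'')(int i := int x)" "?s7 ''ok'' 0 = 1" "?s7 ''r'' 0 = int i" "?s7 ''v'' 0 = v"
      "?s7 ''m'' 0 = int ?m" "?s7 ''g'' 0 = int g" "outputs (solution_code i z) ?s7"
      using v6 i(2) ok vdiv z(3) by (simp_all add: outputs_def)
    have fr7: "frame F s ?s7" using fr6 by (simp add: F_def)
    let ?z = "z(?m := x)"
    have Zold: "\<forall>j<Suc i. t ''Z'' (int j) = int (?z (nodes ! j))" if "t ''Z'' = (s ''Z'')(int i := int x)" for t
      using that z(2) i(1) distinct_nodes by (auto simp: less_Suc_eq nth_eq_iff_index_eq)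
    have "filter (\<lambda>m. 0 < ?z m) (take i nodes) = filter (\<lambda>m. 0 < z m) (take i nodes)"
      using nodes_dvd(2)[OF i(1)] by (intro filter_cong) auto
    then have code: "solution_code (Suc i) ?z = solution_code i z @
        (if 0 < x then [(x div absorbed g (?m div g), absorbed g (?m div g) * (?m div g))] else [])"
      using nodes_dvd(2)[OF i(1)] unfolding solution_code_def take by auto
    have "\<exists>s'. reach (Cond (Positive (V ''v'')) emit_cycle Skip) ?s7 (k * 82 + 160 + 10) s' \<and> frame F s s' \<and>
      progress k (Suc i) s'"
    proof (cases "0 < x")
      case False
      then have "\<not> bval (Positive (V ''v'')) ?s7" using v7(4) x by simp
      then have "reach (Cond (Positive (V ''v'')) emit_cycle Skip) ?s7 (k * 82 + 160 + 10) ?s7"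
        by (rule reach_CondF[OF _ reach_Skip]) simp
      moreover have "consistent k (Suc i) ?z"
        using False by (intro consistent_Suc[OF k z(1) i(1) s3(4) T0 gy]) simp
      then have "progress k (Suc i) ?s7"
        using v7 False code Zold[of ?s7] unfolding progress_def by auto
      ultimately show ?thesis using fr7 by blast
    next
      case x0: True
      then have b: "bval (Positive (V ''v'')) ?s7" using v7(4) x mpos by simp
      have "0 < y" using gy x0 mpos by (cases y) auto
      then have gm: "g dvd ?m" using s3(4) by (auto simp: search_result_def Let_def split: if_splits)
      \<comment> \<open>The seed may be arbitrarily large compared with \<open>B\<close>. Only a
        positive root at a multiple of \<open>g\<close> bounds it, and only then is a gcd with
        \<open>g\<close> computed.\<close>
      have "g < 2 ^ k"
      proof -
        obtain e n where e: "(e, n, g) \<in> set qs" "0 < e" using seed by blast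
        have "g \<le> g * y ^ e" using \<open>0 < y\<close> by simp
        also have "\<dots> \<le> value_at qs ?m y" using value_at_ge[OF e(1) _ g_pos gm] qs_pos[OF e(1)] by simp
        also have "\<dots> \<le> total" using T0 residual_zero_iff[OF k] rhs_at_le_total by simp
        finally show ?thesis using k(1) by simp
      qed
      moreover have "?s7 ''Z'' (int i) = int x" using v7(1) by simp
      ultimately obtain s8 where s8: "reach emit_cycle ?s7 (k * 82 + 160) s8"
        "frame {''e'', ''q'', ''u'', ''A'', ''B'', ''t'', ''ok'', ''output'', ''X''} ?s7 s8"
        "if absorbed g (?m div g) dvd x
         then s8 ''ok'' 0 = 1 \<and> outputs (solution_code i z @ [(x div absorbed g (?m div g), absorbed g (?m div g) * (?m div g))]) s8
         else s8 ''ok'' 0 = 0"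
        using emit_cycle[of ?s7 ?m g i x "solution_code i z" k] v7 g_pos by metis
      have "reach (Cond (Positive (V ''v'')) emit_cycle Skip) ?s7 (k * 82 + 160 + 10) s8"
        using b s8(1) by (rule reach_CondT) simp
      moreover have "frame F s s8" using frame_trans[OF fr7 s8(2), of F] by (simp add: F_def)
      moreover have "progress k (Suc i) s8"
      proof (cases "absorbed g (?m div g) dvd x")
        case True
        have "s8 ''Z'' = (s ''Z'')(int i := int x)" using s8(2) v7(1) by (simp add: frame_def)
        moreover have "consistent k (Suc i) ?z"
          using True by (intro consistent_Suc[OF k z(1) i(1) s3(4) T0 gy]) simp
        ultimately show ?thesis using s8(3) True code x0 Zold[of s8] unfolding progress_def by auto
      next
        case False
        have "\<not> solution X" for X
        proof
          assume X: "solution X"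
          have "?m * x = ?m * multiplicity_of (cycle g * X) ?m"
            using search_result_solution(2)[OF k z(1) i(1) s3(4) X] gy by simp
          then have "x = multiplicity_of (cycle g * X) ?m" using mpos by simp
          then show False using multiplicity_seed_times[of X ?m] x0 False by simp
        qed
        then show ?thesis using s8(3) False by (simp add: progress_def)
      qed
      ultimately show ?thesis by blast
    qed
    then obtain s' where s': "reach (Cond (Positive (V ''v'')) emit_cycle Skip) ?s7 (k * 82 + 160 + 10) s'"
      "frame F s s'" "progress k (Suc i) s'" by blast
    have "reach ?C ?s6 (k * 82 + 160 + 100) s'"
      using True by (rule reach_CondT[OF _ reach_block_Seq[OF _ s'(1) order_refl]]) simp_all
    then show ?thesis using s'(2,3) by blast
  qed
  then obtain s' where s': "reach ?C ?s6 (k * 82 + 160 + 100) s'" "frame F s s'" "progress k (Suc i) s'" by blast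
  have "i \<le> ?N" using i(1) length_nodes by simp
  then have time: "(i * 60 + 20) + ((2 * A + 2) * (?N * (20 * X + 100) + 80) + 50) + (?N * (20 * X + 100) + 20)
      + (k * 82 + 160) + 300 \<le> 3000 * (?N * k)"
    by (rule node_time[OF length_entries_pos k(2) XA(3-5)])
  have "reach node s (3000 * (?N * k)) s'"
    unfolding node_def
    by (rule reach_mono[OF reach_block_Seq[OF _ reach_Seq[OF s2(1) reach_Seq[OF s3(1) reach_block_Seq[OF _ reach_Seq[OF s5(1)
        reach_block_Seq[OF _ s'(1) order_refl] order_refl] order_refl] order_refl] order_refl] order_refl]])
      (use time in simp_all)
  then show ?thesis using s'(2,3) by blast
qed

end

section \<open>Checking the support\<close>

definition node_phase :: com where
  "node_phase = for_loop ''r'' ''R'' (Cond (Positive (V ''ok'')) node Skip)"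

definition join_step :: com where
  "join_step = Cond (Positive (Read ''Z'' (V ''j'')))
     ((''A'' ::= V ''x'';; ''B'' ::= Read ''M'' (V ''j''));; euclid;;
      (''l'' ::= Divide (Times (V ''x'') (Read ''M'' (V ''j''))) (V ''A'');;
       Cond (Positive (Read ''W'' (V ''l'')))
         (Cond (Less (Read ''W'' (V ''l'')) (Minus (Read ''W'' (V ''x'')) (Const 1)))
           (Write ''W'' (V ''l'') (Minus (Read ''W'' (V ''x'')) (Const 1))) Skip)
         (''ok'' ::= Const 0))) Skip"

text \<open>A node of weight 1 allows no further factor and is skipped.\<close>

definition support_phase :: com where
  "support_phase = for_loop ''r'' ''R'' (Cond (Positive (V ''ok''))
     (''x'' ::= Read ''M'' (V ''r'');;
      Cond (Less (Const 1) (Read ''W'' (V ''x''))) (for_loop ''j'' ''R'' join_step) Skip) Skip)"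

context cycle_equation
begin

lemma node_phase:
  assumes k: "total < 2 ^ k" "0 < k" and env: "env k s" and pr: "progress k 0 s"
  defines "F \<equiv> {''m'', ''S'', ''j'', ''y'', ''b'', ''up'', ''w'', ''T'', ''a'', ''h'', ''v'', ''Z'',
    ''e'', ''q'', ''u'', ''A'', ''B'', ''t'', ''ok'', ''output'', ''X''}"
  shows "\<exists>s'. reach node_phase s (length nodes * (3000 * (length entries * k) + 10 + 12) + 9) s' \<and>
    frame (insert ''r'' F) s s' \<and> progress k (length nodes) s'"
proof -
  let ?C = "Cond (Positive (V ''ok'')) node Skip"
  have "\<exists>s'. reach (for_loop ''r'' ''R'' ?C) s (length nodes * (3000 * (length entries * k) + 10 + 12) + 9) s' \<and>
    frame (insert ''r'' F) s s' \<and> progress k (length nodes) s'"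
  proof (rule reach_for)
    fix i t assume i: "i < length nodes" "frame (insert ''r'' F) s t" "t ''r'' 0 = int i" "progress k i t"
    show "\<exists>t'. reach ?C t (3000 * (length entries * k) + 10) t' \<and> frame F t t' \<and> progress k (Suc i) t'"
    proof (cases "t ''ok'' 0 = 1")
      case True
      have "env k t" using env_frame[OF env i(2)] by (simp add: F_def)
      then obtain t' where t': "reach node t (3000 * (length entries * k)) t'" "frame F t t'" "progress k (Suc i) t'"
        using node[OF k _ i(1,3) True i(4)] unfolding F_def by blast
      have "reach ?C t (3000 * (length entries * k) + 10) t'"
        by (rule reach_CondT[OF _ t'(1)]) (use True in simp_all)
      then show ?thesis using t' by blast
    next
      case False
      then have nosol: "t ''ok'' 0 = 0" "progress k (Suc i) t" using i(4) by (auto simp: progress_def)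
      have "\<not> bval (Positive (V ''ok'')) t" using nosol(1) by simp
      then have "reach ?C t (3000 * (length entries * k) + 10) t"
        by (rule reach_CondF[OF _ reach_Skip]) simp
      then show ?thesis using nosol(2) frame_refl by blast
    qed
  next
    show "progress k i (t(''r'' := v)) = progress k i t" for i t v by (simp add: progress_def outputs_def)
  qed (use env pr in \<open>simp_all add: env_def F_def\<close>)
  then show ?thesis unfolding node_phase_def .
qed

text \<open>For \<open>w l > 0\<close>, the number of factors \<open>X\<close> that may still be multiplied to a cycle of length
  \<open>l\<close> is \<open>w l - 1\<close>; the lengths with \<open>w l = 0\<close> are those not admitted.\<close>

definition weights :: "(nat \<Rightarrow> nat) \<Rightarrow> (nat \<times> nat) set \<Rightarrow> (nat \<Rightarrow> int) \<Rightarrow> bool" where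
  "weights z D w \<longleftrightarrow> (\<forall>l. 0 < w l \<longrightarrow> l \<in> lengths) \<and> (\<forall>l\<in>lengths. 1 \<le> w l) \<and>
     (\<forall>(e, n, l)\<in>set qs. int e + 1 \<le> w l) \<and>
     (\<forall>l. 2 \<le> w l \<longrightarrow> (\<exists>e n l0 j. (e, n, l0) \<in> set qs \<and> l \<in> joins {m \<in> lengths. 0 < z m} j l0 \<and>
        int j + w l \<le> int e + 1)) \<and>
     (\<forall>(n, t)\<in>D. 2 \<le> w n \<longrightarrow> w n - 1 \<le> w (lcm n t))"

lemma weightsD:
  assumes "weights z D w"
  shows "0 < w l \<Longrightarrow> l \<in> lengths" and "l \<in> lengths \<Longrightarrow> 1 \<le> w l"
    and "(e, n, l) \<in> set qs \<Longrightarrow> int e + 1 \<le> w l"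
    and "2 \<le> w l \<Longrightarrow> \<exists>e n l0 j. (e, n, l0) \<in> set qs \<and> l \<in> joins {m \<in> lengths. 0 < z m} j l0 \<and>
        int j + w l \<le> int e + 1"
    and "(l, t) \<in> D \<Longrightarrow> 2 \<le> w l \<Longrightarrow> w l - 1 \<le> w (lcm l t)"
  using assms unfolding weights_def by blast+

lemma consistent_all_lengths:
  assumes "consistent k (length nodes) z" "solution X"
  shows "cycle_lengths (cycle g * X) = {m \<in> lengths. 0 < z m}"
  using assms solution_lengths[OF assms(2)] unfolding consistent_def by (auto simp flip: count_greater_zero_iff)

lemma weights_join:
  assumes w: "weights z D w" and n: "2 \<le> w n" and t: "t \<in> lengths" "0 < z t"
  obtains e n' l0 j where "(e, n', l0) \<in> set qs" "lcm n t \<in> joins {m \<in> lengths. 0 < z m} (Suc j) l0"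
    "int (Suc j) + (w n - 1) \<le> int e + 1"
proof -
  obtain e n' l0 j where *: "(e, n', l0) \<in> set qs" "n \<in> joins {m \<in> lengths. 0 < z m} j l0" "int j + w n \<le> int e + 1"
    using weightsD(4)[OF w n] by blast
  then have "lcm n t \<in> joins {m \<in> lengths. 0 < z m} (Suc j) l0" using t by auto
  then show thesis using that * by simp
qed

text \<open>A weight of at least 2 certifies that \<open>n\<close> is reached from some term after
  \<open>j < e\<close> factors. One more factor is still a partial product, and for a solution
  \<open>solution_joins\<close> keeps it inside \<open>lengths\<close>.\<close>

lemma weights_fail:
  assumes w: "weights z D w" and n: "2 \<le> w n" and t: "t \<in> lengths" "0 < z t"
    and c: "consistent k (length nodes) z" and l: "\<not> 0 < w (lcm n t)"
  shows "\<not> solution X"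
proof
  assume X: "solution X"
  obtain e n' l0 j where *: "(e, n', l0) \<in> set qs" "lcm n t \<in> joins {m \<in> lengths. 0 < z m} (Suc j) l0"
    "int (Suc j) + (w n - 1) \<le> int e + 1" using weights_join[OF w n t] .
  have j: "Suc j \<le> e" using *(3) n by linarith
  then have "lcm n t \<in> lengths"
    using solution_joins[OF X *(1) _ _ j] *(2) j unfolding consistent_all_lengths[OF c X] by (meson Suc_le_lessD order_le_less_trans zero_le zero_less_Suc)
  then have "1 \<le> w (lcm n t)" by (rule weightsD(2)[OF w])
  then show False using l by simp
qed

text \<open>Weights grow only at proper multiples of \<open>n\<close>, so the constraints of the nodes up to \<open>n\<close>
  remain valid.\<close>

lemma weights_step:
  assumes w: "weights z D w" and n: "2 \<le> w n" "n \<in> lengths" and t: "t \<in> lengths" "0 < z t"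
    and l: "0 < w (lcm n t)" and D: "\<And>n' t'. (n', t') \<in> D \<Longrightarrow> n' \<le> n"
  shows "weights z (insert (n, t) D) (w(lcm n t := max (w (lcm n t)) (w n - 1)))"
proof (cases "w (lcm n t) < w n - 1")
  case False
  then have "w(lcm n t := max (w (lcm n t)) (w n - 1)) = w" by (intro fun_upd_idem) simp
  then show ?thesis using w False unfolding weights_def by simp
next
  case True
  let ?l = "lcm n t" let ?w = "w(?l := w n - 1)"
  have "0 < n" "0 < t" using n(2) t(1) lengths_pos by auto
  then have "n \<le> ?l" by (intro dvd_imp_le) (auto simp: lcm_pos_nat)
  moreover have "n \<noteq> ?l" using True by auto
  ultimately have nl: "n < ?l" by simp
  obtain e n' l0 j where *: "(e, n', l0) \<in> set qs" "?l \<in> joins {m \<in> lengths. 0 < z m} (Suc j) l0"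
    "int (Suc j) + (w n - 1) \<le> int e + 1" using weights_join[OF w n(1) t] .
  have ge: "w l' \<le> ?w l'" for l' using True by simp
  have "l' \<in> lengths" if "0 < ?w l'" for l'
    using weightsD(1)[OF w, of l'] weightsD(1)[OF w l] that by (cases "l' = ?l") auto
  moreover have "1 \<le> ?w l'" if "l' \<in> lengths" for l'
    using weightsD(2)[OF w that] ge[of l'] by linarith
  moreover have "int e + 1 \<le> ?w l'" if "(e, n'', l') \<in> set qs" for e n'' l'
    using weightsD(3)[OF w that] ge[of l'] by linarith
  moreover have "\<exists>e n l0 j. (e, n, l0) \<in> set qs \<and> l' \<in> joins {m \<in> lengths. 0 < z m} j l0 \<and> int j + ?w l' \<le> int e + 1"
    if "2 \<le> ?w l'" for l'
  proof (cases "l' = ?l")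
    case True
    then have "?w l' = w n - 1" "l' \<in> joins {m \<in> lengths. 0 < z m} (Suc j) l0" using *(2) by simp_all
    then show ?thesis using *(1,3) by metis
  next
    case False
    then have "?w l' = w l'" by simp
    then show ?thesis using weightsD(4)[OF w, of l'] that by simp
  qed
  moreover have "?w n'' - 1 \<le> ?w (lcm n'' t'')" if "(n'', t'') \<in> insert (n, t) D" "2 \<le> ?w n''" for n'' t''
  proof (cases "(n'', t'') = (n, t)")
    case True
    then show ?thesis using nl by simp
  next
    case False
    then have d: "(n'', t'') \<in> D" using that(1) by blast
    then have "?w n'' = w n''" using D[OF d] nl by simp
    moreover have "w n'' - 1 \<le> w (lcm n'' t'')"
      using weightsD(5)[OF w d] that(2) \<open>?w n'' = w n''\<close> by simp
    ultimately show ?thesis using ge[of "lcm n'' t''"] by simp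
  qed
  ultimately have "weights z (insert (n, t) D) ?w" unfolding weights_def by fast
  then show ?thesis using True by (simp add: max_absorb2)
qed

lemma weights_skip:
  assumes "weights z D w" "w n < 2" shows "weights z (D \<union> {n} \<times> T) w"
  using assms unfolding weights_def by auto

lemma weights_mono: "weights z D w \<Longrightarrow> D' \<subseteq> D \<Longrightarrow> weights z D' w"
  unfolding weights_def by blast

lemma weights_closed:
  assumes w: "weights z (lengths \<times> {m \<in> lengths. 0 < z m}) w" and q: "(e, n, l) \<in> set qs"
  shows "joins {m \<in> lengths. 0 < z m} e l \<subseteq> lengths"
proof -
  have "j \<le> e \<Longrightarrow> x \<in> joins {m \<in> lengths. 0 < z m} j l \<Longrightarrow> int e + 1 - int j \<le> w x" for j x
  proof (induction j arbitrary: x)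
    case 0
    then have "x = l" by simp
    then show ?case using weightsD(3)[OF w q] by simp
  next
    case (Suc j)
    then obtain y t where y: "x = lcm y t" "y \<in> joins {m \<in> lengths. 0 < z m} j l" "t \<in> lengths" "0 < z t" by auto
    have wy: "int e + 1 - int j \<le> w y" using Suc y(2) by simp
    then have "2 \<le> w y" using Suc.prems(1) by simp
    moreover from this have "y \<in> lengths" using weightsD(1)[OF w, of y] by simp
    ultimately have "w y - 1 \<le> w x" using weightsD(5)[OF w, of y t] y by simp
    then show ?case using wy by simp
  qed
  from this[OF order_refl] have "0 < w x" if "x \<in> joins {m \<in> lengths. 0 < z m} e l" for x using that by fastforce
  then show ?thesis using weightsD(1)[OF w] by blast
qed

section \<open>Running the propagation\<close>

definition support_ok :: "(nat \<Rightarrow> nat) \<Rightarrow> (nat \<times> nat) set \<Rightarrow> memory \<Rightarrow> bool" where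
  "support_ok z D s \<longleftrightarrow> s ''ok'' 0 = 1 \<and> weights z D (\<lambda>l. s ''W'' (int l)) \<or> s ''ok'' 0 = 0 \<and> (\<forall>X. \<not> solution X)"

lemma join_step:
  assumes c: "consistent k (length nodes) z" and env: "env k s"
    and Z: "\<And>j. j < length nodes \<Longrightarrow> s ''Z'' (int j) = int (z (nodes ! j))"
    and j: "j < length nodes" "s ''j'' 0 = int j" and n: "n \<in> lengths" "s ''x'' 0 = int n"
    and D: "\<And>n' t'. (n', t') \<in> D \<Longrightarrow> n' \<le> n"
    and ok: "support_ok z D s" "s ''ok'' 0 = 1 \<Longrightarrow> 2 \<le> s ''W'' (int n)"
  shows "\<exists>s'. reach join_step s (52 * k + 120) s' \<and> frame {''A'', ''B'', ''t'', ''l'', ''W'', ''ok''} s s' \<and>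
    support_ok z (D \<union> {n} \<times> {t. t = nodes ! j \<and> 0 < z t}) s' \<and> (s' ''ok'' 0 = 1 \<longrightarrow> 2 \<le> s' ''W'' (int n))"
proof (cases "0 < z (nodes ! j)")
  case False
  then have "\<not> bval (Positive (Read ''Z'' (V ''j''))) s" by (simp add: j Z[OF j(1)])
  then have "reach join_step s (52 * k + 120) s"
    unfolding join_step_def by (rule reach_CondF[OF _ reach_Skip]) simp
  moreover have "D \<union> {n} \<times> {t. t = nodes ! j \<and> 0 < z t} = D" using False by auto
  ultimately show ?thesis using ok by auto
next
  case True
  let ?t = "nodes ! j" let ?F = "{''A'', ''B'', ''t'', ''l'', ''W'', ''ok''}"
  have tl: "?t \<in> lengths" "nodes ! j \<in> set (take (length nodes) nodes)" using j(1) nth_mem by fastforce+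
  \<comment> \<open>The factor \<open>?t\<close> has positive multiplicity and is therefore small,
    whereas \<open>n\<close> may be a huge length of \<open>P\<close>; so \<open>?t\<close> takes
    the argument of the gcd that determines its cost.\<close>
  have tk: "?t < 2 ^ k" using c tl True unfolding consistent_def by blast
  have Mj: "s ''M'' (int j) = int ?t" using env j(1) by (simp add: env_def)
  let ?B1 = "''A'' ::= V ''x'';; ''B'' ::= Read ''M'' (V ''j'')"
  let ?s1 = "effect ?B1 s"
  have s1: "?s1 ''A'' 0 = int n" "?s1 ''B'' 0 = int ?t" using Mj j n by simp_all
  obtain s2 where s2: "reach euclid ?s1 ((2 * k + 1) * 26 + 5) s2" "frame {''A'', ''B'', ''t''} ?s1 s2"
    "s2 ''A'' 0 = int (gcd n ?t)" using euclid[of ?s1 n ?t k, OF s1 tk] by blast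
  have same: "s2 ''x'' 0 = int n" "s2 ''j'' 0 = int j" "s2 ''M'' = s ''M''" "s2 ''W'' = s ''W''" "s2 ''ok'' = s ''ok''"
    using s2(2) j n by (simp_all add: frame_def)
  let ?B2 = "''l'' ::= Divide (Times (V ''x'') (Read ''M'' (V ''j''))) (V ''A'');;
       Cond (Positive (Read ''W'' (V ''l'')))
         (Cond (Less (Read ''W'' (V ''l'')) (Minus (Read ''W'' (V ''x'')) (Const 1)))
           (Write ''W'' (V ''l'') (Minus (Read ''W'' (V ''x'')) (Const 1))) Skip)
         (''ok'' ::= Const 0)"
  define s3 where "s3 = effect ?B2 s2"
  let ?w = "\<lambda>l. s ''W'' (int l)" and ?w3 = "\<lambda>l. s3 ''W'' (int l)" and ?l = "lcm n ?t"
  have l: "int n * int ?t div int (gcd n ?t) = int ?l" by (simp add: lcm_nat_def zdiv_int)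
  have W3: "?w3 = (if 0 < ?w ?l then ?w(?l := max (?w ?l) (?w n - 1)) else ?w)"
    "s3 ''ok'' 0 = (if 0 < ?w ?l then s ''ok'' 0 else 0)"
    using same s2(3) l Mj by (auto simp: fun_eq_iff s3_def)
  have "reach join_step s (52 * k + 120) s3"
    unfolding join_step_def s3_def
    by (rule reach_CondT[OF _ reach_block_Seq[OF _ reach_Seq_block[OF s2(1) _ order_refl] order_refl]])
      (use True in \<open>simp_all add: j Z[OF j(1)]\<close>)
  moreover have "frame ?F s s3"
    using frame_trans[OF _ s2(2), of ?F s ?F] by (simp add: s3_def)
  moreover have "support_ok z (D \<union> {n} \<times> {t. t = ?t \<and> 0 < z t}) s3 \<and> (s3 ''ok'' 0 = 1 \<longrightarrow> 2 \<le> ?w3 n)"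
  proof (cases "s ''ok'' 0 = 1")
    case False
    then show ?thesis using ok W3 by (auto simp: support_ok_def)
  next
    case ok1: True
    then have w: "weights z D ?w" "2 \<le> ?w n" using ok by (auto simp: support_ok_def)
    have DD: "D \<union> {n} \<times> {t. t = ?t \<and> 0 < z t} = insert (n, ?t) D" using True by auto
    show ?thesis
    proof (cases "0 < ?w ?l")
      case l0: True
      have "weights z (insert (n, ?t) D) ?w3"
        unfolding W3 using weights_step[OF w(1,2) n(1) tl(1) True l0 D] l0 by simp
      moreover have "2 \<le> ?w3 n" using fun_cong[OF W3(1), of n] w(2) l0 by auto
      ultimately show ?thesis using DD W3(2) l0 ok1 by (simp only: support_ok_def if_True) simp
    next
      case False
      then have "\<forall>X. \<not> solution X" using weights_fail[OF w tl(1) True c] by blast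
      then show ?thesis using W3(2) False by (simp add: support_ok_def)
    qed
  qed
  ultimately show ?thesis by blast
qed

lemma support_phase:
  assumes k: "0 < k" and c: "consistent k (length nodes) z" and env: "env k s"
    and Z: "\<And>j. j < length nodes \<Longrightarrow> s ''Z'' (int j) = int (z (nodes ! j))"
    and ok: "support_ok z {} s"
  shows "\<exists>s'. reach support_phase s (length nodes * (length nodes * (52 * k + 132) + 60) + 9) s' \<and>
    frame {''r'', ''x'', ''j'', ''A'', ''B'', ''t'', ''l'', ''W'', ''ok''} s s' \<and>
    support_ok z (lengths \<times> {m \<in> lengths. 0 < z m}) s'"
proof -
  let ?T = "{m \<in> lengths. 0 < z m}" let ?R = "length nodes"
  let ?F = "{''x'', ''j'', ''A'', ''B'', ''t'', ''l'', ''W'', ''ok''}"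
  let ?I = "for_loop ''j'' ''R'' join_step"
  let ?C2 = "Cond (Less (Const 1) (Read ''W'' (V ''x''))) ?I Skip"
  let ?C = "Cond (Positive (V ''ok'')) (''x'' ::= Read ''M'' (V ''r'');; ?C2) Skip"
  let ?cI = "?R * (52 * k + 120 + 12) + 9"
  have "\<exists>s'. reach (for_loop ''r'' ''R'' ?C) s (?R * (?cI + 39 + 12) + 9) s' \<and>
    frame (insert ''r'' ?F) s s' \<and> support_ok z (set (take ?R nodes) \<times> ?T) s'"
  proof (rule reach_for)
    fix i t assume i: "i < ?R" "frame (insert ''r'' ?F) s t" "t ''r'' 0 = int i"
      and P: "support_ok z (set (take i nodes) \<times> ?T) t"
    let ?n = "nodes ! i"
    have take: "set (take (Suc i) nodes) = insert ?n (set (take i nodes))"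
      using i(1) by (simp add: take_Suc_conv_app_nth)
    have nl: "?n \<in> lengths" using i(1) nth_mem by fastforce
    show "\<exists>t'. reach ?C t (?cI + 39) t' \<and> frame ?F t t' \<and> support_ok z (set (take (Suc i) nodes) \<times> ?T) t'"
    proof (cases "t ''ok'' 0 = 1")
      case False
      then have t0: "t ''ok'' 0 = 0" "\<forall>X. \<not> solution X" using P by (auto simp: support_ok_def)
      then have "\<not> bval (Positive (V ''ok'')) t" by simp
      then have "reach ?C t (?cI + 39) t" by (rule reach_CondF[OF _ reach_Skip]) simp
      moreover have "support_ok z (set (take (Suc i) nodes) \<times> ?T) t" using t0 by (simp add: support_ok_def)
      ultimately show ?thesis using frame_refl by blast
    next
      case True
      then have w: "weights z (set (take i nodes) \<times> ?T) (\<lambda>l. t ''W'' (int l))" using P by (simp add: support_ok_def)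
      have envt: "env k t" using env_frame[OF env i(2)] by simp
      have Zt: "t ''Z'' (int j) = int (z (nodes ! j))" if "j < ?R" for j
        using Z[OF that] i(2) by (simp add: frame_def)
      let ?t1 = "effect (''x'' ::= Read ''M'' (V ''r'')) t"
      have x1: "?t1 ''x'' 0 = int ?n" using envt i by (simp add: env_def)
      have fr1: "frame ?F t ?t1" by simp
      have "\<exists>t'. reach ?C2 ?t1 (?cI + 20) t' \<and> frame ?F t t' \<and> support_ok z (set (take (Suc i) nodes) \<times> ?T) t'"
      proof (cases "2 \<le> t ''W'' (int ?n)")
        case False
        have "reach ?C2 ?t1 (?cI + 20) ?t1"
          by (rule reach_CondF[OF _ reach_Skip]) (use False envt i in \<open>simp_all add: env_def\<close>)
        moreover have "weights z (set (take i nodes) \<times> ?T \<union> {?n} \<times> ?T) (\<lambda>l. t ''W'' (int l))"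
          using weights_skip[OF w] False by simp
        then have "support_ok z (set (take (Suc i) nodes) \<times> ?T) ?t1"
          using True unfolding take support_ok_def by (auto elim: weights_mono)
        ultimately show ?thesis using fr1 by blast
      next
        case W2: True
        let ?G = "{''A'', ''B'', ''t'', ''l'', ''W'', ''ok''}"
        let ?D = "\<lambda>j. set (take i nodes) \<times> ?T \<union> {?n} \<times> {t \<in> set (take j nodes). 0 < z t}"
        \<comment> \<open>The guard \<open>2 \<le> W\<close> at the current node is carried along:
          as long as \<open>ok\<close> stays 1, weights never decrease.\<close>
        have "\<exists>t'. reach ?I ?t1 ?cI t' \<and> frame (insert ''j'' ?G) ?t1 t' \<and>
          (support_ok z (?D ?R) t' \<and> (t' ''ok'' 0 = 1 \<longrightarrow> 2 \<le> t' ''W'' (int ?n)))"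
        proof (rule reach_for)
          show "support_ok z (?D 0) ?t1 \<and> (?t1 ''ok'' 0 = 1 \<longrightarrow> 2 \<le> ?t1 ''W'' (int ?n))"
            using P W2 by (simp add: support_ok_def)
          fix j u assume j: "j < ?R" "frame (insert ''j'' ?G) ?t1 u" "u ''j'' 0 = int j"
            and Q: "support_ok z (?D j) u \<and> (u ''ok'' 0 = 1 \<longrightarrow> 2 \<le> u ''W'' (int ?n))"
          have fru: "frame ?F t u" using frame_trans[OF fr1 j(2), of ?F] by simp
          have envu: "env k u" using env_frame[OF envt fru] by simp
          have Zu: "u ''Z'' (int j) = int (z (nodes ! j))" if "j < ?R" for j
            using Zt[OF that] fru by (simp add: frame_def)
          have xu: "u ''x'' 0 = int ?n" using j(2) x1 by (simp add: frame_def)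
          have D: "n' \<le> ?n" if nt: "(n', t') \<in> ?D j" for n' t'
          proof (cases "n' = ?n")
            case False
            then obtain i' where "i' < i" "n' = nodes ! i'" using nt i(1) by (auto simp: in_set_conv_nth)
            then show ?thesis using sorted_nodes i(1) by (simp add: sorted_nth_mono)
          qed simp
          have Suc: "?D (Suc j) = ?D j \<union> {?n} \<times> {t. t = nodes ! j \<and> 0 < z t}"
            using j(1) by (auto simp: take_Suc_conv_app_nth)
          have "\<exists>u'. reach join_step u (52 * k + 120) u' \<and> frame ?G u u' \<and>
            support_ok z (?D j \<union> {?n} \<times> {t. t = nodes ! j \<and> 0 < z t}) u' \<and> (u' ''ok'' 0 = 1 \<longrightarrow> 2 \<le> u' ''W'' (int ?n))"
            by (rule join_step[OF c envu Zu j(1,3) nl xu D]) (use Q in blast)+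
          then show "\<exists>u'. reach join_step u (52 * k + 120) u' \<and> frame ?G u u' \<and>
            (support_ok z (?D (Suc j)) u' \<and> (u' ''ok'' 0 = 1 \<longrightarrow> 2 \<le> u' ''W'' (int ?n)))"
            unfolding Suc .
        qed (use envt in \<open>simp_all add: env_def support_ok_def\<close>)
        then obtain t' where t': "reach ?I ?t1 ?cI t'" "frame (insert ''j'' ?G) ?t1 t'" "support_ok z (?D ?R) t'" by blast
        have "reach ?C2 ?t1 (?cI + 20) t'"
          by (rule reach_CondT[OF _ t'(1)]) (use W2 envt i in \<open>simp_all add: env_def\<close>)
        moreover have "frame ?F t t'" using frame_trans[OF fr1 t'(2), of ?F] by simp
        moreover have "?D ?R = set (take (Suc i) nodes) \<times> ?T" unfolding take by auto
        ultimately show ?thesis using t'(3) by auto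
      qed
      then obtain t' where t': "reach ?C2 ?t1 (?cI + 20) t'" "frame ?F t t'" "support_ok z (set (take (Suc i) nodes) \<times> ?T) t'"
        by blast
      have "reach ?C t (?cI + 39) t'"
        by (rule reach_CondT[OF _ reach_block_Seq[OF _ t'(1) order_refl]]) (use True in simp_all)
      then show ?thesis using t' by blast
    qed
  qed (use env ok in \<open>simp_all add: env_def support_ok_def\<close>)
  then obtain s' where s': "reach support_phase s (?R * (?cI + 39 + 12) + 9) s'" "frame (insert ''r'' ?F) s s'"
    "support_ok z (lengths \<times> ?T) s'" unfolding support_phase_def by auto
  then show ?thesis by (intro exI[of _ s']) (simp add: algebra_simps)
qed

lemma solution_code_solves:
  assumes c: "consistent k (length nodes) z" and w: "weights z (lengths \<times> {m \<in> lengths. 0 < z m}) w"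
  shows "solution (decode (solution_code (length nodes) z))"
    and "\<And>n l. (n, l) \<in> set (solution_code (length nodes) z) \<Longrightarrow> 0 < n \<and> 0 < l"
proof -
  let ?T = "{m \<in> lengths. 0 < z m}"
  let ?f = "\<lambda>m. of_nat (z m div absorbed g (m div g)) * cycle (absorbed g (m div g) * (m div g))"
  have T: "g dvd m \<and> absorbed g (m div g) dvd z m" if "m \<in> ?T" for m
    using c that unfolding consistent_def by auto
  have "decode (solution_code (length nodes) z) = (\<Sum>m\<leftarrow>filter (\<lambda>m. 0 < z m) nodes. ?f m)"
    by (simp add: decode_def solution_code_def comp_def)
  also have "\<dots> = (\<Sum>m\<in>?T. ?f m)"
    using distinct_nodes by (subst sum_list_distinct_conv_sum_set) simp_all
  finally have eq: "decode (solution_code (length nodes) z) = (\<Sum>m\<in>?T. ?f m)" .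
  show "solution (decode (solution_code (length nodes) z))"
    unfolding eq
  proof (rule solution_exists)
    show "\<exists>y. value_at qs m y = rhs_at bs m \<and> g * y = (\<Sum>l\<in>{l\<in>lengths. l dvd m}. l * z l)" if "m \<in> lengths" for m
      using c that unfolding consistent_def by simp
  qed (use T weights_closed[OF w] in blast)+
  fix n l assume "(n, l) \<in> set (solution_code (length nodes) z)"
  then obtain m where m: "m \<in> ?T" "n = z m div absorbed g (m div g)" "l = absorbed g (m div g) * (m div g)"
    by (auto simp: solution_code_def)
  have d: "0 < absorbed g (m div g)" using absorbed_pos[OF g_pos] .
  have "0 < m" using m lengths_pos by auto
  then have "0 < m div g" using T[OF m(1)] g_pos by (auto simp: div_greater_zero_iff dvd_imp_le)
  moreover have "absorbed g (m div g) \<le> z m" using T[OF m(1)] m(1) by (auto intro: dvd_imp_le)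
  ultimately show "0 < n \<and> 0 < l" using m d by (simp add: div_greater_zero_iff)
qed

end

section \<open>Reading the input\<close>

definition append_entry :: com where
  "append_entry = (Write ''E'' (V ''n'') (V ''f'');;
     Write ''L'' (V ''n'') (Read ''input'' (Plus (V ''i'') (Const 1)));;
     Write ''U'' (V ''n'') (Times (V ''s'') (Read ''input'' (V ''i'')));;
     Cond (Less (Read ''W'' (Read ''L'' (V ''n''))) (Plus (V ''f'') (Const 1)))
       (Write ''W'' (Read ''L'' (V ''n'')) (Plus (V ''f'') (Const 1))) Skip;;
     Cond (Positive (V ''s'')) Skip
       (''G'' ::= Plus (V ''G'') (Times (Read ''input'' (V ''i'')) (Read ''input'' (Plus (V ''i'') (Const 1)))));;
     Cond (Positive (V ''f''))
       (Cond (Conj (Positive (V ''g'')) (Neg (Less (Read ''L'' (V ''n'')) (V ''g'')))) Skip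
         (''g'' ::= Read ''L'' (V ''n''))) Skip;;
     ''n'' ::= Plus (V ''n'') (Const 1);; ''i'' ::= Plus (V ''i'') (Const 2);;
     ''d'' ::= Minus (V ''d'') (Const 1))"

text \<open>Besides the entries, one pass gathers the number of points of \<open>B\<close>, the
  initial weights and the seed, which is not part of the input; \<open>g = 0\<close> says that no
  nonconstant term has been seen.\<close>

definition recorded :: "entry list \<Rightarrow> memory \<Rightarrow> bool" where
  "recorded es s \<longleftrightarrow> stores es s \<and> (\<forall>l. 0 \<le> s ''W'' (int l)) \<and>
     (\<forall>(e, u, l)\<in>set es. int e + 1 \<le> s ''W'' (int l)) \<and>
     (\<forall>l. 0 < s ''W'' (int l) \<longrightarrow> (\<exists>e u. (e, u, l) \<in> set es \<and> s ''W'' (int l) = int e + 1)) \<and>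
     s ''G'' 0 = (\<Sum>(e, u, l)\<leftarrow>es. if u < 0 then - u * int l else 0) \<and>
     (s ''g'' 0 = 0 \<and> (\<forall>(e, u, l)\<in>set es. e = 0) \<or>
      (\<exists>m. s ''g'' 0 = int m \<and> 0 < m \<and> (\<exists>e u. (e, u, m) \<in> set es \<and> 0 < e) \<and>
        (\<forall>(e, u, l)\<in>set es. 0 < e \<longrightarrow> m \<le> l)))"

lemma recorded_frame:
  assumes "recorded es s" "frame F s s'" "{''n'', ''E'', ''U'', ''L'', ''W'', ''G'', ''g''} \<inter> F = {}"
  shows "recorded es s'"
proof -
  have "stores es s'" using stores_frame[of es s F s'] assms unfolding recorded_def by blast
  moreover have "s' ''W'' = s ''W''" "s' ''G'' = s ''G''" "s' ''g'' = s ''g''"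
    using assms(2,3) by (auto simp: frame_def)
  ultimately show ?thesis using assms(1) unfolding recorded_def by simp
qed

lemma append_entry:
  assumes r: "recorded es s" and v: "s ''f'' 0 = int e" "s ''s'' 0 = c" "s ''i'' 0 = int p"
    and c: "c = 1 \<or> c = - 1"
    and inp: "s ''input'' (int p) = int n" "s ''input'' (int p + 1) = int l" and pos: "0 < n" "0 < l"
  defines "s' \<equiv> effect append_entry s"
  shows "recorded (es @ [(e, c * int n, l)]) s'" "s' ''i'' 0 = int (p + 2)" "s' ''d'' 0 = s ''d'' 0 - 1"
    "frame {''E'', ''L'', ''U'', ''W'', ''G'', ''g'', ''n'', ''i'', ''d''} s s'"
proof -
  let ?N = "length es" let ?es = "es @ [(e, c * int n, l)]"
  have N: "s ''n'' 0 = int ?N" using r by (simp add: recorded_def stores_def)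
  have s': "s' ''E'' = (s ''E'')(int ?N := int e)" "s' ''L'' = (s ''L'')(int ?N := int l)"
    "s' ''U'' = (s ''U'')(int ?N := c * int n)"
    "s' ''W'' = (if s ''W'' (int l) < int e + 1 then (s ''W'')(int l := int e + 1) else s ''W'')"
    "s' ''G'' 0 = s ''G'' 0 + (if 0 < c then 0 else int n * int l)"
    "s' ''g'' 0 = (if 0 < e \<and> \<not> (0 < s ''g'' 0 \<and> s ''g'' 0 \<le> int l) then int l else s ''g'' 0)"
    "s' ''n'' 0 = int ?N + 1"
    using v N inp unfolding s'_def append_entry_def by (simp_all add: not_less)
  show "s' ''i'' 0 = int (p + 2)" "s' ''d'' 0 = s ''d'' 0 - 1"
    "frame {''E'', ''L'', ''U'', ''W'', ''G'', ''g'', ''n'', ''i'', ''d''} s s'"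
    using v unfolding s'_def append_entry_def by simp_all
  have st: "stores ?es s'"
    using r s' unfolding recorded_def stores_def
    by (auto simp: nth_append less_Suc_eq split: prod.splits)
  have W: "s' ''W'' (int l') = (if l' = l then max (s ''W'' (int l)) (int e + 1) else s ''W'' (int l'))" for l'
    unfolding s'(4) by auto
  have W1: "0 \<le> s' ''W'' (int l')" for l'
    using r unfolding W recorded_def by auto
  have W2: "int e' + 1 \<le> s' ''W'' (int l')" if "(e', u', l') \<in> set ?es" for e' u' l'
  proof (cases "(e', u', l') \<in> set es")
    case True
    then have "int e' + 1 \<le> s ''W'' (int l')" using r unfolding recorded_def by blast
    then show ?thesis unfolding W by (cases "l' = l") simp_all
  next
    case False
    then show ?thesis using that unfolding W by simp
  qed
  have W3: "\<exists>e u. (e, u, l') \<in> set ?es \<and> s' ''W'' (int l') = int e + 1" if "0 < s' ''W'' (int l')" for l'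
  proof (cases "s' ''W'' (int l') = s ''W'' (int l')")
    case True
    have "\<exists>e u. (e, u, l') \<in> set es \<and> s ''W'' (int l') = int e + 1"
      using r that unfolding True recorded_def by blast
    then show ?thesis unfolding True set_append by blast
  next
    case False
    then have "l' = l" "s' ''W'' (int l') = int e + 1" unfolding W by (simp_all add: max_def split: if_splits)
    then show ?thesis by fastforce
  qed
  have G: "s' ''G'' 0 = (\<Sum>(e, u, l)\<leftarrow>?es. if u < 0 then - u * int l else 0)"
    using r c pos unfolding s'(5) recorded_def by auto
  have g: "s ''g'' 0 = 0 \<and> (\<forall>(e, u, l)\<in>set es. e = 0) \<or>
      (\<exists>m. s ''g'' 0 = int m \<and> 0 < m \<and> (\<exists>e u. (e, u, m) \<in> set es \<and> 0 < e) \<and>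
        (\<forall>(e, u, l)\<in>set es. 0 < e \<longrightarrow> m \<le> l))" using r unfolding recorded_def by blast
  have g': "s' ''g'' 0 = 0 \<and> (\<forall>(e, u, l)\<in>set ?es. e = 0) \<or>
      (\<exists>m. s' ''g'' 0 = int m \<and> 0 < m \<and> (\<exists>e u. (e, u, m) \<in> set ?es \<and> 0 < e) \<and>
        (\<forall>(e, u, l)\<in>set ?es. 0 < e \<longrightarrow> m \<le> l))"
  proof (cases "0 < e \<and> \<not> (0 < s ''g'' 0 \<and> s ''g'' 0 \<le> int l)")
    case True
    then have "s' ''g'' 0 = int l" using s'(6) by simp
    moreover have "\<forall>(e, u, l')\<in>set ?es. 0 < e \<longrightarrow> l \<le> l'" using g True by force
    moreover have "\<exists>e u. (e, u, l) \<in> set ?es \<and> 0 < e" using True by auto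
    ultimately show ?thesis using pos(2) by blast
  next
    case False
    then have eq: "s' ''g'' 0 = s ''g'' 0" unfolding s'(6) by (rule if_not_P)
    from g show ?thesis
    proof (elim disjE exE conjE)
      assume *: "s ''g'' 0 = 0" "\<forall>(e, u, l)\<in>set es. e = 0"
      then have "e = 0" using False by simp
      then have "\<forall>(e, u, l)\<in>set ?es. e = 0" using *(2) by simp
      then show ?thesis using eq * by simp
    next
      fix m e' u' assume *: "s ''g'' 0 = int m" "0 < m" "(e', u', m) \<in> set es" "0 < e'"
        "\<forall>(e, u, l)\<in>set es. 0 < e \<longrightarrow> m \<le> l"
      then have "0 < e \<longrightarrow> m \<le> l" using False by auto
      then have "\<forall>(e, u, l)\<in>set ?es. 0 < e \<longrightarrow> m \<le> l" using *(5) by simp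
      moreover have "(e', u', m) \<in> set ?es" using *(3) by simp
      ultimately show ?thesis using eq *(1,2,4) by auto
    qed
  qed
  show "recorded ?es s'" unfolding recorded_def using st W1 W2 W3 G g' by blast
qed

section \<open>Parsing the nested input\<close>

definition pair_words :: "perm_code \<Rightarrow> int list" where
  "pair_words as = concat (map (\<lambda>(n, l). [int n, int l]) as)"

text \<open>In the parser state, \<open>None\<close> means that the header of the right-hand side has been read.\<close>

definition pending_words :: "perm_code \<Rightarrow> poly_code option \<Rightarrow> int list" where
  "pending_words bs r = (case r of None \<Rightarrow> []
     | Some ps \<Rightarrow> concat (map (\<lambda>(i, as). int i # perm_words as) ps) @ perm_words bs)"

definition poly_entries :: "poly_code \<Rightarrow> entry list" where
  "poly_entries ps = concat (map (\<lambda>(i, as). map (\<lambda>(n, l). (i, int n, l)) as) ps)"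

definition rhs_entries :: "perm_code \<Rightarrow> entry list" where
  "rhs_entries bs = map (\<lambda>(n, l). (0, - int n, l)) bs"

definition pending_entries :: "perm_code \<Rightarrow> poly_code option \<Rightarrow> entry list" where
  "pending_entries bs r = (case r of None \<Rightarrow> [] | Some ps \<Rightarrow> poly_entries ps @ rhs_entries bs)"

text \<open>Counts one iteration for each header and each pair still unread.\<close>

definition pending_size :: "perm_code \<Rightarrow> poly_code option \<Rightarrow> nat" where
  "pending_size bs r = (case r of None \<Rightarrow> 0 | Some ps \<Rightarrow> 1 + (\<Sum>(i, as)\<leftarrow>ps. 1 + length as) + length bs)"

definition pending_headers :: "poly_code option \<Rightarrow> int" where
  "pending_headers r = (case r of None \<Rightarrow> 0 | Some ps \<Rightarrow> int (length ps) + 1)"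

definition next_header :: com where
  "next_header = (''c'' ::= Minus (V ''c'') (Const 1);;
     Cond (Positive (V ''c''))
       (''f'' ::= Read ''input'' (V ''i'');; ''d'' ::= Read ''input'' (Plus (V ''i'') (Const 1));;
        ''s'' ::= Const 1;; ''i'' ::= Plus (V ''i'') (Const 2))
       (''f'' ::= Const 0;; ''d'' ::= Read ''input'' (V ''i'');;
        ''s'' ::= Const (- 1);; ''i'' ::= Plus (V ''i'') (Const 1)))"

text \<open>One flat loop for nested arrays: \<open>d\<close> counts the pairs left in the current
  array, \<open>c\<close> the headers left. The last header is that of \<open>B\<close>; it sets
  exponent 0 and sign \<open>- 1\<close>.\<close>

definition parse :: com where
  "parse = ((''i'' ::= Const 1;; ''c'' ::= Plus (Read ''input'' (Const 0)) (Const 1));;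
     While (Positive (Plus (V ''c'') (V ''d''))) (Cond (Positive (V ''d'')) append_entry next_header))"

lemma drop_eq_Cons: "drop p ws = x # xs \<Longrightarrow> p < length ws \<and> ws ! p = x \<and> drop (Suc p) ws = xs"
  by (metis Cons_nth_drop_Suc drop_all list.distinct(1) list.inject not_le_imp_less)

lemma parse:
  fixes ps :: poly_code and bs :: perm_code
  defines "es \<equiv> poly_entries ps @ rhs_entries bs"
  assumes pos: "\<And>e u l. (e, u, l) \<in> set es \<Longrightarrow> u \<noteq> 0 \<and> 0 < l"
  shows "\<exists>s'. reach parse (initial ps bs) (pending_size bs (Some ps) * 170 + 30) s' \<and>
    frame {''E'', ''L'', ''U'', ''W'', ''G'', ''g'', ''n'', ''i'', ''d'', ''c'', ''f'', ''s''} (initial ps bs) s' \<and>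
    recorded es s'"
proof -
  let ?F = "{''E'', ''L'', ''U'', ''W'', ''G'', ''g'', ''n'', ''i'', ''d'', ''c'', ''f'', ''s''}"
  let ?s0 = "initial ps bs"
  define ws where "ws = poly_words ps @ perm_words bs"
  have input: "s ''input'' (int k) = ws ! k" if "frame ?F ?s0 s" "k < length ws" for s k
    using that by (simp add: frame_def initial_def ws_def Let_def)
  let ?b = "Positive (Plus (V ''c'') (V ''d''))"
  let ?C = "Cond (Positive (V ''d'')) append_entry next_header"
  let ?s1 = "effect (''i'' ::= Const 1;; ''c'' ::= Plus (Read ''input'' (Const 0)) (Const 1)) ?s0"
  \<comment> \<open>\<open>seen\<close> is stored, \<open>cur\<close> is the unread rest of the
    current array, \<open>r\<close> what lies beyond it. The exponent \<open>x\<close> and the sign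
    \<open>c\<close> matter only while \<open>cur\<close> is nonempty, so their initial values are
    arbitrary.\<close>
  define J where "J = (\<lambda>k s seen cur r x c p. k = length cur + pending_size bs r \<and>
    (cur \<noteq> [] \<longrightarrow> (c = 1 \<or> c = - 1) \<and> s ''f'' 0 = int x \<and> s ''s'' 0 = c) \<and>
    frame ?F ?s0 s \<and> recorded seen s \<and> s ''d'' 0 = int (length cur) \<and>
    s ''c'' 0 = pending_headers r \<and> s ''i'' 0 = int p \<and> drop p ws = pair_words cur @ pending_words bs r \<and>
    seen @ map (\<lambda>(n, l). (x, c * int n, l)) cur @ pending_entries bs r = es)"
  let ?I = "\<lambda>k s. \<exists>seen cur r x c p. J k s seen cur r x c p"
  have "\<exists>s' k'. reach (While ?b ?C) ?s1 (pending_size bs (Some ps) * (159 + 1 + bcost ?b) + 1 + bcost ?b) s' \<and>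
    ?I k' s' \<and> \<not> bval ?b s'"
  proof (rule reach_While)
    have "?s1 ''c'' 0 = int (length ps) + 1" "drop 1 ws = pending_words bs (Some ps)"
      by (simp_all add: initial_def poly_words_def ws_def pending_words_def)
    moreover have "recorded [] ?s1" by (simp add: recorded_def stores_def initial_def Let_def)
    moreover have "?s1 ''d'' 0 = 0" "?s1 ''i'' 0 = 1" by (simp_all add: initial_def Let_def)
    moreover have "frame ?F ?s0 ?s1" by simp
    ultimately have "J (pending_size bs (Some ps)) ?s1 [] [] (Some ps) 0 1 1"
      unfolding J_def by (simp del: effect.simps add: pending_headers_def pair_words_def pending_entries_def es_def)
    then show "?I (pending_size bs (Some ps)) ?s1" by blast
  next
    fix k s assume "?I k s" and b: "bval ?b s"
    then obtain seen cur r x c p where J: "J k s seen cur r x c p" by blast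
    have fr: "frame ?F ?s0 s" and rec: "recorded seen s" and d: "s ''d'' 0 = int (length cur)"
      and hd: "s ''c'' 0 = pending_headers r" and i: "s ''i'' 0 = int p"
      and drop: "drop p ws = pair_words cur @ pending_words bs r"
      and all: "seen @ map (\<lambda>(n, l). (x, c * int n, l)) cur @ pending_entries bs r = es"
      and k: "k = length cur + pending_size bs r"
      using J unfolding J_def by blast+
    show "\<exists>s' k'. k' < k \<and> reach ?C s 159 s' \<and> ?I k' s'"
    proof (cases cur)
      case (Cons y cur')
      obtain n l where y: "y = (n, l)" by (cases y)
      have c: "c = 1 \<or> c = - 1" "s ''f'' 0 = int x" "s ''s'' 0 = c" using J Cons unfolding J_def by auto
      have dr: "drop p ws = int n # int l # pair_words cur' @ pending_words bs r"
        using drop Cons y by (simp add: pair_words_def)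
      note d1 = drop_eq_Cons[OF dr]
      note d2 = drop_eq_Cons[OF conjunct2[OF conjunct2[OF d1]]]
      have inp: "s ''input'' (int p) = int n" "s ''input'' (int p + 1) = int l"
        using input[OF fr, of p] input[OF fr, of "Suc p"] d1 d2 by (simp_all add: add.commute)
      have "(x, c * int n, l) \<in> set es" unfolding all[symmetric] by (simp add: Cons y)
      from pos[OF this] have nl: "0 < n" "0 < l" by auto
      let ?s' = "effect append_entry s"
      note ae = append_entry[OF rec c(2,3) i c(1) inp nl]
      have "J (k - 1) ?s' (seen @ [(x, c * int n, l)]) cur' r x c (p + 2)"
        unfolding J_def
      proof (intro conjI impI)
        show "k - 1 = length cur' + pending_size bs r" using k Cons by simp
        show "c = 1 \<or> c = - 1" by (rule c(1))
        show "?s' ''f'' 0 = int x" "?s' ''s'' 0 = c" "?s' ''c'' 0 = pending_headers r"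
          using ae(4) c hd by (simp_all add: frame_def)
        show "frame ?F ?s0 ?s'" using frame_trans[OF fr ae(4), of ?F] by simp
        show "?s' ''d'' 0 = int (length cur')" using ae(3) d Cons by simp
        show "drop (p + 2) ws = pair_words cur' @ pending_words bs r" using d2 by simp
        show "(seen @ [(x, c * int n, l)]) @ map (\<lambda>(n, l). (x, c * int n, l)) cur' @ pending_entries bs r = es"
          using all Cons y by simp
      qed (rule ae(1,2))+
      moreover have "reach ?C s 159 ?s'"
        by (rule reach_CondT[OF _ reach_loop_free]) (use d Cons in \<open>simp_all add: append_entry_def\<close>)
      moreover have "k - 1 < k" using k Cons by simp
      ultimately show ?thesis by blast
    next
      case Nil
      let ?s' = "effect next_header s"
      have "reach ?C s 159 ?s'"
        by (rule reach_CondF[OF _ reach_loop_free]) (use d Nil in \<open>simp_all add: next_header_def\<close>)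
      moreover have rec': "recorded seen ?s'"
        by (rule recorded_frame[OF rec, of "{''c'', ''f'', ''d'', ''s'', ''i''}"]) (simp_all add: next_header_def)
      moreover have fr': "frame ?F ?s0 ?s'" using fr by (simp add: next_header_def)
      moreover obtain qs where r: "r = Some qs"
        using b d hd Nil by (cases r) (simp_all add: pending_headers_def)
      have "\<exists>k' cur r x c p. k' < k \<and> J k' ?s' seen cur r x c p"
      proof (cases qs)
        case Nil': Nil
        have dr: "drop p ws = int (length bs) # pair_words bs"
          using drop Nil Nil' r by (simp add: pair_words_def pending_words_def perm_words_def)
        note d1 = drop_eq_Cons[OF dr]
        have inp: "s ''input'' (int p) = int (length bs)" using input[OF fr, of p] d1 by simp
        have "?s' ''c'' 0 = 0" "?s' ''f'' 0 = 0" "?s' ''d'' 0 = int (length bs)" "?s' ''s'' 0 = - 1" "?s' ''i'' 0 = int (p + 1)"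
          using hd i inp r Nil' by (simp_all add: next_header_def pending_headers_def)
        then have "J (length bs) ?s' seen bs None 0 (- 1) (p + 1)"
          unfolding J_def using rec' fr' d1 all Nil Nil' r
          by (simp del: effect.simps add: pending_size_def pending_headers_def pending_words_def pending_entries_def
            poly_entries_def rhs_entries_def)
        moreover have "length bs < k" using k Nil Nil' r by (simp add: pending_size_def)
        ultimately show ?thesis by blast
      next
        case (Cons y qs')
        obtain e as where y: "y = (e, as)" by (cases y)
        have dr: "drop p ws = int e # int (length as) # pair_words as @ pending_words bs (Some qs')"
          using drop Nil Cons y r by (simp add: pair_words_def pending_words_def perm_words_def)
        note d1 = drop_eq_Cons[OF dr]
        note d2 = drop_eq_Cons[OF conjunct2[OF conjunct2[OF d1]]]
        have inp: "s ''input'' (int p) = int e" "s ''input'' (int p + 1) = int (length as)"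
          using input[OF fr, of p] input[OF fr, of "Suc p"] d1 d2 by (simp_all add: add.commute)
        have "?s' ''c'' 0 = int (length qs') + 1" "?s' ''f'' 0 = int e" "?s' ''d'' 0 = int (length as)" "?s' ''s'' 0 = 1"
          "?s' ''i'' 0 = int (p + 2)"
          using hd i inp r Cons by (simp_all add: next_header_def pending_headers_def)
        then have "J (length as + pending_size bs (Some qs')) ?s' seen as (Some qs') e 1 (p + 2)"
          unfolding J_def using rec' fr' d2 all Nil Cons y r
          by (simp del: effect.simps add: pending_headers_def pending_entries_def poly_entries_def)
        moreover have "length as + pending_size bs (Some qs') < k" using k Nil Cons y r by (simp add: pending_size_def)
        ultimately show ?thesis by blast
      qed
      ultimately show ?thesis by blast
    qed
  qed
  then obtain s' k' seen cur r x c p where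
    s': "reach (While ?b ?C) ?s1 (pending_size bs (Some ps) * (159 + 1 + bcost ?b) + 1 + bcost ?b) s'"
    and J: "J k' s' seen cur r x c p" and b: "\<not> bval ?b s'" by blast
  have fr: "frame ?F ?s0 s'" and rec: "recorded seen s'" and d: "s' ''d'' 0 = int (length cur)"
    and hd: "s' ''c'' 0 = pending_headers r"
    and all: "seen @ map (\<lambda>(n, l). (x, c * int n, l)) cur @ pending_entries bs r = es"
    using J unfolding J_def by blast+
  have "cur = []" "r = None" using b d hd by (cases r; simp add: pending_headers_def)+
  then have "seen = es" using all by (simp add: pending_entries_def)
  moreover have "reach parse ?s0 (pending_size bs (Some ps) * 170 + 30) s'"
    unfolding parse_def by (rule reach_block_Seq[OF _ s']) simp_all
  ultimately show ?thesis using fr rec by blast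
qed

section \<open>Collecting the lengths and capping the exponents\<close>

definition find_next :: com where
  "find_next = (''l'' ::= Const 0;; for_loop ''j'' ''n''
     (Cond (Conj (Less (V ''x'') (Read ''L'' (V ''j'')))
              (Neg (Conj (Positive (V ''l'')) (Neg (Less (Read ''L'' (V ''j'')) (V ''l''))))))
        (''l'' ::= Read ''L'' (V ''j'')) Skip))"

text \<open>The value 0 for "none left" is unambiguous since lengths are positive.\<close>

definition next_length :: "nat set \<Rightarrow> nat \<Rightarrow> int \<Rightarrow> bool" where
  "next_length S c v \<longleftrightarrow> v = 0 \<and> (\<forall>m\<in>S. m \<le> c) \<or>
     (\<exists>m\<in>S. v = int m \<and> c < m \<and> (\<forall>m'\<in>S. c < m' \<longrightarrow> m \<le> m'))"

lemma next_length_insert: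
  assumes "next_length S c v" "0 < a"
  shows "next_length (insert a S) c (if int c < int a \<and> \<not> (0 < v \<and> v \<le> int a) then int a else v)"
  using assms(1) unfolding next_length_def
proof (elim disjE bexE conjE)
  assume *: "v = 0" "\<forall>m\<in>S. m \<le> c"
  show "(if int c < int a \<and> \<not> (0 < v \<and> v \<le> int a) then int a else v) = 0 \<and> (\<forall>m\<in>insert a S. m \<le> c) \<or>
    (\<exists>m\<in>insert a S. (if int c < int a \<and> \<not> (0 < v \<and> v \<le> int a) then int a else v) = int m \<and> c < m \<and>
      (\<forall>m'\<in>insert a S. c < m' \<longrightarrow> m \<le> m'))"
    using * by (cases "c < a") auto
next
  fix m assume *: "m \<in> S" "v = int m" "c < m" "\<forall>m'\<in>S. c < m' \<longrightarrow> m \<le> m'"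
  have "\<exists>m\<in>insert a S. (if int c < int a \<and> \<not> (0 < v \<and> v \<le> int a) then int a else v) = int m \<and> c < m \<and>
      (\<forall>m'\<in>insert a S. c < m' \<longrightarrow> m \<le> m')"
  proof (cases "c < a \<and> a < m")
    case True
    then show ?thesis using * by (intro bexI[of _ a]) auto
  next
    case False
    then show ?thesis using * by (intro bexI[of _ m]) auto
  qed
  then show "(if int c < int a \<and> \<not> (0 < v \<and> v \<le> int a) then int a else v) = 0 \<and> (\<forall>m\<in>insert a S. m \<le> c) \<or>
    (\<exists>m\<in>insert a S. (if int c < int a \<and> \<not> (0 < v \<and> v \<le> int a) then int a else v) = int m \<and> c < m \<and>
      (\<forall>m'\<in>insert a S. c < m' \<longrightarrow> m \<le> m'))" ..
qed

lemma find_next: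
  assumes st: "stores es s" and x: "s ''x'' 0 = int c" and pos: "\<And>e u l. (e, u, l) \<in> set es \<Longrightarrow> 0 < l"
  shows "\<exists>s'. reach find_next s (length es * 60 + 30) s' \<and> frame {''l'', ''j''} s s' \<and>
    next_length ((\<lambda>(e, u, l). l) ` set es) c (s' ''l'' 0)"
proof -
  let ?L = "\<lambda>i. (\<lambda>(e, u, l). l) ` set (take i es)"
  let ?s1 = "effect (''l'' ::= Const 0) s"
  let ?C = "Cond (Conj (Less (V ''x'') (Read ''L'' (V ''j'')))
              (Neg (Conj (Positive (V ''l'')) (Neg (Less (Read ''L'' (V ''j'')) (V ''l''))))))
        (''l'' ::= Read ''L'' (V ''j'')) Skip"
  have "\<exists>s'. reach (for_loop ''j'' ''n'' ?C) ?s1 (length es * (40 + 12) + 9) s' \<and> frame {''j'', ''l''} ?s1 s' \<and>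
    next_length (?L (length es)) c (s' ''l'' 0)"
  proof (rule reach_for)
    show "?s1 ''n'' 0 = int (length es)" using st by (simp add: stores_def)
    show "next_length (?L 0) c (?s1 ''l'' 0)" by (simp add: next_length_def)
    fix i t assume i: "i < length es" and t: "frame {''j'', ''l''} ?s1 t" "t ''j'' 0 = int i"
      "next_length (?L i) c (t ''l'' 0)"
    obtain e u l where el: "es ! i = (e, u, l)" by (cases "es ! i")
    have l: "0 < l" using pos[of e u l] nth_mem[OF i] el by simp
    have "s ''L'' (int i) = int l" using st i el by (auto simp: stores_def)
    then have v: "t ''L'' (int i) = int l" "t ''x'' 0 = int c" using t(1) x by (simp_all add: frame_def)
    have "effect ?C t ''l'' 0 = (if int c < int l \<and> \<not> (0 < t ''l'' 0 \<and> t ''l'' 0 \<le> int l) then int l else t ''l'' 0)"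
      using v t(2) by (simp add: not_less)
    moreover have "?L (Suc i) = insert l (?L i)" using i el by (simp add: take_Suc_conv_app_nth)
    ultimately have "next_length (?L (Suc i)) c (effect ?C t ''l'' 0)"
      using next_length_insert[OF t(3) l] by (simp only:)
    moreover have "frame {''l''} t (effect ?C t)" by simp
    moreover have "reach ?C t 40 (effect ?C t)" by (rule reach_mono[OF reach_loop_free]) simp_all
    ultimately show "\<exists>t'. reach ?C t 40 t' \<and> frame {''l''} t t' \<and> next_length (?L (Suc i)) c (t' ''l'' 0)"
      by blast
  qed simp_all
  then obtain s' where s': "reach (for_loop ''j'' ''n'' ?C) ?s1 (length es * (40 + 12) + 9) s'" "frame {''j'', ''l''} ?s1 s'"
    "next_length ((\<lambda>(e, u, l). l) ` set es) c (s' ''l'' 0)" by auto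
  have "reach find_next s (length es * 60 + 30) s'"
    unfolding find_next_def by (rule reach_block_Seq[OF _ s'(1)]) simp_all
  moreover have "frame {''l'', ''j''} s s'" using s'(2) by (auto simp: frame_def)
  ultimately show ?thesis using s'(3) by blast
qed

definition sort_update :: com where
  "sort_update = Cond (Positive (V ''l''))
     (Write ''M'' (V ''R'') (V ''l'');; ''R'' ::= Plus (V ''R'') (Const 1);; ''x'' ::= V ''l'')
     (''go'' ::= Const 0)"

text \<open>Selecting the next strictly larger length sorts and removes duplicates at once; its
  quadratic cost fits into the bound.\<close>

definition sort_phase :: com where
  "sort_phase = (''go'' ::= Const 1;; While (Positive (V ''go'')) (find_next;; sort_update))"

definition cap_phase :: com where
  "cap_phase = ((''k'' ::= Const 1;; ''p'' ::= Const 2);;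
     While (Neg (Less (V ''G'') (V ''p'')))
       (''p'' ::= Times (Const 2) (V ''p'');; ''k'' ::= Plus (V ''k'') (Const 1)))"

definition solver :: com where
  "solver = (parse;; sort_phase;; cap_phase;; ''ok'' ::= Const 1;; node_phase;;
     Cond (Positive (V ''ok'')) support_phase Skip;;
     Cond (Positive (V ''ok''))
       (Write ''output'' (Const 0) (Const 1);; Write ''output'' (Const 1) (V ''X''))
       (Write ''output'' (Const 0) (Const 0)))"

lemma length_pair_words: "length (pair_words xs) = 2 * length xs"
  by (induction xs) (auto simp: pair_words_def)

lemma nth_pair_words:
  "t < length xs \<Longrightarrow> pair_words xs ! (2 * t) = int (fst (xs ! t)) \<and> pair_words xs ! (2 * t + 1) = int (snd (xs ! t))"
proof (induction xs arbitrary: t)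
  case (Cons x xs)
  obtain n l where x: "x = (n, l)" by (cases x)
  show ?case
  proof (cases t)
    case (Suc t')
    then show ?thesis using Cons.IH[of t'] Cons.prems x by (simp add: pair_words_def)
  qed (simp add: pair_words_def x)
qed simp

lemma outputs_starts_with:
  assumes "outputs xs s" "s ''output'' 0 = 1" "s ''output'' 1 = int (length xs)"
  shows "output_starts_with s (1 # perm_words xs)"
  unfolding output_starts_with_def
proof (intro allI impI)
  fix k assume k: "k < length (1 # perm_words xs)"
  have pw: "perm_words xs = int (length xs) # pair_words xs" by (simp add: perm_words_def pair_words_def)
  show "s ''output'' (int k) = (1 # perm_words xs) ! k"
  proof (cases "k < 2")
    case True
    then have "k = 0 \<or> k = 1" by auto
    then show ?thesis using assms(2,3) pw by auto
  next
    case False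
    define t where "t = (k - 2) div 2"
    have t: "t < length xs" using k False pw by (simp add: t_def length_pair_words)
    have nth: "(1 # perm_words xs) ! k = pair_words xs ! (k - 2)"
      using False by (simp add: pw nth_Cons' numeral_2_eq_2)
    have idx: "int (2 * t + 2) = 2 * int t + 2" "int (2 * t + 3) = 2 * int t + 3" by simp_all
    have "k = 2 * t + 2 \<or> k = 2 * t + 3" using False unfolding t_def by presburger
    then show ?thesis
    proof
      assume kt: "k = 2 * t + 2"
      have "s ''output'' (int k) = int (fst (xs ! t))" using assms(1) t unfolding kt idx outputs_def by blast
      then show ?thesis unfolding nth using nth_pair_words[OF t] by (simp add: kt)
    next
      assume kt: "k = 2 * t + 3"
      have "s ''output'' (int k) = int (snd (xs ! t))" using assms(1) t unfolding kt idx outputs_def by blast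
      moreover have "k - 2 = 2 * t + 1" using kt by simp
      ultimately show ?thesis unfolding nth using nth_pair_words[OF t] by (simp only:)
    qed
  qed
qed

section \<open>Sorted lengths, cap, seed and initial weights of an equation\<close>

context cycle_equation
begin

lemma entries_lengths: "(\<lambda>(e, u, l). l) ` set entries = lengths"
  unfolding entries_def lengths_def by (force simp: image_Un image_image split_beta)

lemma sort_phase:
  assumes st: "stores entries s" and x: "s ''x'' 0 = 0" "s ''R'' 0 = 0"
  shows "\<exists>s'. reach sort_phase s ((length nodes + 1) * (length entries * 60 + 80) + 20) s' \<and>
    frame {''l'', ''j'', ''M'', ''R'', ''x'', ''go''} s s' \<and> s' ''R'' 0 = int (length nodes) \<and>
    (\<forall>j<length nodes. s' ''M'' (int j) = int (nodes ! j))"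
proof -
  let ?F = "{''l'', ''j'', ''M'', ''R'', ''x'', ''go''}"
  let ?b = "Positive (V ''go'')" and ?s1 = "effect (''go'' ::= Const 1) s"
  let ?c = "length entries * 60 + 30 + 40"
  define J where "J = (\<lambda>k t r c. frame ?F s t \<and> r \<le> length nodes \<and> t ''R'' 0 = int r \<and>
    (\<forall>j<r. t ''M'' (int j) = int (nodes ! j)) \<and>
    (t ''go'' 0 = 1 \<and> k = length nodes - r + 1 \<and> t ''x'' 0 = int c \<and> {l \<in> lengths. c < l} = set (drop r nodes) \<or>
     t ''go'' 0 = 0 \<and> r = length nodes))"
  have "\<exists>s' k. reach (While ?b (find_next;; sort_update)) ?s1 ((length nodes + 1) * (?c + 1 + bcost ?b) + 1 + bcost ?b) s' \<and>
    (\<exists>r c. J k s' r c) \<and> \<not> bval ?b s'"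
  proof (rule reach_While)
    have "{l \<in> lengths. 0 < l} = set (drop 0 nodes)" using lengths_pos by auto
    then have "J (length nodes + 1) ?s1 0 0" unfolding J_def using x by simp
    then show "\<exists>r c. J (length nodes + 1) ?s1 r c" by blast
    fix k t assume "\<exists>r c. J k t r c" and b: "bval ?b t"
    then obtain r c where "J k t r c" by blast
    then have fr: "frame ?F s t" and r: "r \<le> length nodes" and R: "t ''R'' 0 = int r"
      and M: "\<forall>j<r. t ''M'' (int j) = int (nodes ! j)" and go: "t ''go'' 0 = 1" and k: "k = length nodes - r + 1"
      and xt: "t ''x'' 0 = int c" and rest: "{l \<in> lengths. c < l} = set (drop r nodes)"
      using b unfolding J_def by auto
    have "stores entries t" using stores_frame[OF st fr] by simp
    then obtain t1 where t1: "reach find_next t (length entries * 60 + 30) t1" "frame {''l'', ''j''} t t1"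
      "next_length lengths c (t1 ''l'' 0)" using find_next[of entries t c] xt entries_pos unfolding entries_lengths by blast
    have fr1: "frame ?F s t1" using frame_trans[OF fr t1(2), of ?F] by simp
    have same: "t1 ''R'' = t ''R''" "t1 ''M'' = t ''M''" "t1 ''go'' = t ''go''" using t1(2) by (simp_all add: frame_def)
    define t2 where "t2 = effect sort_update t1"
    have "reach (find_next;; sort_update) t ?c t2"
      unfolding t2_def by (rule reach_Seq_block[OF t1(1)]) (simp_all add: sort_update_def)
    moreover have fr2: "frame ?F s t2" using fr1 by (simp add: t2_def sort_update_def)
    moreover have "\<exists>k' r' c'. k' < k \<and> J k' t2 r' c'"
    proof (cases "r < length nodes")
      case True
      let ?m = "nodes ! r"
      have dr: "drop r nodes = ?m # drop (Suc r) nodes" using True by (rule Cons_nth_drop_Suc[symmetric])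
      have sd: "sorted (?m # drop (Suc r) nodes)" "distinct (?m # drop (Suc r) nodes)"
        using sorted_nodes distinct_nodes unfolding dr[symmetric] by (simp_all add: sorted_wrt_drop)
      have m: "?m \<in> lengths" "c < ?m" using rest dr by auto
      have "t1 ''l'' 0 = int ?m"
        using t1(3) unfolding next_length_def
      proof (elim disjE bexE conjE)
        fix m' assume *: "m' \<in> lengths" "t1 ''l'' 0 = int m'" "c < m'" "\<forall>m''\<in>lengths. c < m'' \<longrightarrow> m' \<le> m''"
        have "m' \<in> set (drop r nodes)" using * rest by blast
        then have "?m \<le> m'" using sd(1) unfolding dr by auto
        moreover have "m' \<le> ?m" using * m by blast
        ultimately show ?thesis using *(2) by simp
      qed (use m in force)
      then have t2: "t2 ''R'' 0 = int (Suc r)" "t2 ''M'' = (t ''M'')(int r := int ?m)" "t2 ''go'' 0 = 1" "t2 ''x'' 0 = int ?m"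
        using lengths_pos[OF m(1)] same R go by (simp_all add: t2_def sort_update_def)
      have "{l \<in> lengths. ?m < l} = set (drop (Suc r) nodes)"
      proof (intro set_eqI iffI)
        fix l assume l: "l \<in> {l \<in> lengths. ?m < l}"
        then have "l \<in> {l \<in> lengths. c < l}" using m(2) by simp
        then have "l \<in> set (?m # drop (Suc r) nodes)" unfolding rest dr .
        moreover have "l \<noteq> ?m" using l by simp
        ultimately show "l \<in> set (drop (Suc r) nodes)" by simp
      next
        fix l assume l: "l \<in> set (drop (Suc r) nodes)"
        then have "l \<in> lengths" using in_set_dropD[OF l] by simp
        moreover have "?m \<le> l" using l sd(1) by simp
        moreover have "l \<noteq> ?m" using l sd(2) by (metis distinct.simps(2))
        ultimately show "l \<in> {l \<in> lengths. ?m < l}" by simp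
      qed
      then have "J (length nodes - Suc r + 1) t2 (Suc r) ?m"
        unfolding J_def using fr2 True t2 M by (auto simp: less_Suc_eq)
      moreover have "length nodes - Suc r + 1 < k" using True k by simp
      ultimately show ?thesis by blast
    next
      case False
      then have none: "r = length nodes" "{l \<in> lengths. c < l} = {}" using r rest by auto
      then have "t1 ''l'' 0 = 0" using t1(3) unfolding next_length_def by auto
      then have "t2 ''R'' 0 = int r" "t2 ''M'' = t ''M''" "t2 ''go'' 0 = 0"
        using same R by (simp_all add: t2_def sort_update_def)
      then have "J 0 t2 r c" unfolding J_def using fr2 none(1) M by auto
      moreover have "0 < k" using k by simp
      ultimately show ?thesis by blast
    qed
    ultimately show "\<exists>s' k'. k' < k \<and> reach (find_next;; sort_update) t ?c s' \<and> (\<exists>r c. J k' s' r c)" by blast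
  qed
  then obtain s' k r c where
    s': "reach (While ?b (find_next;; sort_update)) ?s1 ((length nodes + 1) * (?c + 1 + bcost ?b) + 1 + bcost ?b) s'"
    and J: "J k s' r c" "\<not> bval ?b s'" by blast
  have "reach sort_phase s ((length nodes + 1) * (length entries * 60 + 80) + 20) s'"
    unfolding sort_phase_def by (rule reach_block_Seq[OF _ s']) (simp_all add: algebra_simps)
  then show ?thesis using J unfolding J_def by auto
qed

text \<open>Positivity matters for empty \<open>B\<close>: a cap of 0 would turn every term into a
  constant.\<close>

definition capacity :: nat where
  "capacity = (LEAST k. 0 < k \<and> total < 2 ^ k)"

lemma capacity: "0 < capacity" "total < 2 ^ capacity"
proof -
  have "0 < capacity \<and> total < 2 ^ capacity"
    unfolding capacity_def by (rule LeastI[of _ "Suc total"]) (auto intro: less_trans[OF less_exp])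
  then show "0 < capacity" "total < 2 ^ capacity" by auto
qed

lemma capacity_least: "0 < k \<Longrightarrow> k < capacity \<Longrightarrow> 2 ^ k \<le> total"
  unfolding capacity_def using not_less_Least[of k] by fastforce

lemma cap_phase:
  assumes G: "s ''G'' 0 = int total"
  shows "\<exists>s'. reach cap_phase s (capacity * 30 + 20) s' \<and> frame {''k'', ''p''} s s' \<and> s' ''k'' 0 = int capacity"
proof -
  let ?b = "Neg (Less (V ''G'') (V ''p''))"
  let ?C = "''p'' ::= Times (Const 2) (V ''p'');; ''k'' ::= Plus (V ''k'') (Const 1)"
  let ?s1 = "effect (''k'' ::= Const 1;; ''p'' ::= Const 2) s"
  define J where "J = (\<lambda>i t k. frame {''k'', ''p''} s t \<and> 0 < k \<and> k \<le> capacity \<and> i = capacity - k \<and>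
    t ''k'' 0 = int k \<and> t ''p'' 0 = 2 ^ k)"
  have cap: "total < 2 ^ k \<longleftrightarrow> k = capacity" if "0 < k" "k \<le> capacity" for k
    using capacity_least[OF that(1)] capacity(2) that(2) by (metis le_neq_implies_less not_le)
  have "\<exists>s' i. reach (While ?b ?C) ?s1 ((capacity - 1) * (20 + 1 + bcost ?b) + 1 + bcost ?b) s' \<and>
    (\<exists>k. J i s' k) \<and> \<not> bval ?b s'"
  proof (rule reach_While)
    have "J (capacity - 1) ?s1 1" unfolding J_def using capacity(1) by simp
    then show "\<exists>k. J (capacity - 1) ?s1 k" by blast
    fix i t assume "\<exists>k. J i t k" and b: "bval ?b t"
    then obtain k where J: "frame {''k'', ''p''} s t" "0 < k" "k \<le> capacity" "i = capacity - k"
      "t ''k'' 0 = int k" "t ''p'' 0 = 2 ^ k" unfolding J_def by blast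
    have "t ''G'' 0 = int total" using J(1) G by (simp add: frame_def)
    then have "(2::int) ^ k \<le> int total" using b J(6) by simp
    then have "\<not> total < 2 ^ k" by (metis of_nat_le_iff of_nat_numeral of_nat_power not_le)
    then have k: "k < capacity" using cap[OF J(2,3)] J(3) by simp
    let ?t = "effect ?C t"
    have "J (capacity - Suc k) ?t (Suc k)" unfolding J_def using J k by simp
    moreover have "reach ?C t 20 ?t" by (rule reach_mono[OF reach_loop_free]) simp_all
    moreover have "capacity - Suc k < i" using J(4) k by simp
    ultimately show "\<exists>s' i'. i' < i \<and> reach ?C t 20 s' \<and> (\<exists>k. J i' s' k)" by blast
  qed
  then obtain s' i k where s': "reach (While ?b ?C) ?s1 ((capacity - 1) * (20 + 1 + bcost ?b) + 1 + bcost ?b) s'"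
    and "J i s' k" and b: "\<not> bval ?b s'" by blast
  then have J: "frame {''k'', ''p''} s s'" "0 < k" "k \<le> capacity" "s' ''k'' 0 = int k" "s' ''p'' 0 = 2 ^ k"
    unfolding J_def by auto
  have "s' ''G'' 0 = int total" using J(1) G by (simp add: frame_def)
  then have "int total < 2 ^ k" using b J(5) by simp
  then have "total < 2 ^ k" by (metis of_nat_less_iff of_nat_numeral of_nat_power)
  then have "k = capacity" using cap[OF J(2,3)] by simp
  moreover have "reach cap_phase s (capacity * 30 + 20) s'"
    unfolding cap_phase_def by (rule reach_block_Seq[OF _ s']) (simp_all add: diff_mult_distrib)
  ultimately show ?thesis using J by blast
qed

lemma total_entries: "(\<Sum>(e, u, l)\<leftarrow>entries. if u < 0 then - u * int l else 0) = int total"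
proof -
  have 1: "(\<Sum>(e, u, l)\<leftarrow>map (\<lambda>(e, n, l). (e, int n, l)) qs. if u < 0 then - u * int l else 0) = 0"
    by (induction qs) auto
  have 2: "(\<Sum>(e, u, l)\<leftarrow>map (\<lambda>(n, l). (0::nat, - int n, l)) bs. if u < 0 then - u * int l else 0) = int total"
    unfolding total_def by (induction bs) auto
  show ?thesis by (simp only: entries_def map_append sum_list.append 1 2 add_0)
qed

lemma entries_nonzero: "(e, u, l) \<in> set entries \<Longrightarrow> u \<noteq> 0 \<and> 0 < l"
  using qs_pos bs_pos by (force simp: entries_def)

text \<open>The least nonconstant length is at most \<open>g\<close>, because \<open>g\<close>
  occurs, and is a multiple of \<open>g\<close>.\<close>

lemma recorded_seed:
  assumes "recorded entries s" shows "s ''g'' 0 = int g"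
proof -
  obtain e n where e: "(e, n, g) \<in> set qs" "0 < e" using seed by blast
  then have g: "(e, int n, g) \<in> set entries" by (force simp: entries_def)
  have ex: "\<exists>n. (e, n, l) \<in> set qs" if "(e, u, l) \<in> set entries" "0 < e" for e u l
    using that by (auto simp: entries_def)
  have "\<not> (\<forall>(e, u, l)\<in>set entries. e = 0)" using g e(2) by fast
  then obtain m where m: "s ''g'' 0 = int m" "\<exists>e u. (e, u, m) \<in> set entries \<and> 0 < e"
    "\<forall>(e, u, l)\<in>set entries. 0 < e \<longrightarrow> m \<le> l" "0 < m"
    using assms unfolding recorded_def by blast
  have "m \<le> g" using m(3) g e(2) by blast
  moreover have "g \<le> m" using m(2,4) ex seed_dvd by (meson dvd_imp_le)
  ultimately show ?thesis using m(1) by simp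
qed

text \<open>A weight of at least 2 stems from a positive exponent, hence from \<open>qs\<close>, and
  is certified by the chain without factors. Entries of \<open>B\<close> have exponent 0 and merely
  admit their length.\<close>

lemma recorded_weights:
  assumes "recorded entries s" shows "weights z {} (\<lambda>l. s ''W'' (int l))"
proof -
  have a: "\<forall>(e, u, l)\<in>set entries. int e + 1 \<le> s ''W'' (int l)"
    and b: "\<forall>l. 0 < s ''W'' (int l) \<longrightarrow> (\<exists>e u. (e, u, l) \<in> set entries \<and> s ''W'' (int l) = int e + 1)"
    using assms unfolding recorded_def by blast+
  have "l \<in> lengths" if "0 < s ''W'' (int l)" for l
    using b that unfolding entries_lengths[symmetric] by force
  moreover have "1 \<le> s ''W'' (int l)" if "l \<in> lengths" for l
    using a that unfolding entries_lengths[symmetric] by fastforce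
  moreover have "int e + 1 \<le> s ''W'' (int l)" if "(e, n, l) \<in> set qs" for e n l
  proof -
    have "(e, int n, l) \<in> set entries" using that by (force simp: entries_def)
    then show ?thesis using a by blast
  qed
  moreover have "\<exists>e n l0 j. (e, n, l0) \<in> set qs \<and> l \<in> joins {m \<in> lengths. 0 < z m} j l0 \<and>
      int j + s ''W'' (int l) \<le> int e + 1" if l: "2 \<le> s ''W'' (int l)" for l
  proof -
    obtain e u where eu: "(e, u, l) \<in> set entries" "s ''W'' (int l) = int e + 1" using b l by force
    then have "0 < e" using l by simp
    then obtain n where "(e, n, l) \<in> set qs" using eu(1) by (auto simp: entries_def)
    moreover have "l \<in> joins {m \<in> lengths. 0 < z m} 0 l" by simp
    moreover have "int 0 + s ''W'' (int l) \<le> int e + 1" using eu(2) by simp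
    ultimately show ?thesis by blast
  qed
  ultimately show ?thesis unfolding weights_def by blast
qed

end

section \<open>The solver\<close>

definition flatten :: "poly_code \<Rightarrow> (nat \<times> nat \<times> nat) list" where
  "flatten ps = concat (map (\<lambda>(i, as). map (\<lambda>(n, l). (i, n, l)) as) ps)"

lemma poly_entries_flatten: "poly_entries ps = map (\<lambda>(e, n, l). (e, int n, l)) (flatten ps)"
  by (induction ps) (auto simp: poly_entries_def flatten_def)

lemma length_flatten: "length (flatten ps) = (\<Sum>(i, as)\<leftarrow>ps. length as)"
  by (induction ps) (auto simp: flatten_def)

text \<open>Headers take time to read but are not counted in the size of the input; nonempty arrays
  bound their number by that size.\<close>

lemma length_le_sum_lengths:
  "(\<And>i as. (i, as) \<in> set ps \<Longrightarrow> as \<noteq> []) \<Longrightarrow> length ps \<le> (\<Sum>(i, as)\<leftarrow>ps. length as)"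
proof (induction ps)
  case (Cons y ps)
  obtain i as where y: "y = (i, as)" by (cases y)
  have "length ps \<le> (\<Sum>(i, as)\<leftarrow>ps. length as)" 
  proof (rule Cons.IH)
    show "as \<noteq> []" if "(i, as) \<in> set ps" for i as using Cons.prems[of i as] that by simp
  qed
  moreover have "as \<noteq> []" using Cons.prems[of i as] y by simp
  ultimately show ?case by (cases as) (simp_all add: y)
qed simp

lemma solver_time:
  fixes N R k H :: nat
  assumes "0 < N" "0 < k" "R \<le> N" "H \<le> 2 * N + 1"
  shows "(H * 170 + 30) + ((R + 1) * (N * 60 + 80) + 20) + (k * 30 + 20) + 10
    + (R * (3000 * (N * k) + 10 + 12) + 9) + (R * (R * (52 * k + 132) + 60) + 9) + 100 \<le> 8000 * (N ^ 2 * k)"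
proof -
  have "R * (R * (52 * k + 132) + 60) \<le> N * (N * (52 * k + 132) + 60)"
    using assms(3) by (intro mult_le_mono add_mono) auto
  also have "\<dots> = 52 * (N ^ 2 * k) + 132 * N ^ 2 + 60 * N" by (simp add: algebra_simps power2_eq_square)
  finally have 1: "R * (R * (52 * k + 132) + 60) \<le> 52 * (N ^ 2 * k) + 132 * N ^ 2 + 60 * N" .
  have "R * (3000 * (N * k) + 10 + 12) \<le> N * (3000 * (N * k) + 10 + 12)"
    using assms(3) by (rule mult_le_mono1)
  also have "\<dots> = 3000 * (N ^ 2 * k) + 22 * N" by (simp add: algebra_simps power2_eq_square)
  finally have 2: "R * (3000 * (N * k) + 10 + 12) \<le> 3000 * (N ^ 2 * k) + 22 * N" .
  have "(R + 1) * (N * 60 + 80) \<le> (N + 1) * (N * 60 + 80)"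
    using assms(3) by (intro mult_le_mono1) simp
  also have "\<dots> = 60 * N ^ 2 + 140 * N + 80" by (simp add: algebra_simps power2_eq_square)
  finally have 3: "(R + 1) * (N * 60 + 80) \<le> 60 * N ^ 2 + 140 * N + 80" .
  have "N \<le> N ^ 2" using assms(1) by (simp add: power2_eq_square)
  moreover have "N ^ 2 \<le> N ^ 2 * k" "k \<le> N ^ 2 * k" "1 \<le> N ^ 2 * k" using assms(1,2) by simp_all
  ultimately show ?thesis using 1 2 3 assms(4) by linarith
qed

context cycle_equation
begin

lemma solver:
  assumes ps: "qs = flatten ps" and ne: "\<And>i as. (i, as) \<in> set ps \<Longrightarrow> as \<noteq> []"
  shows "\<exists>s'. reach solver (initial ps bs) (8000 * (length entries ^ 2 * capacity)) s' \<and>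
    (if \<exists>X. solution X
     then \<exists>xs. solution (decode xs) \<and> (\<forall>(n, l)\<in>set xs. 0 < n \<and> 0 < l) \<and> output_starts_with s' (1 # perm_words xs)
     else output_starts_with s' [0])"
proof -
  let ?N = "length entries" and ?R = "length nodes" and ?k = capacity
  let ?s0 = "initial ps bs"
  have es: "poly_entries ps @ rhs_entries bs = entries"
    unfolding entries_def poly_entries_flatten rhs_entries_def ps[symmetric] ..
  obtain s1 where s1: "reach parse ?s0 (pending_size bs (Some ps) * 170 + 30) s1"
    "frame {''E'', ''L'', ''U'', ''W'', ''G'', ''g'', ''n'', ''i'', ''d'', ''c'', ''f'', ''s''} ?s0 s1"
    "recorded entries s1" using parse[of ps bs] entries_nonzero unfolding es by blast
  have z1: "s1 ''x'' 0 = 0" "s1 ''R'' 0 = 0" "s1 ''X'' 0 = 0"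
    using s1(2) by (simp_all add: frame_def initial_def Let_def)
  have "stores entries s1" using s1(3) by (simp add: recorded_def)
  then obtain s2 where s2: "reach sort_phase s1 ((?R + 1) * (?N * 60 + 80) + 20) s2"
    "frame {''l'', ''j'', ''M'', ''R'', ''x'', ''go''} s1 s2" "s2 ''R'' 0 = int ?R"
    "\<forall>j<?R. s2 ''M'' (int j) = int (nodes ! j)" using sort_phase z1 by blast
  have rec2: "recorded entries s2" by (rule recorded_frame[OF s1(3) s2(2)]) simp
  then have "s2 ''G'' 0 = int total" by (simp add: recorded_def total_entries)
  then obtain s3 where s3: "reach cap_phase s2 (?k * 30 + 20) s3" "frame {''k'', ''p''} s2 s3" "s3 ''k'' 0 = int ?k"
    using cap_phase by blast
  let ?s4 = "effect (''ok'' ::= Const 1) s3"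
  have fr4: "frame {''k'', ''p'', ''ok''} s2 ?s4"
    using frame_mono[OF s3(2), of "{''k'', ''p'', ''ok''}"] by simp
  have rec4: "recorded entries ?s4" by (rule recorded_frame[OF rec2 fr4]) simp
  have env4: "env ?k ?s4"
    using rec4 recorded_seed[OF rec4] s2(3,4) s3(2,3) unfolding env_def recorded_def by (simp add: frame_def)
  have "?s4 ''X'' 0 = 0" using z1(3) s2(2) fr4 by (simp add: frame_def)
  then have "progress ?k 0 ?s4"
    by (simp add: progress_def consistent_def outputs_def solution_code_def)
  then obtain s5 where s5: "reach node_phase ?s4 (?R * (3000 * (?N * ?k) + 10 + 12) + 9) s5"
    "frame (insert ''r'' {''m'', ''S'', ''j'', ''y'', ''b'', ''up'', ''w'', ''T'', ''a'', ''h'', ''v'', ''Z'',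
      ''e'', ''q'', ''u'', ''A'', ''B'', ''t'', ''ok'', ''output'', ''X''}) ?s4 s5" "progress ?k ?R s5"
    using node_phase[OF capacity(2,1) env4] by blast
  have rec5: "recorded entries s5" by (rule recorded_frame[OF rec4 s5(2)]) simp
  have env5: "env ?k s5" by (rule env_frame[OF env4 s5(2)]) simp
  let ?C6 = "Cond (Positive (V ''ok'')) support_phase Skip"
  let ?C7 = "Cond (Positive (V ''ok''))
       (Write ''output'' (Const 0) (Const 1);; Write ''output'' (Const 1) (V ''X''))
       (Write ''output'' (Const 0) (Const 0))"
  let ?c6 = "?R * (?R * (52 * ?k + 132) + 60) + 9"
  have "\<exists>s6. reach ?C6 s5 (?c6 + 10) s6 \<and>
    (s6 ''ok'' 0 = 1 \<and> (\<exists>xs. solution (decode xs) \<and> (\<forall>(n, l)\<in>set xs. 0 < n \<and> 0 < l) \<and> outputs xs s6) \<or>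
     s6 ''ok'' 0 = 0 \<and> (\<forall>X. \<not> solution X))"
  proof (cases "s5 ''ok'' 0 = 1")
    case False
    then have *: "s5 ''ok'' 0 = 0" "\<forall>X. \<not> solution X" using s5(3) by (auto simp: progress_def)
    have "reach ?C6 s5 (?c6 + 10) s5" by (rule reach_CondF[OF _ reach_Skip]) (use * in simp_all)
    then show ?thesis using * by blast
  next
    case True
    then obtain z where z: "consistent ?k ?R z" "\<And>j. j < ?R \<Longrightarrow> s5 ''Z'' (int j) = int (z (nodes ! j))"
      "outputs (solution_code ?R z) s5" using s5(3) by (auto simp: progress_def)
    have "support_ok z {} s5" using True recorded_weights[OF rec5] by (simp add: support_ok_def)
    then obtain s6 where s6: "reach support_phase s5 ?c6 s6"
      "frame {''r'', ''x'', ''j'', ''A'', ''B'', ''t'', ''l'', ''W'', ''ok''} s5 s6"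
      "support_ok z (lengths \<times> {m \<in> lengths. 0 < z m}) s6"
      using support_phase[OF capacity(1) z(1) env5 z(2)] by blast
    have "reach ?C6 s5 (?c6 + 10) s6" by (rule reach_CondT[OF _ s6(1)]) (use True in simp_all)
    moreover have "outputs (solution_code ?R z) s6" using z(3) s6(2) by (simp add: outputs_def frame_def)
    ultimately show ?thesis
      using s6(3) solution_code_solves[OF z(1)] unfolding support_ok_def by blast
  qed
  then obtain s6 where s6: "reach ?C6 s5 (?c6 + 10) s6"
    "s6 ''ok'' 0 = 1 \<and> (\<exists>xs. solution (decode xs) \<and> (\<forall>(n, l)\<in>set xs. 0 < n \<and> 0 < l) \<and> outputs xs s6) \<or>
     s6 ''ok'' 0 = 0 \<and> (\<forall>X. \<not> solution X)" by blast
  define s7 where "s7 = effect ?C7 s6"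
  have H: "pending_size bs (Some ps) \<le> 2 * ?N + 1"
  proof -
    have "length ps \<le> (\<Sum>(i, as)\<leftarrow>ps. length as)" using ne by (rule length_le_sum_lengths)
    moreover have "(\<Sum>(i, as)\<leftarrow>ps. 1 + length as) = length ps + (\<Sum>(i, as)\<leftarrow>ps. length as)"
      by (induction ps) auto
    moreover have "?N = (\<Sum>(i, as)\<leftarrow>ps. length as) + length bs"
      unfolding length_entries unfolding ps length_flatten ..
    ultimately show ?thesis by (simp add: pending_size_def)
  qed
  have "reach solver ?s0 (8000 * (?N ^ 2 * ?k)) s7"
    unfolding solver_def s7_def
    by (rule reach_mono[OF reach_Seq[OF s1(1) reach_Seq[OF s2(1) reach_Seq[OF s3(1) reach_block_Seq[OF _
        reach_Seq[OF s5(1) reach_Seq_block[OF s6(1) _ order_refl] order_refl] order_refl] order_refl] order_refl] order_refl]])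
      (use solver_time[OF length_entries_pos capacity(1) length_nodes H] in simp_all)
  moreover have "if \<exists>X. solution X
     then \<exists>xs. solution (decode xs) \<and> (\<forall>(n, l)\<in>set xs. 0 < n \<and> 0 < l) \<and> output_starts_with s7 (1 # perm_words xs)
     else output_starts_with s7 [0]"
  proof (cases "s6 ''ok'' 0 = 1")
    case True
    then obtain xs where xs: "solution (decode xs)" "\<forall>(n, l)\<in>set xs. 0 < n \<and> 0 < l" "outputs xs s6"
      using s6(2) by auto
    have "s7 ''output'' = (s6 ''output'')(0 := 1, 1 := int (length xs))" "s7 ''X'' = s6 ''X''"
      using True xs(3) by (simp_all add: s7_def outputs_def)
    moreover from this have "outputs xs s7" using xs(3) by (simp add: outputs_def)
    ultimately have "output_starts_with s7 (1 # perm_words xs)" by (intro outputs_starts_with) simp_all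
    then show ?thesis using xs by auto
  next
    case False
    then have "s6 ''ok'' 0 = 0" "\<forall>X. \<not> solution X" using s6(2) by auto
    then show ?thesis by (simp add: s7_def output_starts_with_def)
  qed
  ultimately show ?thesis by blast
qed

section \<open>From the number of points of \<open>B\<close> to the logarithms\<close>

lemma total_le:
  "total \<le> (length qs + length bs) * max_length (decode bs) * max_multiplicity (decode bs)"
proof -
  let ?B = "decode bs"
  \<comment> \<open>Every length divides 0, so the count at 0 sees all points. Passing through
    counts collects repeated lengths of \<open>bs\<close>, whereas the greatest multiplicity refers
    to the permutation itself.\<close>
  have "total = rhs_at bs 0" unfolding total_def rhs_at_def by (induction bs) auto
  also have "\<dots> = (\<Sum>l\<in>{l\<in>cycle_lengths ?B. l dvd 0}. l * multiplicity_of ?B l)"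
    unfolding fixed_count_decode[symmetric] by (rule fixed_count_eq_sum) simp_all
  also have "\<dots> = (\<Sum>l\<in>cycle_lengths ?B. l * multiplicity_of ?B l)" by simp
  also have "\<dots> \<le> (\<Sum>l\<in>cycle_lengths ?B. max_length ?B * max_multiplicity ?B)"
    unfolding max_length_def max_multiplicity_def by (intro sum_mono mult_le_mono Max_ge) auto
  also have "\<dots> = card (cycle_lengths ?B) * (max_length ?B * max_multiplicity ?B)" by simp
  also have "\<dots> \<le> (length qs + length bs) * (max_length ?B * max_multiplicity ?B)"
  proof (rule mult_le_mono1)
    have "cycle_lengths ?B = snd ` set bs" by (rule cycle_lengths_decode) (rule bs_pos)
    then have "card (cycle_lengths ?B) \<le> length bs"
      using card_image_le[of "set bs" snd] card_length[of bs] by simp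
    then show "card (cycle_lengths ?B) \<le> length qs + length bs" by simp
  qed
  finally show ?thesis by (simp only: mult.assoc)
qed

text \<open>The number of bits is at most 1 more than a sum of two logarithms, while the time bound
  has their product. As \<open>lg\<close> is at least 1, the sum is at most twice the product and
  the 1 at most once, which gives the 3.\<close>

lemma capacity_le_lg:
  fixes c p q :: real
  assumes "real total \<le> c * p * q" "0 \<le> c" "0 \<le> p" "0 \<le> q"
  shows "real capacity \<le> 3 * (lg (c * p) * lg q)"
proof -
  have ge1: "1 \<le> lg x" for x by (simp add: lg_def)
  have prod: "lg (c * p) + lg q \<le> 2 * (lg (c * p) * lg q)" "1 \<le> lg (c * p) * lg q"
  proof -
    have *: "a + b \<le> 2 * (a * b) \<and> 1 \<le> a * b" if "1 \<le> a" "1 \<le> b" for a b :: real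
    proof -
      have "a * 1 \<le> a * b" "1 * b \<le> a * b" using that by (intro mult_mono; simp)+
      then show ?thesis using that by (intro conjI) linarith+
    qed
    show "lg (c * p) + lg q \<le> 2 * (lg (c * p) * lg q)" "1 \<le> lg (c * p) * lg q"
      using *[OF ge1 ge1] by blast+
  qed
  show ?thesis
  proof (cases "capacity = 1")
    case True
    then show ?thesis using prod(2) by simp
  next
    case False
    then have "1 < capacity" using capacity(1) by simp
    then have "2 ^ (capacity - 1) \<le> total" by (intro capacity_least) simp_all
    then have pw: "(2::real) ^ (capacity - 1) \<le> real total" by (metis of_nat_le_iff of_nat_numeral of_nat_power)
    have t: "0 < real total" by (rule less_le_trans[OF _ pw]) simp
    \<comment> \<open>More than one bit means that \<open>B\<close> has points, so no factor is 0
      and the logarithm splits.\<close>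
    have "0 < c * p * q" using t assms(1) by linarith
    then have "c \<noteq> 0" "p \<noteq> 0" "q \<noteq> 0" by auto
    then have "0 < c" "0 < p" and q: "0 < q" using assms(2-4) by linarith+
    then have cp: "0 < c * p" by simp
    have "real (capacity - 1) = log 2 (2 ^ (capacity - 1))" by simp
    also have "\<dots> \<le> log 2 (c * p * q)" using order_trans[OF pw assms(1)] by (intro log_mono) simp_all
    also have "\<dots> = log 2 (c * p) + log 2 q" using cp q log_mult_pos by simp
    also have "\<dots> \<le> lg (c * p) + lg q" by (simp add: lg_def)
    finally have "real capacity - 1 \<le> lg (c * p) + lg q" using capacity(1) by simp
    then show ?thesis using prod by linarith
  qed
qed

end

section \<open>From compact encodings to the flattened equation\<close>

lemma encodes_perm_decode:
  "encodes_perm as A \<longleftrightarrow> (\<forall>(n, l)\<in>set as. 0 < n \<and> 0 < l) \<and> A = decode as"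
  by (simp add: encodes_perm_def decode_def)

lemma lhs_flatten: "lhs (flatten ps) X = (\<Sum>(i, as)\<leftarrow>ps. decode as * X ^ i)"
proof (induction ps)
  case (Cons y ps)
  obtain i as where y: "y = (i, as)" by (cases y)
  have "lhs (map (\<lambda>(n, l). (i, n, l)) as) X = decode as * X ^ i"
    by (induction as) (auto simp: lhs_def decode_def distrib_right)
  then show ?case using Cons y by (simp add: lhs_def flatten_def)
qed (simp add: lhs_def flatten_def)

lemma encodes_poly_lhs:
  assumes "encodes_poly ps P" shows "lhs (flatten ps) X = poly P X"
proof -
  have c: "coeff P i = decode as" if "(i, as) \<in> set ps" for i as
    using assms that unfolding encodes_poly_def encodes_perm_decode by blast
  have d: "distinct (map fst ps)" and sup: "{i. coeff P i \<noteq> 0} \<subseteq> fst ` set ps"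
    using assms unfolding encodes_poly_def by auto
  have deg: "i \<le> degree P" if "i \<in> fst ` set ps" for i
  proof (rule le_degree)
    show "coeff P i \<noteq> 0" using assms that unfolding encodes_poly_def by fastforce
  qed
  have "poly P X = (\<Sum>i\<le>degree P. coeff P i * X ^ i)" by (rule poly_altdef)
  also have "\<dots> = (\<Sum>i\<in>fst ` set ps. coeff P i * X ^ i)"
  proof (rule sum.mono_neutral_right)
    show "fst ` set ps \<subseteq> {..degree P}" using deg by blast
    have "coeff P i = 0" if "i \<notin> fst ` set ps" for i using sup that by blast
    then show "\<forall>i\<in>{..degree P} - fst ` set ps. coeff P i * X ^ i = 0" by simp
  qed simp
  also have "\<dots> = (\<Sum>i\<leftarrow>map fst ps. coeff P i * X ^ i)"
    using sum_list_distinct_conv_sum_set[OF d, of "\<lambda>i. coeff P i * X ^ i"] by simp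
  also have "\<dots> = (\<Sum>(i, as)\<leftarrow>ps. decode as * X ^ i)"
    unfolding map_map by (intro arg_cong[of _ _ sum_list] map_cong) (auto simp: c)
  finally show ?thesis by (simp add: lhs_flatten)
qed

lemma encodes_cycle_equation:
  assumes P: "pseudo_injective P g" "encodes_poly ps P" and B: "encodes_perm bs B"
  shows "cycle_equation (flatten ps) bs g"
proof
  have c: "coeff P i = decode as" "\<And>n l. (n, l) \<in> set as \<Longrightarrow> 0 < n \<and> 0 < l" if "(i, as) \<in> set ps" for i as
    using P(2) that unfolding encodes_poly_def encodes_perm_decode by blast+
  have len: "cycle_lengths (coeff P i) = snd ` set as" if "(i, as) \<in> set ps" for i as
    using cycle_lengths_decode[of as] c[OF that] by simp
  show "0 < n \<and> 0 < l" if "(e, n, l) \<in> set (flatten ps)" for e n l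
    using that c(2) by (auto simp: flatten_def)
  show "0 < n \<and> 0 < l" if "(n, l) \<in> set bs" for n l
    using B that unfolding encodes_perm_decode by blast
  show "\<exists>e n. (e, n, g) \<in> set (flatten ps) \<and> 0 < e"
  proof -
    have "g \<in> nonconst_cycle_lengths P" using P(1) by (simp add: pseudo_injective_def)
    then obtain i where "i \<in> {1..degree P}" and i2: "g \<in> cycle_lengths (coeff P i)"
      unfolding nonconst_cycle_lengths_def by blast
    then have i: "0 < i" "g \<in> cycle_lengths (coeff P i)" by simp_all
    then have "coeff P i \<noteq> 0" by auto
    then obtain as where as: "(i, as) \<in> set ps" using P(2) unfolding encodes_poly_def by force
    then have "g \<in> snd ` set as" using i len by blast
    then show ?thesis using as i(1) by (force simp: flatten_def)
  qed
  show "g dvd l" if el: "(e, n, l) \<in> set (flatten ps)" "0 < e" for e n l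
  proof -
    obtain as where as: "(e, as) \<in> set ps" "(n, l) \<in> set as" using el(1) by (auto simp: flatten_def)
    have "l \<in> cycle_lengths (coeff P e)" using len[OF as(1)] as(2) by force
    moreover from this have "e \<le> degree P" by (intro le_degree) auto
    ultimately have "l \<in> nonconst_cycle_lengths P"
      using el(2) by (auto simp: nonconst_cycle_lengths_def intro!: bexI[of _ e])
    then show ?thesis using P(1) by (simp add: pseudo_injective_def)
  qed
qed

theorem theorem30:
  shows "\<exists>(C :: com) (K :: real). \<forall>(P :: permutation poly) (g :: nat) (B :: permutation)
      (ps :: poly_code) (bs :: perm_code).
    pseudo_injective P g \<longrightarrow> encodes_poly ps P \<longrightarrow> encodes_perm bs B \<longrightarrow>
    (let c = real (code_size ps bs); p = real (max_length B); q = real (max_multiplicity B)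
     in \<exists>t s. run C (initial ps bs) t s \<and> solved s P B \<and>
          real t \<le> K * (c ^ 2 * lg (c * p) * lg q + c * lg p * lg (lg p)))"
proof (intro exI[of _ solver] exI[of _ 24000] allI impI)
  fix P :: "permutation poly" and g B ps bs
  assume P: "pseudo_injective P g" "encodes_poly ps P" and B: "encodes_perm bs B"
  interpret cycle_equation "flatten ps" bs g by (rule encodes_cycle_equation[OF P B])
  define c p q where "c = real (code_size ps bs)" and "p = real (max_length B)" and "q = real (max_multiplicity B)"
  have BD: "B = decode bs" using B by (simp add: encodes_perm_decode)
  have size: "length entries = code_size ps bs" by (simp add: length_entries length_flatten code_size_def)
  \<comment> \<open>The empty array encodes 0, which is not allowed as a listed coefficient.\<close>
  have ne: "as \<noteq> []" if "(i, as) \<in> set ps" for i as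
    using P(2) that unfolding encodes_poly_def encodes_perm_decode by (auto simp: decode_def)
  have "\<exists>s. reach solver (initial ps bs) (8000 * (length entries ^ 2 * capacity)) s \<and>
    (if \<exists>X. solution X
     then \<exists>xs. solution (decode xs) \<and> (\<forall>(n, l)\<in>set xs. 0 < n \<and> 0 < l) \<and> output_starts_with s (1 # perm_words xs)
     else output_starts_with s [0])"
    by (rule solver[OF refl]) (rule ne)
  then obtain s t where t: "t \<le> 8000 * (length entries ^ 2 * capacity)" "run solver (initial ps bs) t s"
    and s: "if \<exists>X. solution X
     then \<exists>xs. solution (decode xs) \<and> (\<forall>(n, l)\<in>set xs. 0 < n \<and> 0 < l) \<and> output_starts_with s (1 # perm_words xs)
     else output_starts_with s [0]"
    unfolding reach_def by blast
  have "solved s P B"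
    using s unfolding solved_def encodes_poly_lhs[OF P(2)] BD encodes_perm_decode by metis
  \<comment> \<open>The constant is 8000 from the step count times 3 from
    \<open>capacity_le_lg\<close>.\<close>
  moreover have "real t \<le> 24000 * (c ^ 2 * lg (c * p) * lg q + c * lg p * lg (lg p))"
  proof -
    have "real total \<le> real ((length (flatten ps) + length bs) * max_length B * max_multiplicity B)"
      using total_le unfolding BD by (simp only: of_nat_le_iff)
    also have "\<dots> = c * p * q" by (simp add: c_def p_def q_def code_size_def length_flatten)
    finally have cap: "real capacity \<le> 3 * (lg (c * p) * lg q)"
      by (rule capacity_le_lg) (simp_all add: c_def p_def q_def)
    have "real t \<le> real (8000 * (length entries ^ 2 * capacity))" using t(1) by (simp only: of_nat_le_iff)
    also have "\<dots> = 8000 * (c ^ 2 * real capacity)" by (simp add: size c_def)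
    also have "\<dots> \<le> 8000 * (c ^ 2 * (3 * (lg (c * p) * lg q)))" by (intro mult_left_mono cap) simp_all
    also have "\<dots> = 24000 * (c ^ 2 * lg (c * p) * lg q)" by simp
    also have "\<dots> \<le> 24000 * (c ^ 2 * lg (c * p) * lg q + c * lg p * lg (lg p))"
      by (simp add: c_def lg_def)
    finally show ?thesis .
  qed
  ultimately show "let c = real (code_size ps bs); p = real (max_length B); q = real (max_multiplicity B)
     in \<exists>t s. run solver (initial ps bs) t s \<and> solved s P B \<and>
          real t \<le> 24000 * (c ^ 2 * lg (c * p) * lg q + c * lg p * lg (lg p))"
    using t(2) unfolding Let_def c_def p_def q_def by blast
qed

end
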